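(* Let four pairwise distinct generalized circles be given in the plane (completed by $\infty$), not all of which are tangent at one and the same point, and suppose that there exist $6$ generalized circles (called solutions) each tangent to all four given ones. Then these $10$ generalized circles (four given ones and six solutions) can be brought by a composition of inversions and similarities to one of the following four kinds of configurations (given ones to given ones, solutions to solutions). (No. 1) Take two intersecting lines with intersection point $O$. The four given circles are two circles inscribed in sector I and the two circles symmetric to them with respect to $O$. The six solutions are the two lines together with the circles of type I and of type II (relative to the two lines) tangent to all four given circles. (No. 2) Take two intersecting lines with intersection point $O$, a circle $\omega$ inscribed in sector I, and the circle $\omega'$ in sector III symmetric to $\omega$ with respect to $O$. The four given generalized circles are the two lines, a circle of type I tangent to $\omega$ externally and to $\omega'$ internally, and the circle symmetric to the latter with respect to the common bisector of sectors II and IV. The six solutions are $\omega$, $\omega'$ and four circles inscribed in sectors II and IV. (No. 3) Take two parallel lines at distance $2$ from each other. The four given generalized circles are the line parallel to them at distance $1$ from each of them, and three circles each tangent to both parallel lines, such that the distance between the centers of neighbouring ones among these three circles equals $2/\sqrt5$. The six solutions are the two parallel lines and four further circles tangent to all four given generalized circles. (No. 4) Take two concentric circles whose ratio of radii is $3+2\sqrt2$ (larger to smaller), and four circles of type B (relative to these concentric circles) whose centers are the vertices of a square. The four given circles are the two concentric circles and two further circles, each of which is tangent to all four of these type B circles, and which lie on perpendicular diameters (that is, the lines joining their centers to the common center of the concentric circles are perpendicular). The six solutions are the four type B circles and two circles of type A tangent to all four given circles.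
   Context: The plane is completed by one point at infinity $\infty$, through which every line passes. A generalized circle is a circle, a line (together with $\infty$), or a point (the point $\infty$ is allowed). Two generalized circles are called tangent (in the generalized sense) if: (1) they are two tangent circles, or a circle and a line tangent to it; or (2) they are two distinct parallel lines (tangent at $\infty$); or (3) one is a point and the other is a circle or line containing this point. Generalized circles are "all tangent at one point" if there is a point $P$ (possibly $\infty$) such that any two of them are tangent at $P$. For two intersecting lines meeting at $O$, the four parts into which they divide the plane are called sectors and are numbered I, II, III, IV counterclockwise; a circle is inscribed in a sector if it lies in this sector and is tangent to both lines. A circle $\alpha$ not passing through $O$ which intersects each of the two lines in two points is of type I if $O$ lies inside $\alpha$, and of type II if $O$ lies outside $\alpha$. For two concentric circles, the smaller $\omega$ and the larger $\Omega$, a circle tangent to both is of type A if it is tangent to $\omega$ externally and of type B if it is tangent to $\omega$ internally. *)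

theory Defs
  imports "HOL-Analysis.Analysis"
begin

section \<open>The completed plane and generalized circles\<close>

text \<open>The plane is the type of complex numbers; \<open>None\<close> is the point at infinity.\<close>

type_synonym epoint = "complex option"

definition circle :: "complex \<Rightarrow> real \<Rightarrow> epoint set" where
  "circle c r = Some ` sphere c r"

definition line :: "complex \<Rightarrow> complex \<Rightarrow> epoint set" where
  "line p d = insert None (Some ` {p + t *\<^sub>R d | t. True})"

definition is_circle :: "epoint set \<Rightarrow> bool" where
  "is_circle X \<longleftrightarrow> (\<exists>c r. r > 0 \<and> X = circle c r)"

definition is_line :: "epoint set \<Rightarrow> bool" where
  "is_line X \<longleftrightarrow> (\<exists>p d. d \<noteq> 0 \<and> X = line p d)"

definition is_point :: "epoint set \<Rightarrow> bool" where
  "is_point X \<longleftrightarrow> (\<exists>P. X = {P})"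

definition gen_circle :: "epoint set \<Rightarrow> bool" where
  "gen_circle X \<longleftrightarrow> is_circle X \<or> is_line X \<or> is_point X"

definition parallel_lines :: "epoint set \<Rightarrow> epoint set \<Rightarrow> bool" where
  "parallel_lines X Y \<longleftrightarrow> (\<exists>p q d. d \<noteq> 0 \<and> X = line p d \<and> Y = line q d)"


section \<open>Tangency\<close>

text \<open>Two circles, or a circle and a line, are tangent at \<open>P\<close> when \<open>P\<close> is their only common point.\<close>

definition tangent_at :: "epoint set \<Rightarrow> epoint set \<Rightarrow> epoint \<Rightarrow> bool" where
  "tangent_at X Y P \<longleftrightarrow>
     (is_circle X \<and> is_circle Y \<or> is_circle X \<and> is_line Y \<or> is_line X \<and> is_circle Y)
       \<and> X \<inter> Y = {P}
   \<or> parallel_lines X Y \<and> X \<noteq> Y \<and> P = None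
   \<or> X = {P} \<and> (is_circle Y \<or> is_line Y) \<and> P \<in> Y
   \<or> Y = {P} \<and> (is_circle X \<or> is_line X) \<and> P \<in> X"

definition tangent :: "epoint set \<Rightarrow> epoint set \<Rightarrow> bool" where
  "tangent X Y \<longleftrightarrow> (\<exists>P. tangent_at X Y P)"

definition all_tangent_at_one_point :: "epoint set set \<Rightarrow> bool" where
  "all_tangent_at_one_point G \<longleftrightarrow>
     (\<exists>P. \<forall>X\<in>G. \<forall>Y\<in>G. X \<noteq> Y \<longrightarrow> tangent_at X Y P)"

definition ext_tangent :: "epoint set \<Rightarrow> epoint set \<Rightarrow> bool" where
  "ext_tangent X Y \<longleftrightarrow> tangent X Y \<and>
     (\<exists>c r d s. r > 0 \<and> s > 0 \<and> X = circle c r \<and> Y = circle d s \<and> ball c r \<inter> ball d s = {})"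

definition int_tangent :: "epoint set \<Rightarrow> epoint set \<Rightarrow> bool" where
  "int_tangent X Y \<longleftrightarrow> tangent X Y \<and>
     (\<exists>c r d s. r > 0 \<and> s > 0 \<and> X = circle c r \<and> Y = circle d s \<and>
        (ball c r \<subseteq> ball d s \<or> ball d s \<subseteq> ball c r))"


section \<open>Compositions of inversions and similarities\<close>

fun inversion :: "complex \<Rightarrow> real \<Rightarrow> epoint \<Rightarrow> epoint" where
  "inversion c r None = Some c"
| "inversion c r (Some z) =
     (if z = c then None else Some (c + (r\<^sup>2 / (dist z c)\<^sup>2) *\<^sub>R (z - c)))"

definition similarity :: "(complex \<Rightarrow> complex) \<Rightarrow> bool" where
  "similarity g \<longleftrightarrow> (\<exists>k>0. \<forall>z w. dist (g z) (g w) = k * dist z w)"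

inductive inv_sim_composition :: "(epoint \<Rightarrow> epoint) \<Rightarrow> bool" where
  inversion: "r > 0 \<Longrightarrow> inv_sim_composition (inversion c r)"
| similarity: "similarity g \<Longrightarrow> inv_sim_composition (map_option g)"
| comp: "inv_sim_composition f \<Longrightarrow> inv_sim_composition h \<Longrightarrow> inv_sim_composition (f \<circ> h)"

definition point_symmetry :: "complex \<Rightarrow> epoint \<Rightarrow> epoint" where
  "point_symmetry p = map_option (\<lambda>z. 2 * p - z)"

text \<open>Reflection in the line through \<open>p\<close> with direction \<open>d\<close>: twice the foot of the perpendicular
  minus the point.\<close>

definition line_symmetry :: "complex \<Rightarrow> complex \<Rightarrow> epoint \<Rightarrow> epoint" where
  "line_symmetry p d =
     map_option (\<lambda>z. 2 * (p + (((z - p) \<bullet> d) / (d \<bullet> d)) *\<^sub>R d) - z)"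


section \<open>Two intersecting lines and their sectors\<close>

text \<open>Two lines meeting at \<open>q\<close> are given by unit directions \<open>u\<close>, \<open>v\<close> such that \<open>v\<close> is obtained
  from \<open>u\<close> by a counterclockwise turn of less than a half-turn. Sectors I, II, III, IV are then
  \<open>sector q u v\<close>, \<open>sector q v (-u)\<close>, \<open>sector q (-u) (-v)\<close>, \<open>sector q (-v) u\<close>, in counterclockwise
  order. Sectors are closed, since an inscribed circle touches both boundary rays.\<close>

definition crossing_directions :: "complex \<Rightarrow> complex \<Rightarrow> bool" where
  "crossing_directions u v \<longleftrightarrow> norm u = 1 \<and> norm v = 1 \<and> Im (cnj u * v) > 0"

definition sector :: "complex \<Rightarrow> complex \<Rightarrow> complex \<Rightarrow> complex set" where
  "sector q u v = {q + s *\<^sub>R u + t *\<^sub>R v | s t. s \<ge> 0 \<and> t \<ge> 0}"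

definition inscribed :: "complex \<Rightarrow> complex \<Rightarrow> complex \<Rightarrow> epoint set \<Rightarrow> bool" where
  "inscribed q u v X \<longleftrightarrow> is_circle X \<and> X \<subseteq> Some ` sector q u v \<and>
     tangent X (line q u) \<and> tangent X (line q v)"

definition type_I :: "complex \<Rightarrow> complex \<Rightarrow> complex \<Rightarrow> epoint set \<Rightarrow> bool" where
  "type_I q u v X \<longleftrightarrow>
     (\<exists>c r. r > 0 \<and> X = circle c r \<and> dist c q < r) \<and>
     card (X \<inter> line q u) = 2 \<and> card (X \<inter> line q v) = 2"

definition type_II :: "complex \<Rightarrow> complex \<Rightarrow> complex \<Rightarrow> epoint set \<Rightarrow> bool" where
  "type_II q u v X \<longleftrightarrow>
     (\<exists>c r. r > 0 \<and> X = circle c r \<and> dist c q > r) \<and>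
     card (X \<inter> line q u) = 2 \<and> card (X \<inter> line q v) = 2"


section \<open>Circles tangent to two concentric circles\<close>

text \<open>\<open>X\<close> is the smaller of the two concentric circles, \<open>Y\<close> the larger.\<close>

definition type_A :: "epoint set \<Rightarrow> epoint set \<Rightarrow> epoint set \<Rightarrow> bool" where
  "type_A X Y Z \<longleftrightarrow> is_circle Z \<and> ext_tangent Z X \<and> tangent Z Y"

definition type_B :: "epoint set \<Rightarrow> epoint set \<Rightarrow> epoint set \<Rightarrow> bool" where
  "type_B X Y Z \<longleftrightarrow> is_circle Z \<and> int_tangent Z X \<and> tangent Z Y"

definition square_vertices :: "complex set \<Rightarrow> bool" where
  "square_vertices V \<longleftrightarrow> (\<exists>a w. w \<noteq> 0 \<and> V = {a, a + w, a + w + \<i> * w, a + \<i> * w})"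


section \<open>The four kinds of configurations\<close>

text \<open>In each case \<open>G\<close> is the set of given generalized circles and \<open>S\<close> the set of solutions.\<close>

definition config1 :: "epoint set set \<Rightarrow> epoint set set \<Rightarrow> bool" where
  "config1 G S \<longleftrightarrow>
     (\<exists>q u v A B.
        crossing_directions u v \<and>
        inscribed q u v A \<and> inscribed q u v B \<and> A \<noteq> B \<and>
        G = {A, B, point_symmetry q ` A, point_symmetry q ` B} \<and>
        S = {line q u, line q v} \<union>
            {X. (type_I q u v X \<or> type_II q u v X) \<and> (\<forall>Y\<in>G. tangent X Y)} \<and>
        card S = 6)"

text \<open>Sectors II and IV are bisected by the line through \<open>q\<close> with direction \<open>v - u\<close>, as \<open>u\<close> and \<open>v\<close>
  are unit vectors.\<close>

definition config2 :: "epoint set set \<Rightarrow> epoint set set \<Rightarrow> bool" where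
  "config2 G S \<longleftrightarrow>
     (\<exists>q u v W W' A T.
        crossing_directions u v \<and>
        inscribed q u v W \<and> W' = point_symmetry q ` W \<and>
        type_I q u v A \<and> ext_tangent A W \<and> int_tangent A W' \<and>
        G = {line q u, line q v, A, line_symmetry q (v - u) ` A} \<and>
        S = {W, W'} \<union> T \<and> card T = 4 \<and>
        (\<forall>X\<in>T. (inscribed q v (- u) X \<or> inscribed q (- v) u X) \<and> (\<forall>Y\<in>G. tangent X Y)))"

text \<open>The parallel lines have unit direction \<open>d\<close> and unit normal \<open>\<i> * d\<close>; the line halfway between
  them passes through \<open>p\<close>. The circle with centre \<open>c2\<close> is the middle one.\<close>

definition config3 :: "epoint set set \<Rightarrow> epoint set set \<Rightarrow> bool" where
  "config3 G S \<longleftrightarrow>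
     (\<exists>p d L M c1 c2 c3 r1 r2 r3 T.
        norm d = 1 \<and> L = line (p + \<i> * d) d \<and> M = line (p - \<i> * d) d \<and>
        r1 > 0 \<and> r2 > 0 \<and> r3 > 0 \<and>
        (\<forall>X\<in>{circle c1 r1, circle c2 r2, circle c3 r3}. tangent X L \<and> tangent X M) \<and>
        c2 \<in> closed_segment c1 c3 \<and> dist c1 c2 = 2 / sqrt 5 \<and> dist c2 c3 = 2 / sqrt 5 \<and>
        G = {line p d, circle c1 r1, circle c2 r2, circle c3 r3} \<and>
        S = {L, M} \<union> T \<and> card T = 4 \<and>
        (\<forall>X\<in>T. is_circle X \<and> (\<forall>Y\<in>G. tangent X Y)))"

definition config4 :: "epoint set set \<Rightarrow> epoint set set \<Rightarrow> bool" where
  "config4 G S \<longleftrightarrow>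
     (\<exists>q r R W V B p1 p2 t1 t2 T.
        r > 0 \<and> R = (3 + 2 * sqrt 2) * r \<and> W = circle q r \<and> V = circle q R \<and>
        card B = 4 \<and> (\<forall>X\<in>B. type_B W V X) \<and>
        square_vertices {c. \<exists>s>0. circle c s \<in> B} \<and>
        t1 > 0 \<and> t2 > 0 \<and> (\<forall>X\<in>B. tangent (circle p1 t1) X \<and> tangent (circle p2 t2) X) \<and>
        p1 \<noteq> q \<and> p2 \<noteq> q \<and> (p1 - q) \<bullet> (p2 - q) = 0 \<and>
        G = {W, V, circle p1 t1, circle p2 t2} \<and>
        S = B \<union> T \<and> card T = 2 \<and>
        (\<forall>X\<in>T. type_A W V X \<and> (\<forall>Y\<in>G. tangent X Y)))"

end

theory Submission
  imports Defs
begin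

text \<open>A circle or line \<open>b \<bar>z\<bar>\<^sup>2 - 2 c \<bullet> z + d = 0\<close> is a vector \<open>(b, c, d)\<close> of the Lorentz space
  \<open>R\<^sup>3\<^sup>,\<^sup>1\<close> with \<open>ip v v = 1\<close>, determined up to sign, and points are null vectors; distinct circles or
  lines are tangent iff the inner product is 1 or -1. Isometries are, up to sign, products of
  reflections, and these act on the plane as inversions and line symmetries, so everything is
  decided by Gram matrices. Points among the given circles or the solutions, and a common point of the
  given circles, are excluded by sending a suitable point to infinity and counting solutions.

  If the four given vectors are independent, a solution is determined by the signs of its inner
  products with them, which form one of 8 classes up to a common sign, and for \<open>h\<close> the inverse of the
  Gram matrix these signs \<open>a\<close> satisfy \<open>a\<^sup>T h a = 1\<close>. Six of the 8 classes satisfying this equation leave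
  only the Gram matrices of configurations 3 and 4. If the given vectors are dependent, they sum to
  zero after a choice of signs; a vector orthogonal to all of them is not null, and configuration 2 or
  1 arises according as it is timelike or spacelike.\<close>

section \<open>Circles as vectors of Lorentz space\<close>

text \<open>What makes counting rigid: among the even products of the four signs, only the product
  of all four is absent from the form \<open>a\<^sup>T h a\<close>. So its deviation from 1 at the
  two missing sign classes is determined up to one factor. If the classes differ in one sign (up to
  a common sign), one given vector is orthogonal to the other three; if they differ in two signs,
  the vectors fall into two pairs. The unit diagonal of the Gram matrix then fixes the factor.

  In the dependent case signs no longer determine a solution: reflection in the common orthogonal
  vector \<open>n\<close> preserves them. Each class holds at most two solutions, so at least three
  classes occur, which forces the relation with coefficients 1 and -1. The vanishing sum in turn
  allows exactly three classes, so each holds two solutions not orthogonal to \<open>n\<close>; this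
  gives the strict inequalities needed for real parameters of the models.

  The models never verify that six tangent circles exist. In coordinates the tangency equations
  leave at most six candidates, and the isometry has carried over six solutions, so all candidates
  are solutions and inherit their tangencies.\<close>

type_synonym cvec = "real \<times> complex \<times> real"

text \<open>The polar form of \<open>c \<bullet> c - b * d\<close>, the discriminant of the circle
  equation. For circles with radii r, s and centre distance D its value on the unit vectors with
  positive first entry is (r^2 + s^2 - D^2) / (2 r s), by the law of cosines the cosine of the angle
  between the radii at a common point.\<close>

definition ip :: "cvec \<Rightarrow> cvec \<Rightarrow> real" where
  "ip v w = fst (snd v) \<bullet> fst (snd w) - (fst v * snd (snd w) + snd (snd v) * fst w) / 2"

lemma ip_triple: "ip (b, c, d) (b', c', d') = c \<bullet> c' - (b * d' + d * b') / 2"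
  by (simp add: ip_def)

lemma ip_commute: "ip v w = ip w v"
  by (simp add: ip_def inner_commute algebra_simps)

lemma ip_bilinear [simp]:
  "ip (u + v) w = ip u w + ip v w" "ip w (u + v) = ip w u + ip w v"
  "ip (u - v) w = ip u w - ip v w" "ip w (u - v) = ip w u - ip w v"
  "ip (a *\<^sub>R v) w = a * ip v w" "ip w (a *\<^sub>R v) = a * ip w v"
  "ip (- v) w = - ip v w" "ip w (- v) = - ip w v"
  "ip 0 w = 0" "ip w 0 = 0"
  by (simp_all add: ip_def inner_simps field_simps)

lemma ip_nondegenerate:
  assumes "\<And>w. ip v w = 0"
  shows "v = 0"
proof -
  obtain b c d where v: "v = (b, c, d)" by (cases v)
  show ?thesis
    using assms[of "(1, 0, 0)"] assms[of "(0, 0, 1)"] assms[of "(0, c, 0)"]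
    by (simp add: v ip_triple zero_prod_def)
qed

text \<open>A finite point is normalized to first entry 1; infinity is the one remaining null ray.
  Isometries preserve null rays but not this normalization, hence the nonzero factors in later
  statements.\<close>

fun lift :: "epoint \<Rightarrow> cvec" where
  "lift None = (0, 0, 1)"
| "lift (Some z) = (1, z, z \<bullet> z)"

definition cyc :: "cvec \<Rightarrow> epoint set" where
  "cyc v = {P. ip v (lift P) = 0}"

lemma cyc_uminus [simp]: "cyc (- v) = cyc v"
  by (simp add: cyc_def)

lemma in_cyc_simps:
  "None \<in> cyc (b, c, d) \<longleftrightarrow> b = 0"
  "Some z \<in> cyc (b, c, d) \<longleftrightarrow> 2 * (c \<bullet> z) = b * (z \<bullet> z) + d"
  by (auto simp: cyc_def ip_triple)

lemma lift_nonzero [simp]: "lift P \<noteq> 0"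
  by (cases P) (auto simp: zero_prod_def)

lemma lift_null [simp]: "ip (lift P) (lift P) = 0"
  by (cases P) (auto simp: ip_triple)

text \<open>Two finite points have product minus half their squared distance, and a finite point has
  product -1/2 with infinity.\<close>

lemma ip_lift_eq_0_iff: "ip (lift P) (lift Q) = 0 \<longleftrightarrow> P = Q"
proof -
  have "ip (lift (Some z)) (lift (Some w)) = - ((z - w) \<bullet> (z - w)) / 2" for z w
    by (simp add: ip_triple inner_simps inner_commute field_simps)
  then show ?thesis
    by (cases P; cases Q) (auto simp: ip_triple)
qed

text \<open>For \<open>b \<noteq> 0\<close> a null vector is a circle of radius 0, and its centre is
  the point; for \<open>b = 0\<close> nullity forces \<open>c = 0\<close>.\<close>

lemma null_is_lift:
  assumes "ip v v = 0" "v \<noteq> 0"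
  obtains P l where "l \<noteq> 0" "v = l *\<^sub>R lift P"
proof -
  obtain b c d where v: "v = (b, c, d)" by (cases v)
  have q: "c \<bullet> c = b * d" using assms(1) by (simp add: v ip_triple)
  show ?thesis
  proof (cases "b = 0")
    case True
    then have "c = 0" using q by simp
    with True assms(2) v have "d \<noteq> 0" "v = d *\<^sub>R lift None" by (auto simp: zero_prod_def)
    then show ?thesis by (rule that)
  next
    case False
    have "v = b *\<^sub>R lift (Some (c /\<^sub>R b))"
      using False q by (simp add: v field_simps)
    with False show ?thesis by (rule that)
  qed
qed

definition circline :: "epoint set \<Rightarrow> bool" where
  "circline X \<longleftrightarrow> is_circle X \<or> is_line X"

lemma circle_eq_cyc:
  assumes "r > 0"
  shows "circle p r = cyc (1 / r, p /\<^sub>R r, (p \<bullet> p - r\<^sup>2) / r)"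
proof -
  have "dist p z = r \<longleftrightarrow> (p - z) \<bullet> (p - z) = r\<^sup>2" for z
    using assms by (auto simp: dist_norm simp flip: power2_norm_eq_inner)
  then have "dist p z = r \<longleftrightarrow> Some z \<in> cyc (1 / r, p /\<^sub>R r, (p \<bullet> p - r\<^sup>2) / r)" for z
    using assms by (auto simp: in_cyc_simps inner_simps inner_commute field_simps)
  moreover have "None \<notin> cyc (1 / r, p /\<^sub>R r, (p \<bullet> p - r\<^sup>2) / r)"
    using assms by (simp add: in_cyc_simps)
  ultimately show ?thesis
    unfolding circle_def sphere_def by (auto simp: image_iff) (metis not_None_eq)
qed

lemma cyc_eq_circle:
  assumes "ip (b, c, d) (b, c, d) = 1" "b \<noteq> 0"
  shows "cyc (b, c, d) = circle (c /\<^sub>R b) (1 / \<bar>b\<bar>)"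
proof -
  have q: "c \<bullet> c - b * d = 1" using assms(1) by (simp add: ip_triple)
  have d: "d = (c \<bullet> c - 1) / b" using q assms(2) by (simp add: field_simps)
  \<comment> \<open>Multiplication by \<open>sgn b\<close> makes the first entry positive, which is
    the form of the vector that \<open>circle_eq_cyc\<close> assigns to a circle.\<close>
  have "circle (c /\<^sub>R b) (1 / \<bar>b\<bar>) = cyc (sgn b *\<^sub>R (b, c, d))"
    using assms(2) unfolding d
    by (subst circle_eq_cyc)
       (auto intro!: arg_cong[where f = cyc] simp: sgn_if field_simps power2_eq_square)
  also have "\<dots> = cyc (b, c, d)"
    using assms(2) cyc_uminus[of "(b, c, d)"] by (auto simp: sgn_if)
  finally show ?thesis by simp
qed

lemma complex_orthogonal_decomposition:
  fixes d x :: complex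
  assumes "norm d = 1"
  shows "x = (x \<bullet> d) *\<^sub>R d + (x \<bullet> (\<i> * d)) *\<^sub>R (\<i> * d)"
proof -
  have 1: "(Re d)\<^sup>2 + (Im d)\<^sup>2 = 1" using assms by (simp add: cmod_def)
  have "Re x = Re x * ((Re d)\<^sup>2 + (Im d)\<^sup>2)" "Im x = Im x * ((Re d)\<^sup>2 + (Im d)\<^sup>2)"
    by (simp_all add: 1)
  then show ?thesis
    by (simp add: complex_eq_iff inner_complex_def power2_eq_square algebra_simps)
qed

lemma cyc_eq_line:
  assumes "norm c = 1"
  shows "cyc (0, c, d) = line ((d / 2) *\<^sub>R c) (\<i> * c)"
proof -
  have n: "c \<bullet> c = 1" using assms by (simp add: dot_square_norm)
  have o: "c \<bullet> (\<i> * c) = 0" by (simp add: inner_complex_def)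
  have "z \<in> {(d / 2) *\<^sub>R c + t *\<^sub>R (\<i> * c) | t. True} \<longleftrightarrow> 2 * (c \<bullet> z) = d" for z
  proof
    assume "2 * (c \<bullet> z) = d"
    then have zc: "z \<bullet> c = d / 2" by (simp add: inner_commute)
    have "z = (d / 2) *\<^sub>R c + (z \<bullet> (\<i> * c)) *\<^sub>R (\<i> * c)"
      using complex_orthogonal_decomposition[OF assms, of z] unfolding zc .
    then show "z \<in> {(d / 2) *\<^sub>R c + t *\<^sub>R (\<i> * c) | t. True}" by blast
  next
    assume "z \<in> {(d / 2) *\<^sub>R c + t *\<^sub>R (\<i> * c) | t. True}"
    then show "2 * (c \<bullet> z) = d" by (auto simp: inner_simps n o)
  qed
  then have "Some z \<in> line ((d / 2) *\<^sub>R c) (\<i> * c) \<longleftrightarrow> Some z \<in> cyc (0, c, d)" for z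
    unfolding line_def in_cyc_simps by (simp add: image_iff)
  moreover have "None \<in> line ((d / 2) *\<^sub>R c) (\<i> * c)" by (simp add: line_def)
  moreover have "None \<in> cyc (0, c, d)" by (simp add: in_cyc_simps)
  ultimately show ?thesis
    by (metis option.exhaust subset_antisym subsetI)
qed

lemma line_eq_cyc:
  assumes "norm d = 1"
  shows "line p d = cyc (0, \<i> * d, 2 * (p \<bullet> (\<i> * d)))"
proof -
  have o: "(\<i> * d) \<bullet> d = 0" by (simp add: inner_complex_def)
  have n: "(\<i> * d) \<bullet> (\<i> * d) = 1" using assms by (simp add: dot_square_norm norm_mult)
  have "z \<in> {p + t *\<^sub>R d | t. True} \<longleftrightarrow> 2 * ((\<i> * d) \<bullet> z) = 2 * (p \<bullet> (\<i> * d))" for z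
  proof
    assume "2 * ((\<i> * d) \<bullet> z) = 2 * (p \<bullet> (\<i> * d))"
    then have "(z - p) \<bullet> (\<i> * d) = 0" by (simp add: inner_simps inner_commute)
    then have "z = p + ((z - p) \<bullet> d) *\<^sub>R d"
      using complex_orthogonal_decomposition[OF assms, of "z - p"] by simp
    then show "z \<in> {p + t *\<^sub>R d | t. True}" by blast
  next
    assume "z \<in> {p + t *\<^sub>R d | t. True}"
    then show "2 * ((\<i> * d) \<bullet> z) = 2 * (p \<bullet> (\<i> * d))"
      using o by (auto simp: inner_simps inner_commute)
  qed
  then have "Some z \<in> line p d \<longleftrightarrow> Some z \<in> cyc (0, \<i> * d, 2 * (p \<bullet> (\<i> * d)))" for z
    unfolding line_def in_cyc_simps by (simp add: image_iff)
  moreover have "None \<in> line p d" by (simp add: line_def)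
  moreover have "None \<in> cyc (0, \<i> * d, 2 * (p \<bullet> (\<i> * d)))" by (simp add: in_cyc_simps)
  ultimately show ?thesis
    by (metis option.exhaust subset_antisym subsetI)
qed

lemma line_scaleR:
  assumes "a \<noteq> 0"
  shows "line p (a *\<^sub>R d) = line p d"
proof -
  have "p + t *\<^sub>R d = p + (t / a) *\<^sub>R a *\<^sub>R d" for t using assms by simp
  then have "p + t *\<^sub>R d \<in> {p + t *\<^sub>R a *\<^sub>R d | t. True}" for t by blast
  moreover have "p + t *\<^sub>R a *\<^sub>R d \<in> {p + t *\<^sub>R d | t. True}" for t
    unfolding scaleR_scaleR by blast
  ultimately have "{p + t *\<^sub>R a *\<^sub>R d | t. True} = {p + t *\<^sub>R d | t. True}" by blast
  then show ?thesis by (simp add: line_def)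
qed

lemma line_eq_line_unit:
  assumes "d \<noteq> 0"
  shows "line p d = line p (sgn d)" and "norm (sgn d) = 1"
  using assms line_scaleR[of "inverse (norm d)" p d] by (simp_all add: sgn_div_norm divide_inverse_commute norm_sgn)

lemma circline_iff: "circline X \<longleftrightarrow> (\<exists>v. ip v v = 1 \<and> X = cyc v)"
proof
  assume "circline X"
  then consider p r where "r > 0" "X = circle p r" | p d where "d \<noteq> 0" "X = line p d"
    by (auto simp: circline_def is_circle_def is_line_def)
  then show "\<exists>v. ip v v = 1 \<and> X = cyc v"
  proof cases
    case 1
    then show ?thesis
      by (intro exI[of _ "(1 / r, p /\<^sub>R r, (p \<bullet> p - r\<^sup>2) / r)"])
         (auto simp: circle_eq_cyc ip_triple field_simps power2_eq_square)
  next
    case 2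
    have "ip (0, \<i> * sgn d, x) (0, \<i> * sgn d, x) = 1" for x
      using line_eq_line_unit(2)[OF 2(1)] by (simp add: ip_triple dot_square_norm norm_mult)
    moreover have "X = cyc (0, \<i> * sgn d, 2 * (p \<bullet> (\<i> * sgn d)))"
      using line_eq_line_unit[OF 2(1)] 2(2) line_eq_cyc by simp
    ultimately show ?thesis by blast
  qed
next
  assume "\<exists>v. ip v v = 1 \<and> X = cyc v"
  then obtain b c d where v: "ip (b, c, d) (b, c, d) = 1" "X = cyc (b, c, d)" by auto
  show "circline X"
  proof (cases "b = 0")
    case True
    then have "(norm c)\<^sup>2 = 1" using v(1) by (simp add: ip_triple dot_square_norm)
    then have "norm c = 1" by (metis abs_1 abs_norm_cancel power2_eq_iff_nonneg norm_ge_zero one_power2 zero_le_one)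
    moreover from this have "\<i> * c \<noteq> 0" by auto
    ultimately show ?thesis
      unfolding circline_def is_line_def using v(2) True cyc_eq_line by blast
  next
    case False
    then have "1 / \<bar>b\<bar> > 0" by simp
    then show ?thesis
      unfolding circline_def is_circle_def using cyc_eq_circle[OF v(1) False] v(2) by blast
  qed
qed

declare split_paired_All [simp del] split_paired_Ex [simp del]

section \<open>Lorentz isometries and compositions of inversions\<close>

definition reflect :: "cvec \<Rightarrow> cvec \<Rightarrow> cvec" where
  "reflect m v = v - (2 * ip v m) *\<^sub>R m"

lemma linear_reflect: "linear (reflect m)"
proof -
  have "linear (\<lambda>v. (2 * ip v m) *\<^sub>R m)"
    by (rule linearI) (simp_all add: distrib_left scaleR_add_left)
  then show ?thesis
    unfolding reflect_def using linear_compose_sub[OF linear_ident] by blast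
qed

lemma ip_reflect:
  assumes "ip m m = 1"
  shows "ip (reflect m v) (reflect m w) = ip v w"
  using assms ip_commute[of m w] by (simp add: reflect_def right_diff_distrib)

lemma reflect_reflect:
  assumes "ip m m = 1"
  shows "reflect m (reflect m v) = v"
  using assms by (simp add: reflect_def right_diff_distrib flip: scaleR_left_diff_distrib)

lemma reflect_uminus: "reflect (- m) = reflect m"
  by (simp add: reflect_def fun_eq_iff)

text \<open>\<open>F\<close> is the action of the isometry \<open>T\<close> on null rays. The factor
  \<open>l\<close> depends on the point and may be negative, so \<open>T\<close> and
  \<open>- T\<close> induce the same \<open>F\<close>; this accounts for isometries that exchange
  the two halves of the null cone.\<close>

definition induces :: "(epoint \<Rightarrow> epoint) \<Rightarrow> (cvec \<Rightarrow> cvec) \<Rightarrow> bool" where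
  "induces F T \<longleftrightarrow> inv_sim_composition F \<and> bij F \<and> linear T \<and>
     (\<forall>v w. ip (T v) (T w) = ip v w) \<and>
     (\<forall>P. \<exists>l. l \<noteq> 0 \<and> lift (F P) = l *\<^sub>R T (lift P))"

lemma induces_cyc:
  assumes "induces F T"
  shows "F ` cyc v = cyc (T v)"
proof -
  have *: "F P \<in> cyc (T v) \<longleftrightarrow> P \<in> cyc v" for P
  proof -
    obtain l where "l \<noteq> 0" "lift (F P) = l *\<^sub>R T (lift P)"
      using assms unfolding induces_def by blast
    moreover have "ip (T v) (T (lift P)) = ip v (lift P)"
      using assms unfolding induces_def by blast
    ultimately show ?thesis by (simp add: cyc_def)
  qed
  have "surj F" using assms by (simp add: induces_def bij_is_surj)
  then have "Q \<in> F ` cyc v" if "Q \<in> cyc (T v)" for Q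
  proof -
    obtain P where "Q = F P" using \<open>surj F\<close> by blast
    then show ?thesis using that * by blast
  qed
  then show ?thesis using * by blast
qed

lemma induces_comp:
  assumes "induces F T" "induces F' T'"
  shows "induces (F \<circ> F') (T \<circ> T')"
proof -
  have "\<exists>l. l \<noteq> 0 \<and> lift ((F \<circ> F') P) = l *\<^sub>R (T \<circ> T') (lift P)" for P
  proof -
    obtain l where l: "l \<noteq> 0" "lift (F' P) = l *\<^sub>R T' (lift P)"
      using assms(2) unfolding induces_def by blast
    obtain k where k: "k \<noteq> 0" "lift (F (F' P)) = k *\<^sub>R T (lift (F' P))"
      using assms(1) unfolding induces_def by blast
    have "linear T" using assms(1) by (simp add: induces_def)
    then have "lift (F (F' P)) = (k * l) *\<^sub>R T (T' (lift P))"
      using k(2) l(2) by (simp add: linear_cmul)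
    then show ?thesis using k l by (intro exI[of _ "k * l"]) simp
  qed
  then show ?thesis
    using assms unfolding induces_def
    by (auto intro!: inv_sim_composition.comp bij_comp linear_compose)
qed

lemma induces_uminus:
  assumes "induces F T"
  shows "induces F (\<lambda>v. - T v)"
proof -
  have "\<exists>l. l \<noteq> 0 \<and> lift (F P) = l *\<^sub>R - T (lift P)" for P
  proof -
    obtain l where "l \<noteq> 0" "lift (F P) = l *\<^sub>R T (lift P)"
      using assms unfolding induces_def by blast
    then show ?thesis by (intro exI[of _ "- l"]) simp
  qed
  then show ?thesis
    using assms unfolding induces_def by (auto intro: linear_compose_neg)
qed

lemma bij_involution:
  assumes "\<And>P. F (F P) = P"
  shows "bij F"
  by (rule o_bij[of F F]) (simp_all add: fun_eq_iff assms)

lemma inversion_involution: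
  assumes "r > 0"
  shows "inversion p r (inversion p r P) = P"
proof (cases P)
  case (Some z)
  show ?thesis
  proof (cases "z = p")
    case False
    define k where "k = r\<^sup>2 / (dist z p)\<^sup>2"
    have k: "k > 0" using False assms by (simp add: k_def)
    have "dist (p + k *\<^sub>R (z - p)) p = k * dist z p"
      using k by (simp add: dist_norm)
    then have "(dist (p + k *\<^sub>R (z - p)) p)\<^sup>2 = k * (k * (dist z p)\<^sup>2)"
      by (simp add: power2_eq_square)
    also have "k * (dist z p)\<^sup>2 = r\<^sup>2" using False by (simp add: k_def)
    finally have "r\<^sup>2 / (dist (p + k *\<^sub>R (z - p)) p)\<^sup>2 * k = 1"
      using k assms by simp
    moreover have "p + a *\<^sub>R (p + k *\<^sub>R (z - p) - p) = z" if "a * k = 1" for a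
      using that by simp
    ultimately have "p + (r\<^sup>2 / (dist (p + k *\<^sub>R (z - p)) p)\<^sup>2) *\<^sub>R (p + k *\<^sub>R (z - p) - p) = z"
      by blast
    then show ?thesis using Some False k by (simp flip: k_def)
  qed (use Some in simp)
qed simp

lemma induces_inversion:
  assumes "r > 0"
  shows "induces (inversion p r) (reflect (1 / r, p /\<^sub>R r, (p \<bullet> p - r\<^sup>2) / r))"
    (is "induces _ (reflect ?m)")
proof -
  have m: "ip ?m ?m = 1"
    using assms by (simp add: ip_triple field_simps power2_eq_square)
  have "\<exists>l. l \<noteq> 0 \<and> lift (inversion p r P) = l *\<^sub>R reflect ?m (lift P)" for P
  proof (cases P)
    case None
    show ?thesis
      by (intro exI[of _ "r\<^sup>2"])
         (use assms None in \<open>simp add: reflect_def ip_triple field_simps power2_eq_square\<close>)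
  next
    case (Some z)
    have q: "2 * ip (lift P) ?m = (r\<^sup>2 - (z - p) \<bullet> (z - p)) / r"
      using assms Some by (simp add: ip_triple inner_simps inner_commute field_simps power2_eq_square)
    define D where "D = (z - p) \<bullet> (z - p)"
    have D: "z \<bullet> z = D + 2 * (p \<bullet> z) - p \<bullet> p"
      by (simp add: D_def inner_simps inner_commute)
    show ?thesis
    proof (cases "z = p")
      case True
      then show ?thesis
        by (intro exI[of _ "1 / r\<^sup>2"])
           (use assms Some q in \<open>simp add: reflect_def field_simps power2_eq_square\<close>)
    next
      case False
      then have "D > 0" by (simp add: D_def)
      have dist: "(dist z p)\<^sup>2 = D"
        by (simp add: D_def dist_norm power2_norm_eq_inner)
      show ?thesis
      \<comment> \<open>The first entry dictates the factor: reflection turns the entry 1 of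
        \<open>lift (Some z)\<close> into D / r^2, and a lift of a finite point has first entry
        1.\<close>
      proof (intro exI[of _ "r\<^sup>2 / D"] conjI)
        show "r\<^sup>2 / D \<noteq> 0" using assms \<open>D > 0\<close> by simp
        have 1: "r\<^sup>2 / D * (1 - (r\<^sup>2 - D) / r * (1 / r)) = 1"
          using assms \<open>D > 0\<close> by (simp add: field_simps power2_eq_square)
        have 2: "(r\<^sup>2 / D) *\<^sub>R (z - ((r\<^sup>2 - D) / r) *\<^sub>R (p /\<^sub>R r)) = p + (r\<^sup>2 / D) *\<^sub>R (z - p)"
          using assms \<open>D > 0\<close>
          by (simp add: complex_eq_iff field_simps power2_eq_square)
        have 3: "r\<^sup>2 / D * (z \<bullet> z - (r\<^sup>2 - D) / r * ((p \<bullet> p - r\<^sup>2) / r)) =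
            (p + (r\<^sup>2 / D) *\<^sub>R (z - p)) \<bullet> (p + (r\<^sup>2 / D) *\<^sub>R (z - p))"
        proof -
          have "(p + k *\<^sub>R w) \<bullet> (p + k *\<^sub>R w) = p \<bullet> p + 2 * k * (p \<bullet> w) + k * k * (w \<bullet> w)"
            for k and w :: complex
            by (simp add: inner_add_left inner_add_right inner_commute[of w p] algebra_simps)
          then have "(p + (r\<^sup>2 / D) *\<^sub>R (z - p)) \<bullet> (p + (r\<^sup>2 / D) *\<^sub>R (z - p)) =
              p \<bullet> p + 2 * (r\<^sup>2 / D) * (p \<bullet> z - p \<bullet> p) + r\<^sup>2 / D * (r\<^sup>2 / D) * D"
            unfolding D_def inner_diff_right[of p z p, symmetric] .
          moreover have "r\<^sup>2 / D * (D + 2 * (p \<bullet> z) - p \<bullet> p - (r\<^sup>2 - D) / r * ((p \<bullet> p - r\<^sup>2) / r)) =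
              p \<bullet> p + 2 * (r\<^sup>2 / D) * (p \<bullet> z - p \<bullet> p) + r\<^sup>2 / D * (r\<^sup>2 / D) * D"
            using assms \<open>D > 0\<close> by (simp add: field_simps power2_eq_square)
          ultimately show ?thesis
            unfolding D by presburger
        qed
        show "lift (inversion p r P) = (r\<^sup>2 / D) *\<^sub>R reflect ?m (lift P)"
          using Some False 1 2 3 q by (simp add: reflect_def dist flip: D_def)
      qed
    qed
  qed
  then show ?thesis
    unfolding induces_def using m assms
    by (auto intro!: inv_sim_composition.inversion bij_involution linear_reflect
        simp: inversion_involution ip_reflect)
qed

lemma induces_line_reflection:
  assumes "norm c = 1"
  shows "induces (map_option (\<lambda>z. z - (2 * (c \<bullet> z) - d) *\<^sub>R c)) (reflect (0, c, d))"
    (is "induces (map_option ?g) (reflect ?m)")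
proof -
  have c: "c \<bullet> c = 1" using assms by (simp add: dot_square_norm)
  have m: "ip ?m ?m = 1" by (simp add: ip_triple c)
  have "dist (?g z) (?g w) = dist z w" for z w
  proof -
    have e: "?g z - ?g w = (z - w) - (2 * (c \<bullet> (z - w))) *\<^sub>R c"
      by (simp add: algebra_simps inner_diff_right)
    have "(?g z - ?g w) \<bullet> (?g z - ?g w) = (z - w) \<bullet> (z - w)"
      unfolding e by (simp add: inner_diff_left inner_diff_right c inner_commute algebra_simps)
    then show ?thesis by (simp add: dist_norm norm_eq_sqrt_inner)
  qed
  then have "similarity ?g"
    unfolding similarity_def by (intro exI[of _ 1]) simp
  moreover have "map_option ?g (map_option ?g P) = P" for P
  proof -
    have 1: "2 * (c \<bullet> (?g z)) - d = - (2 * (c \<bullet> z) - d)" for z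
      by (simp add: inner_diff_right c)
    have "w - k *\<^sub>R c = z" if "w = z - l *\<^sub>R c" "k = - l" for w z k l
      using that by simp
    from this[OF refl 1] have gg: "?g (?g z) = z" for z .
    show ?thesis by (cases P) (simp_all only: option.map gg)
  qed
  moreover have "\<exists>l. l \<noteq> 0 \<and> lift (map_option ?g P) = l *\<^sub>R reflect ?m (lift P)" for P
  proof (intro exI[of _ 1] conjI)
    show "lift (map_option ?g P) = 1 *\<^sub>R reflect ?m (lift P)"
    proof (cases P)
      case (Some z)
      have "2 * ip (lift P) ?m = 2 * (c \<bullet> z) - d"
        using Some by (simp add: ip_triple inner_commute)
      moreover have "?g z \<bullet> ?g z = z \<bullet> z - (2 * (c \<bullet> z) - d) * d"
        by (simp add: inner_diff_left inner_diff_right c inner_commute algebra_simps)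
      ultimately show ?thesis using Some by (simp add: reflect_def)
    qed (simp add: reflect_def ip_triple)
  qed simp
  ultimately show ?thesis
    unfolding induces_def using m
    by (auto intro!: inv_sim_composition.similarity bij_involution linear_reflect simp: ip_reflect)
qed

lemma ex_induces_reflect:
  assumes "ip m m = 1"
  shows "\<exists>F. induces F (reflect m)"
proof -
  obtain b c d where m: "m = (b, c, d)" by (cases m)
  have q: "c \<bullet> c - b * d = 1" using assms by (simp add: m ip_triple)
  have *: "\<exists>F. induces F (reflect (b, c, d))" if "b > 0" "c \<bullet> c - b * d = 1" for b c d
  proof -
    have "d = (c \<bullet> c - 1) / b" using that by (simp add: field_simps)
    then have "(1 / (1 / b), (c /\<^sub>R b) /\<^sub>R (1 / b), ((c /\<^sub>R b) \<bullet> (c /\<^sub>R b) - (1 / b)\<^sup>2) / (1 / b)) = (b, c, d)"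
      using that by (simp add: field_simps power2_eq_square)
    then show ?thesis
      using induces_inversion[of "1 / b" "c /\<^sub>R b"] \<open>b > 0\<close> by auto
  qed
  consider "b > 0" | "b < 0" | "b = 0" by linarith
  then show ?thesis
  proof cases
    case 1
    then show ?thesis using * q m by blast
  next
    case 2
    then have "\<exists>F. induces F (reflect (- b, - c, - d))" using q by (intro *) auto
    then show ?thesis using reflect_uminus[of m] m by simp
  next
    case 3
    then have "norm c = 1" using q by (simp add: norm_eq_sqrt_inner)
    then show ?thesis using induces_line_reflection m 3 by blast
  qed
qed

text \<open>The sign: one of the differences \<open>v - w\<close> and \<open>v + w\<close> is spacelike.\<close>

lemma ex_move_unit_vector:
  assumes "ip v v = 1" "ip w w = 1"
  shows "\<exists>R. linear R \<and> (\<forall>x y. ip (R x) (R y) = ip x y) \<and> R v = w \<and>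
    (\<forall>x. ip x v = 0 \<longrightarrow> ip x w = 0 \<longrightarrow> R x = x) \<and>
    (\<forall>T. (\<exists>F. induces F (R \<circ> T)) \<longrightarrow> (\<exists>F. induces F T))"
    (is "\<exists>R. ?P R")
proof -
  \<comment> \<open>A reflection is its own inverse and induced by a composition of inversions, so
    it can be cancelled from the left.\<close>
  have undo: "\<exists>F. induces F T" if "ip m m = 1" "\<exists>F. induces F (reflect m \<circ> T)" for m T
  proof -
    have "reflect m \<circ> (reflect m \<circ> T) = T"
      using reflect_reflect[OF that(1)] by (simp add: fun_eq_iff)
    then show ?thesis using that ex_induces_reflect induces_comp by metis
  qed
  have swap: "\<exists>m. ip m m = 1 \<and> reflect m v = w \<and> (\<forall>x. ip x v = 0 \<longrightarrow> ip x w = 0 \<longrightarrow> reflect m x = x)"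
    if "ip v w < 1" "ip v v = 1" "ip w w = 1" for v w
  proof -
    define k where "k = sqrt (2 - 2 * ip v w)"
    have k: "k > 0" "k\<^sup>2 = 2 - 2 * ip v w" using that by (simp_all add: k_def)
    have "ip ((v - w) /\<^sub>R k) ((v - w) /\<^sub>R k) = (ip v v - 2 * ip v w + ip w w) / k\<^sup>2"
      by (simp add: ip_commute[of w v] divide_inverse power2_eq_square algebra_simps)
    also have "\<dots> = 1"
      using that k by simp
    finally have "ip ((v - w) /\<^sub>R k) ((v - w) /\<^sub>R k) = 1" .
    moreover have "2 * ip v ((v - w) /\<^sub>R k) = k"
      using that k by (simp add: divide_simps power2_eq_square)
    then have "reflect ((v - w) /\<^sub>R k) v = w"
      using k by (simp add: reflect_def)
    moreover have "reflect ((v - w) /\<^sub>R k) x = x" if "ip x v = 0" "ip x w = 0" for x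
      using that by (simp add: reflect_def)
    ultimately show ?thesis by blast
  qed
  show ?thesis
  proof (cases "ip v w < 1")
    case True
    from swap[OF this assms] obtain m where m: "ip m m = 1" "reflect m v = w"
      "\<forall>x. ip x v = 0 \<longrightarrow> ip x w = 0 \<longrightarrow> reflect m x = x" by blast
    then have "?P (reflect m)" using undo[OF m(1)] by (simp add: ip_reflect linear_reflect)
    then show ?thesis by blast
  next
    case False
    then have "ip v (- w) < 1" by simp
    from swap[OF this] assms obtain m where m: "ip m m = 1" "reflect m v = - w"
      "\<forall>x. ip x v = 0 \<longrightarrow> ip x w = 0 \<longrightarrow> reflect m x = x" by auto
    \<comment> \<open>\<open>reflect m\<close> sends \<open>v\<close> to \<open>- w\<close>, and the
      reflection in \<open>w\<close> itself repairs the sign. Vectors orthogonal to \<open>v\<close>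
      and \<open>w\<close> are fixed by both.\<close>
    have "?P (reflect w \<circ> reflect m)"
    proof (intro conjI allI impI)
      show "linear (reflect w \<circ> reflect m)" by (intro linear_compose linear_reflect)
      show "ip ((reflect w \<circ> reflect m) x) ((reflect w \<circ> reflect m) y) = ip x y" for x y
        using m(1) assms(2) by (simp add: ip_reflect)
      show "(reflect w \<circ> reflect m) v = w"
        using m(2) assms(2) by (simp add: reflect_def[of w] scaleR_2)
      show "(reflect w \<circ> reflect m) x = x" if "ip x v = 0" "ip x w = 0" for x
        using m(3) that by (simp add: reflect_def[of w])
      show "\<exists>F. induces F T" if "\<exists>F. induces F (reflect w \<circ> reflect m \<circ> T)" for T
        using undo[OF m(1), of T] undo[OF assms(2), of "reflect m \<circ> T"] that
        unfolding comp_assoc by blast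
    qed
    then show ?thesis by blast
  qed
qed

text \<open>The theorem of Cartan and Dieudonne by hand: products of reflections bring the images of
  the spacelike basis vectors \<open>e1\<close>, \<open>e2\<close>, \<open>e3\<close> back one after
  the other. Each such product fixes what is orthogonal to both the vector and its target, so the
  basis vectors already restored stay in place. What remains can only send \<open>e0\<close> to plus
  or minus itself.\<close>

lemma ex_induces_isometry:
  assumes "linear T" "\<And>v w. ip (T v) (T w) = ip v w"
  shows "\<exists>F. induces F T"
proof -
  define e0 e1 e2 e3 :: cvec where
    "e0 = (1, 0, 1)" and "e1 = (0, 1, 0)" and "e2 = (0, \<i>, 0)" and "e3 = (1, 0, -1)"
  note e_defs = e0_def e1_def e2_def e3_def
  have e: "ip e0 e0 = -1" "ip e1 e1 = 1" "ip e2 e2 = 1" "ip e3 e3 = 1"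
    "ip e0 e1 = 0" "ip e0 e2 = 0" "ip e0 e3 = 0" "ip e1 e2 = 0" "ip e1 e3 = 0" "ip e2 e3 = 0"
    "ip e1 e0 = 0" "ip e2 e0 = 0" "ip e3 e0 = 0" "ip e2 e1 = 0" "ip e3 e1 = 0" "ip e3 e2 = 0"
    by (simp_all add: e_defs ip_triple inner_complex_def)
  have expand: "v = (- ip v e0) *\<^sub>R e0 + ip v e1 *\<^sub>R e1 + ip v e2 *\<^sub>R e2 + ip v e3 *\<^sub>R e3" for v
    by (cases v) (simp add: e_defs ip_triple inner_complex_def complex_eq_iff field_simps)
  have "ip (T e1) (T e1) = 1" "ip e1 e1 = 1" using assms(2) e by simp_all
  from ex_move_unit_vector[OF this]
  obtain R1 where R1: "linear R1" "\<And>x y. ip (R1 x) (R1 y) = ip x y" "R1 (T e1) = e1"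
    "\<And>S. \<exists>F. induces F (R1 \<circ> S) \<Longrightarrow> \<exists>F. induces F S"
    by blast
  define T1 where "T1 = R1 \<circ> T"
  have T1: "linear T1" "\<And>x y. ip (T1 x) (T1 y) = ip x y" "T1 e1 = e1"
    using assms R1 by (auto simp: T1_def intro: linear_compose)
  have "ip (T1 e2) (T1 e2) = 1" "ip e2 e2 = 1" using T1(2) e by simp_all
  from ex_move_unit_vector[OF this]
  obtain R2 where R2: "linear R2" "\<And>x y. ip (R2 x) (R2 y) = ip x y" "R2 (T1 e2) = e2"
    "\<And>x. ip x (T1 e2) = 0 \<Longrightarrow> ip x e2 = 0 \<Longrightarrow> R2 x = x"
    "\<And>S. \<exists>F. induces F (R2 \<circ> S) \<Longrightarrow> \<exists>F. induces F S"
    by blast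
  define T2 where "T2 = R2 \<circ> T1"
  have "R2 e1 = e1" using R2(4) T1(2)[of e1 e2] T1(3) e by simp
  then have T2: "linear T2" "\<And>x y. ip (T2 x) (T2 y) = ip x y" "T2 e1 = e1" "T2 e2 = e2"
    using T1 R2 by (auto simp: T2_def intro: linear_compose)
  have "ip (T2 e3) (T2 e3) = 1" "ip e3 e3 = 1" using T2(2) e by simp_all
  from ex_move_unit_vector[OF this]
  obtain R3 where R3: "linear R3" "\<And>x y. ip (R3 x) (R3 y) = ip x y" "R3 (T2 e3) = e3"
    "\<And>x. ip x (T2 e3) = 0 \<Longrightarrow> ip x e3 = 0 \<Longrightarrow> R3 x = x"
    "\<And>S. \<exists>F. induces F (R3 \<circ> S) \<Longrightarrow> \<exists>F. induces F S"
    by blast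
  define T3 where "T3 = R3 \<circ> T2"
  have "R3 e1 = e1" "R3 e2 = e2"
    using R3(4) T2(2)[of e1 e3] T2(2)[of e2 e3] T2(3,4) e by simp_all
  then have T3: "linear T3" "\<And>x y. ip (T3 x) (T3 y) = ip x y" "T3 e1 = e1" "T3 e2 = e2" "T3 e3 = e3"
    using T2 R3 by (auto simp: T3_def intro: linear_compose)
  have T3_eq: "T3 v = (- ip v e0) *\<^sub>R T3 e0 + ip v e1 *\<^sub>R e1 + ip v e2 *\<^sub>R e2 + ip v e3 *\<^sub>R e3" for v
    by (subst expand[of v]) (simp only: linear_add[OF T3(1)] linear_cmul[OF T3(1)] T3)
  define k where "k = - ip (T3 e0) e0"
  have "ip (T3 e0) e1 = 0" "ip (T3 e0) e2 = 0" "ip (T3 e0) e3 = 0"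
    using T3(2)[of e0 e1] T3(2)[of e0 e2] T3(2)[of e0 e3] T3(3-5) e by simp_all
  then have k: "T3 e0 = k *\<^sub>R e0"
    using expand[of "T3 e0"] by (simp add: k_def)
  have "k * k = 1" using T3(2)[of e0 e0] by (simp add: k e)
  then have "k = 1 \<or> k = -1" by (simp add: square_eq_1_iff)
  have "\<exists>F. induces F T3"
  proof (cases "k = 1")
    case True
    then have "T3 v = v" for v using expand[of v] T3_eq[of v] k by simp
    \<comment> \<open>The identity, too, has to be written as a composition of generators; a
      reflection performed twice serves.\<close>
    then have "T3 = reflect e1 \<circ> reflect e1"
      using reflect_reflect[OF e(2)] by (simp add: fun_eq_iff)
    then show ?thesis
      using ex_induces_reflect[OF e(2)] induces_comp by blast
  next
    case False
    then have k': "T3 e0 = - e0" using k \<open>k = 1 \<or> k = -1\<close> by simp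
    have "T3 v = ip v e0 *\<^sub>R e0 + ip v e1 *\<^sub>R e1 + ip v e2 *\<^sub>R e2 + ip v e3 *\<^sub>R e3" for v
      using T3_eq[of v] k' by simp
    \<comment> \<open>Reversing \<open>e0\<close> alone is minus the map that reverses
      \<open>e1\<close>, \<open>e2\<close> and \<open>e3\<close>, and that map is the product of the
      three orthogonal reflections.\<close>
    then have "- (reflect e1 \<circ> (reflect e2 \<circ> reflect e3)) v = T3 v" for v
      by (cases v) (simp add: reflect_def e_defs ip_triple inner_complex_def complex_eq_iff field_simps)
    then have T3_neg: "T3 = (\<lambda>v. - (reflect e1 \<circ> (reflect e2 \<circ> reflect e3)) v)"
      by (simp add: fun_eq_iff)
    obtain F1 F2 F3 where "induces F1 (reflect e1)" "induces F2 (reflect e2)" "induces F3 (reflect e3)"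
      using ex_induces_reflect e by metis
    then have "induces (F1 \<circ> (F2 \<circ> F3)) (reflect e1 \<circ> (reflect e2 \<circ> reflect e3))"
      by (intro induces_comp)
    then show ?thesis unfolding T3_neg by (blast intro: induces_uminus)
  qed
  then show ?thesis
    using R1(4) R2(5) R3(5) unfolding T1_def T2_def T3_def by blast
qed

lemma induces_bij: "induces F T \<Longrightarrow> bij F"
  and induces_linear: "induces F T \<Longrightarrow> linear T"
  and induces_ip: "induces F T \<Longrightarrow> ip (T v) (T w) = ip v w"
  and induces_inv_sim: "induces F T \<Longrightarrow> inv_sim_composition F"
  by (simp_all add: induces_def)

lemma induces_surj_linear:
  assumes "induces F T"
  shows "surj T"
proof -
  have "v = 0" if "T v = 0" for v
    using ip_nondegenerate[of v] induces_ip[OF assms, of v] that by simp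
  then have "inj T"
    using induces_linear[OF assms] by (simp add: linear_injective_0)
  then show ?thesis
    using induces_linear[OF assms] linear_injective_imp_surjective by blast
qed

lemma induces_circline_iff:
  assumes "induces F T"
  shows "circline (F ` X) \<longleftrightarrow> circline X"
proof
  assume "circline X"
  then obtain v where "ip v v = 1" "X = cyc v" by (auto simp: circline_iff)
  then show "circline (F ` X)"
    unfolding circline_iff using induces_cyc[OF assms] induces_ip[OF assms] by metis
next
  assume "circline (F ` X)"
  then obtain w where w: "ip w w = 1" "F ` X = cyc w" by (auto simp: circline_iff)
  obtain v where v: "w = T v" using induces_surj_linear[OF assms] by blast
  have "F ` X = F ` cyc v" using w(2) v induces_cyc[OF assms] by simp
  then have "X = cyc v"
    using induces_bij[OF assms] by (simp add: bij_is_inj inj_image_eq_iff)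
  moreover have "ip v v = 1" using w(1) v induces_ip[OF assms] by simp
  ultimately show "circline X" unfolding circline_iff by blast
qed

lemma ex_induces_to_infinity: "\<exists>F T. induces F T \<and> F P = None"
proof (cases P)
  case None
  then show ?thesis using induces_line_reflection[of 1 0] by fastforce
next
  case (Some p)
  then show ?thesis using induces_inversion[of 1 p] by fastforce
qed

section \<open>Tangency and the inner product\<close>

lemma ex_meeting_point:
  fixes c c' :: complex
  assumes "Im (cnj c * c') \<noteq> 0"
  shows "\<exists>z. c \<bullet> z = a \<and> c' \<bullet> z = b"
proof -
  define k where "k = Im (cnj c * c')"
  have k: "k \<noteq> 0" using assms by (simp add: k_def)
  have 1: "c \<bullet> (\<i> * c') = - k" "c' \<bullet> (\<i> * c) = k" "c \<bullet> (\<i> * c) = 0" "c' \<bullet> (\<i> * c') = 0"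
    by (simp_all add: k_def inner_complex_def)
  show ?thesis
    by (intro exI[of _ "(- a / k) *\<^sub>R (\<i> * c') + (b / k) *\<^sub>R (\<i> * c)"])
       (use k in \<open>simp only: inner_add_right inner_scaleR_right 1, simp\<close>)
qed

lemma unit_parallel:
  assumes "norm c = 1" "norm c' = 1" "Im (cnj c * c') = 0"
  shows "c' = c \<or> c' = - c"
proof -
  have "c' \<bullet> (\<i> * c) = Im (cnj c * c')" by (simp add: inner_complex_def)
  then have 1: "c' = (c' \<bullet> c) *\<^sub>R c"
    using complex_orthogonal_decomposition[OF assms(1), of c'] assms(3) by simp
  then have "\<bar>c' \<bullet> c\<bar> = 1" using assms by (metis abs_1 mult.right_neutral norm_scaleR)
  then have "c' \<bullet> c = 1 \<or> c' \<bullet> c = -1" by linarith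
  then show ?thesis using 1 by (metis scaleR_minus1_left scaleR_one)
qed

lemma line_unit_norm:
  assumes "ip (0, c, d) (0, c, d) = 1"
  shows "norm c = 1"
  using assms by (simp add: ip_triple norm_eq_sqrt_inner)

lemma lines_meet_only_at_infinity:
  assumes "norm c = 1" "norm c' = 1" "cyc (0, c, d) \<inter> cyc (0, c', d') = {None}"
  shows "c' = c \<or> c' = - c"
proof (rule ccontr)
  assume "\<not> ?thesis"
  then have "Im (cnj c * c') \<noteq> 0" using unit_parallel assms by blast
  from ex_meeting_point[OF this, of "d / 2" "d' / 2"] obtain z
    where "c \<bullet> z = d / 2" "c' \<bullet> z = d' / 2" by blast
  then have "Some z \<in> cyc (0, c, d) \<inter> cyc (0, c', d')" by (simp add: in_cyc_simps)
  then show False using assms(3) by simp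
qed

text \<open>With the common point sent to infinity both are lines without a finite common point, so
  their unit normals agree up to sign. They differ because a line also has finite points.\<close>

lemma cyc_Int_singleton_imp:
  assumes "ip v v = 1" "ip w w = 1" "cyc v \<inter> cyc w = {P}"
  shows "\<bar>ip v w\<bar> = 1" and "cyc v \<noteq> cyc w"
proof -
  obtain F T where F: "induces F T" "F P = None" using ex_induces_to_infinity by blast
  obtain b c d where v: "T v = (b, c, d)" by (cases "T v")
  obtain b' c' d' where w: "T w = (b', c', d')" by (cases "T w")
  have "inj F" using F induces_bij bij_is_inj by blast
  then have I: "cyc (T v) \<inter> cyc (T w) = {None}"
    using assms(3) F(2) induces_cyc[OF F(1)] by (metis image_Int image_empty image_insert)
  then have b: "b = 0" "b' = 0"
    using v w in_cyc_simps(1) by (metis Int_iff insertI1)+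
  have n: "norm c = 1" "norm c' = 1"
    using assms induces_ip[OF F(1), of v v] induces_ip[OF F(1), of w w] v w b
    by (auto intro!: line_unit_norm)
  then have cc: "c' = c \<or> c' = - c" using I v w b lines_meet_only_at_infinity by metis
  have "ip v w = c \<bullet> c'" using induces_ip[OF F(1), of v w] v w b by (simp add: ip_triple)
  then show "\<bar>ip v w\<bar> = 1" using cc n by (auto simp: dot_square_norm)
  have "Some ((d / 2) *\<^sub>R c) \<in> cyc (T v)"
    using n b v by (simp add: in_cyc_simps dot_square_norm)
  then have "cyc (T v) \<noteq> cyc (T w)" using I by auto
  then show "cyc v \<noteq> cyc w" using induces_cyc[OF F(1)] by metis
qed

text \<open>One of \<open>v - w\<close> and \<open>v + w\<close> is a nonzero null vector, and its
  ray is the point of contact: a common point is orthogonal to this vector, and only proportional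
  null vectors are orthogonal.\<close>

lemma cyc_Int_singletonI:
  assumes "ip v v = 1" "ip w w = 1" "\<bar>ip v w\<bar> = 1" "cyc v \<noteq> cyc w"
  shows "\<exists>P. cyc v \<inter> cyc w = {P}"
proof -
  define w' where "w' = ip v w *\<^sub>R w"
  have k: "ip v w = 1 \<or> ip v w = -1" using assms(3) by linarith
  then have w': "ip w' w' = 1" "ip v w' = 1" "cyc w' = cyc w"
    using assms by (auto simp: w'_def)
  have "v - w' \<noteq> 0" using w' assms(4) by auto
  moreover have "ip (v - w') (v - w') = 0" using w' assms ip_commute[of w' v] by simp
  ultimately obtain P l where P: "l \<noteq> 0" "v - w' = l *\<^sub>R lift P"
    using null_is_lift by metis
  have "Q \<in> cyc v \<inter> cyc w' \<longleftrightarrow> Q = P" for Q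
  proof
    assume "Q \<in> cyc v \<inter> cyc w'"
    then have "ip (v - w') (lift Q) = 0" by (simp add: cyc_def)
    then show "Q = P" using P by (auto simp: ip_lift_eq_0_iff)
  next
    have "ip v (v - w') = 0" "ip w' (v - w') = 0"
      using w' assms ip_commute[of w' v] by simp_all
    then have "P \<in> cyc v \<inter> cyc w'" using P by (simp add: cyc_def)
    then show "Q \<in> cyc v \<inter> cyc w'" if "Q = P" using that by simp
  qed
  then show ?thesis using w'(3) by blast
qed

text \<open>A circle or line meets itself in all its points, whereas two of them with a single
  common point are different.\<close>

lemma circline_not_singleton: "\<not> circline {P}"
  unfolding circline_iff using cyc_Int_singleton_imp(2) by (metis Int_absorb)

text \<open>Distinct parallel lines are exactly the pairs of lines with a single common point,
  namely infinity. So every tangency between circles and lines becomes the same condition on the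
  intersection, invariant under the maps considered.\<close>

lemma tangent_at_iff:
  "tangent_at X Y P \<longleftrightarrow> circline X \<and> circline Y \<and> X \<inter> Y = {P}
     \<or> X = {P} \<and> circline Y \<and> P \<in> Y \<or> Y = {P} \<and> circline X \<and> P \<in> X"
proof -
  have 1: "circline X \<and> circline Y \<and> X \<inter> Y = {None}" if par: "parallel_lines X Y" "X \<noteq> Y"
  proof -
    obtain p q d where d: "d \<noteq> 0" "X = line p d" "Y = line q d"
      using par by (auto simp: parallel_lines_def)
    have 1: "X = cyc (0, \<i> * sgn d, 2 * (p \<bullet> (\<i> * sgn d)))"
      using line_eq_line_unit[OF d(1)] d(2) line_eq_cyc by simp
    have 2: "Y = cyc (0, \<i> * sgn d, 2 * (q \<bullet> (\<i> * sgn d)))"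
      using line_eq_line_unit[OF d(1)] d(3) line_eq_cyc by simp
    have "Q = None" if Q: "Q \<in> X" "Q \<in> Y" for Q
    proof (rule ccontr)
      assume "Q \<noteq> None"
      then obtain z where "Q = Some z" by blast
      then have "2 * (p \<bullet> (\<i> * sgn d)) = 2 * (q \<bullet> (\<i> * sgn d))"
        using Q 1 2 by (simp add: in_cyc_simps)
      then show False using 1 2 par(2) by simp
    qed
    moreover have "None \<in> X" "None \<in> Y" using 1 2 by (simp_all add: in_cyc_simps)
    ultimately have "X \<inter> Y = {None}" by blast
    moreover have "circline X" "circline Y"
      using d unfolding circline_def is_line_def by blast+
    ultimately show ?thesis by blast
  qed
  have 2: "parallel_lines X Y \<and> X \<noteq> Y \<and> P = None" if l: "is_line X" "is_line Y" "X \<inter> Y = {P}"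
  proof -
    obtain p d q e where d: "d \<noteq> 0" "X = line p d" "e \<noteq> 0" "Y = line q e"
      using l by (auto simp: is_line_def)
    then have "None \<in> X \<inter> Y" by (simp add: line_def)
    then have P: "P = None" using l(3) by simp
    have X: "X = line p (sgn d)" "norm (sgn d) = 1" using line_eq_line_unit[OF d(1)] d(2) by auto
    have Y: "Y = line q (sgn e)" "norm (sgn e) = 1" using line_eq_line_unit[OF d(3)] d(4) by auto
    have "norm (\<i> * sgn d) = 1" "norm (\<i> * sgn e) = 1" using X Y by (simp_all add: norm_mult)
    then have "\<i> * sgn e = \<i> * sgn d \<or> \<i> * sgn e = - (\<i> * sgn d)"
      using lines_meet_only_at_infinity l(3) P line_eq_cyc X Y by metis
    then have "sgn e = sgn d \<or> sgn e = (-1) *\<^sub>R sgn d"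
      by (metis complex_i_not_zero mult_left_cancel mult_minus_right scaleR_minus1_left)
    moreover have "line q ((-1) *\<^sub>R sgn d) = line q (sgn d)" by (rule line_scaleR) simp
    ultimately have "Y = line q (sgn d)" using Y(1) by metis
    moreover have "sgn d \<noteq> 0" using X by auto
    ultimately have "parallel_lines X Y" unfolding parallel_lines_def using X(1) by blast
    moreover have "X \<noteq> Y"
      using l(3) circline_not_singleton[of P] l(1) by (auto simp: circline_def)
    ultimately show ?thesis using P by blast
  qed
  have 1: "circline X \<and> circline Y \<and> X \<inter> Y = {P}" if "parallel_lines X Y \<and> X \<noteq> Y \<and> P = None"
    using 1 that by simp
  have "((cX \<and> cY \<or> cX \<and> lY \<or> lX \<and> cY) \<and> I \<or> par \<or> A \<and> (cY \<or> lY) \<and> p \<or> B \<and> (cX \<or> lX) \<and> q) \<longleftrightarrow>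
      (cX \<or> lX) \<and> (cY \<or> lY) \<and> I \<or> A \<and> (cY \<or> lY) \<and> p \<or> B \<and> (cX \<or> lX) \<and> q"
    if "par \<Longrightarrow> (cX \<or> lX) \<and> (cY \<or> lY) \<and> I" "lX \<Longrightarrow> lY \<Longrightarrow> I \<Longrightarrow> par"
    for cX lX cY lY I par A B p q using that by blast
  from this[OF 1[unfolded circline_def] 2] show ?thesis
    unfolding tangent_at_def circline_def .
qed

lemma tangent_at_commute: "tangent_at X Y P \<longleftrightarrow> tangent_at Y X P"
  unfolding tangent_at_iff by blast

lemma tangent_commute: "tangent X Y \<longleftrightarrow> tangent Y X"
  unfolding tangent_def using tangent_at_commute by blast

lemma gen_circle_iff: "gen_circle X \<longleftrightarrow> circline X \<or> (\<exists>P. X = {P})"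
  by (auto simp: gen_circle_def circline_def is_point_def)

lemma circline_cyc: "ip v v = 1 \<Longrightarrow> circline (cyc v)"
  using circline_iff by blast

lemma tangent_at_cyc_iff:
  assumes "ip v v = 1" "ip w w = 1"
  shows "tangent_at (cyc v) (cyc w) P \<longleftrightarrow> \<bar>ip v w\<bar> = 1 \<and> cyc v \<noteq> cyc w \<and> P \<in> cyc v \<and> P \<in> cyc w"
proof -
  have c: "circline (cyc v)" "circline (cyc w)"
    using circline_cyc assms by blast+
  then have n: "cyc v \<noteq> {P}" "cyc w \<noteq> {P}"
    using circline_not_singleton by metis+
  have "tangent_at (cyc v) (cyc w) P \<longleftrightarrow> cyc v \<inter> cyc w = {P}"
    unfolding tangent_at_iff by (simp only: c n simp_thms)
  also have "\<dots> \<longleftrightarrow> \<bar>ip v w\<bar> = 1 \<and> cyc v \<noteq> cyc w \<and> P \<in> cyc v \<and> P \<in> cyc w"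
  proof
    assume *: "cyc v \<inter> cyc w = {P}"
    then have "P \<in> cyc v \<inter> cyc w" by simp
    then show "\<bar>ip v w\<bar> = 1 \<and> cyc v \<noteq> cyc w \<and> P \<in> cyc v \<and> P \<in> cyc w"
      using cyc_Int_singleton_imp[OF assms *] by simp
  next
    assume *: "\<bar>ip v w\<bar> = 1 \<and> cyc v \<noteq> cyc w \<and> P \<in> cyc v \<and> P \<in> cyc w"
    then obtain Q where Q: "cyc v \<inter> cyc w = {Q}" using cyc_Int_singletonI[OF assms] by metis
    have "P \<in> cyc v \<inter> cyc w" using * by simp
    then show "cyc v \<inter> cyc w = {P}" unfolding Q by simp
  qed
  finally show ?thesis .
qed

lemma tangent_cyc_iff:
  assumes "ip v v = 1" "ip w w = 1"
  shows "tangent (cyc v) (cyc w) \<longleftrightarrow> \<bar>ip v w\<bar> = 1 \<and> cyc v \<noteq> cyc w"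
proof -
  have "\<exists>P. P \<in> cyc v \<and> P \<in> cyc w" if "\<bar>ip v w\<bar> = 1" "cyc v \<noteq> cyc w"
    using cyc_Int_singletonI[OF assms that] by (metis Int_iff singletonI)
  then show ?thesis
    unfolding tangent_def tangent_at_cyc_iff[OF assms] by metis
qed

lemma tangent_point_cyc_iff:
  assumes "ip v v = 1"
  shows "tangent {P} (cyc v) \<longleftrightarrow> P \<in> cyc v" and "tangent (cyc v) {P} \<longleftrightarrow> P \<in> cyc v"
proof -
  have "cyc v \<noteq> {P}" for P
    using circline_cyc[OF assms(1)] circline_not_singleton by metis
  then show "tangent {P} (cyc v) \<longleftrightarrow> P \<in> cyc v"
    unfolding tangent_def tangent_at_iff
    using circline_cyc[OF assms(1)] circline_not_singleton by blast
  then show "tangent (cyc v) {P} \<longleftrightarrow> P \<in> cyc v" using tangent_commute by blast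
qed

lemma not_tangent_points: "\<not> tangent {P} {Q}"
  unfolding tangent_def tangent_at_iff using circline_not_singleton by blast

lemma induces_tangent_at_iff:
  assumes "induces F T"
  shows "tangent_at (F ` X) (F ` Y) (F P) \<longleftrightarrow> tangent_at X Y P"
proof -
  have inj: "inj F" using assms induces_bij bij_is_inj by blast
  have "F ` X \<inter> F ` Y = {F P} \<longleftrightarrow> X \<inter> Y = {P}"
    using inj by (metis image_Int image_empty image_insert inj_image_eq_iff)
  moreover have "F ` X = {F P} \<longleftrightarrow> X = {P}" for X
    using inj by (metis image_empty image_insert inj_image_eq_iff)
  moreover have "F P \<in> F ` X \<longleftrightarrow> P \<in> X" for X using inj by (simp add: inj_image_mem_iff)
  ultimately show ?thesis
    unfolding tangent_at_iff induces_circline_iff[OF assms] by presburger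
qed

lemma induces_tangent_iff:
  assumes "induces F T"
  shows "tangent (F ` X) (F ` Y) \<longleftrightarrow> tangent X Y"
  using induces_bij[OF assms] unfolding tangent_def
  by (metis induces_tangent_at_iff[OF assms] bij_pointE)

lemma induces_all_tangent_iff:
  assumes "induces F T"
  shows "all_tangent_at_one_point (image F ` G) \<longleftrightarrow> all_tangent_at_one_point G"
proof -
  have "F ` X \<noteq> F ` Y \<longleftrightarrow> X \<noteq> Y" for X Y
    using induces_bij[OF assms] by (simp add: bij_is_inj inj_image_eq_iff)
  then have eq: "(\<forall>X\<in>image F ` G. \<forall>Y\<in>image F ` G. X \<noteq> Y \<longrightarrow> tangent_at X Y (F P)) \<longleftrightarrow>
      (\<forall>X\<in>G. \<forall>Y\<in>G. X \<noteq> Y \<longrightarrow> tangent_at X Y P)" for P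
    by (simp add: induces_tangent_at_iff[OF assms])
  have ex: "(\<exists>Q. \<Phi> Q) \<longleftrightarrow> (\<exists>P. \<Phi> (F P))" for \<Phi>
    using induces_bij[OF assms] by (metis bij_pointE)
  show ?thesis
    unfolding all_tangent_at_one_point_def by (subst ex) (simp only: eq)
qed

lemma induces_gen_circle:
  assumes "induces F T" "gen_circle X"
  shows "gen_circle (F ` X)"
  using assms(2) unfolding gen_circle_iff induces_circline_iff[OF assms(1)]
  by auto

lemma induces_card_image:
  assumes "induces F T"
  shows "card (image F ` G) = card G"
  using bij_is_inj[OF induces_bij[OF assms]]
  by (intro card_image) (simp add: inj_on_def inj_image_eq_iff)

section \<open>Bases and Gram matrices\<close>

text \<open>Since the form is nondegenerate, a trivial orthogonal complement means that the vectors
  span; being four in dimension four, they are then a basis.\<close>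

definition spanning :: "cvec \<Rightarrow> cvec \<Rightarrow> cvec \<Rightarrow> cvec \<Rightarrow> bool" where
  "spanning g1 g2 g3 g4 \<longleftrightarrow>
     (\<forall>n. ip n g1 = 0 \<longrightarrow> ip n g2 = 0 \<longrightarrow> ip n g3 = 0 \<longrightarrow> ip n g4 = 0 \<longrightarrow> n = 0)"

text \<open>When the \<open>g\<close> vectors span, the products of the \<open>h\<close> vectors
  among themselves form the inverse of the Gram matrix.\<close>

definition dual_basis :: "cvec \<Rightarrow> cvec \<Rightarrow> cvec \<Rightarrow> cvec \<Rightarrow> cvec \<Rightarrow> cvec \<Rightarrow> cvec \<Rightarrow> cvec \<Rightarrow> bool" where
  "dual_basis g1 g2 g3 g4 h1 h2 h3 h4 \<longleftrightarrow>
     ip h1 g1 = 1 \<and> ip h1 g2 = 0 \<and> ip h1 g3 = 0 \<and> ip h1 g4 = 0 \<and>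
     ip h2 g1 = 0 \<and> ip h2 g2 = 1 \<and> ip h2 g3 = 0 \<and> ip h2 g4 = 0 \<and>
     ip h3 g1 = 0 \<and> ip h3 g2 = 0 \<and> ip h3 g3 = 1 \<and> ip h3 g4 = 0 \<and>
     ip h4 g1 = 0 \<and> ip h4 g2 = 0 \<and> ip h4 g3 = 0 \<and> ip h4 g4 = 1"

lemma dual_basis_expansion:
  assumes "spanning g1 g2 g3 g4" "dual_basis g1 g2 g3 g4 h1 h2 h3 h4"
  shows "v = ip v g1 *\<^sub>R h1 + ip v g2 *\<^sub>R h2 + ip v g3 *\<^sub>R h3 + ip v g4 *\<^sub>R h4" (is "v = ?w")
proof -
  have "ip (v - ?w) g1 = 0" "ip (v - ?w) g2 = 0" "ip (v - ?w) g3 = 0" "ip (v - ?w) g4 = 0"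
    using assms(2) by (simp_all add: dual_basis_def)
  then have "v - ?w = 0" using assms(1) unfolding spanning_def by blast
  then show ?thesis by simp
qed

lemma ex_dual_basis:
  assumes "spanning g1 g2 g3 g4"
  shows "\<exists>h1 h2 h3 h4. dual_basis g1 g2 g3 g4 h1 h2 h3 h4 \<and>
    (\<forall>v. v = ip v h1 *\<^sub>R g1 + ip v h2 *\<^sub>R g2 + ip v h3 *\<^sub>R g3 + ip v h4 *\<^sub>R g4)"
proof -
  \<comment> \<open>The four products are packed into another \<open>cvec\<close>, so that
    injectivity of this endomorphism yields surjectivity.\<close>
  define L :: "cvec \<Rightarrow> cvec" where "L v = (ip v g1, Complex (ip v g2) (ip v g3), ip v g4)" for v
  have "linear L" by (rule linearI) (simp_all add: L_def complex_eq_iff)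
  moreover have "inj L"
    unfolding linear_injective_0[OF \<open>linear L\<close>]
    using assms unfolding spanning_def by (auto simp: L_def zero_prod_def complex_eq_iff)
  ultimately have "surj L" using linear_injective_imp_surjective by blast
  have ex: "\<exists>h. ip h g1 = a \<and> ip h g2 = b \<and> ip h g3 = c \<and> ip h g4 = d" for a b c d
  proof -
    obtain h where "L h = (a, Complex b c, d)" using \<open>surj L\<close> by (metis surjD)
    then show ?thesis by (auto simp: L_def)
  qed
  obtain h1 where h1: "ip h1 g1 = 1" "ip h1 g2 = 0" "ip h1 g3 = 0" "ip h1 g4 = 0" using ex by blast
  obtain h2 where h2: "ip h2 g1 = 0" "ip h2 g2 = 1" "ip h2 g3 = 0" "ip h2 g4 = 0" using ex by blast
  obtain h3 where h3: "ip h3 g1 = 0" "ip h3 g2 = 0" "ip h3 g3 = 1" "ip h3 g4 = 0" using ex by blast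
  obtain h4 where h4: "ip h4 g1 = 0" "ip h4 g2 = 0" "ip h4 g3 = 0" "ip h4 g4 = 1" using ex by blast
  have d: "dual_basis g1 g2 g3 g4 h1 h2 h3 h4"
    using h1 h2 h3 h4 by (simp add: dual_basis_def)
  have h: "x = ip x g1 *\<^sub>R h1 + ip x g2 *\<^sub>R h2 + ip x g3 *\<^sub>R h3 + ip x g4 *\<^sub>R h4" for x
    using dual_basis_expansion[OF assms d] .
  have "v = ip v h1 *\<^sub>R g1 + ip v h2 *\<^sub>R g2 + ip v h3 *\<^sub>R g3 + ip v h4 *\<^sub>R g4" (is "v = ?w") for v
  proof -
    have "ip (v - ?w) x = 0" for x
    proof -
      have "ip v x = ip x g1 * ip v h1 + ip x g2 * ip v h2 + ip x g3 * ip v h3 + ip x g4 * ip v h4"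
        by (subst h[of x]) simp
      then show ?thesis by (simp add: ip_commute[of _ x] mult.commute)
    qed
    then have "v - ?w = 0" by (rule ip_nondegenerate)
    then show ?thesis by simp
  qed
  then show ?thesis using d by blast
qed

text \<open>The linear map sending each \<open>g\<close> vector to its \<open>k\<close> vector,
  written with the dual basis, preserves the form by bilinearity. Thus equal Gram matrices mean
  equivalence under inversions and similarities, and only models with the right products have to be
  exhibited.\<close>

lemma ex_induces_of_gram:
  assumes sp: "spanning g1 g2 g3 g4"
    and gram: "ip g1 g1 = ip k1 k1" "ip g2 g2 = ip k2 k2" "ip g3 g3 = ip k3 k3" "ip g4 g4 = ip k4 k4"
      "ip g1 g2 = ip k1 k2" "ip g1 g3 = ip k1 k3" "ip g1 g4 = ip k1 k4"
      "ip g2 g3 = ip k2 k3" "ip g2 g4 = ip k2 k4" "ip g3 g4 = ip k3 k4"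
  obtains F T where "induces F T" "T g1 = k1" "T g2 = k2" "T g3 = k3" "T g4 = k4"
proof -
  obtain h1 h2 h3 h4 where d: "dual_basis g1 g2 g3 g4 h1 h2 h3 h4"
    and exp: "\<And>v. v = ip v h1 *\<^sub>R g1 + ip v h2 *\<^sub>R g2 + ip v h3 *\<^sub>R g3 + ip v h4 *\<^sub>R g4"
    using ex_dual_basis[OF sp] by blast
  note h = d[unfolded dual_basis_def]
  define T where "T v = ip v h1 *\<^sub>R k1 + ip v h2 *\<^sub>R k2 + ip v h3 *\<^sub>R k3 + ip v h4 *\<^sub>R k4" for v
  have "linear T"
    by (rule linearI) (simp_all add: T_def scaleR_add_left scaleR_add_right)
  moreover have "ip (T v) (T w) = ip v w" for v w
  proof -
    have "ip v w = ip (ip v h1 *\<^sub>R g1 + ip v h2 *\<^sub>R g2 + ip v h3 *\<^sub>R g3 + ip v h4 *\<^sub>R g4)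
       (ip w h1 *\<^sub>R g1 + ip w h2 *\<^sub>R g2 + ip w h3 *\<^sub>R g3 + ip w h4 *\<^sub>R g4)"
      using exp[of v] exp[of w] by presburger
    then show ?thesis
      unfolding T_def
      by (simp add: gram ip_commute[of g2 g1] ip_commute[of g3 g1] ip_commute[of g4 g1]
          ip_commute[of g3 g2] ip_commute[of g4 g2] ip_commute[of g4 g3]
          ip_commute[of k2 k1] ip_commute[of k3 k1] ip_commute[of k4 k1]
          ip_commute[of k3 k2] ip_commute[of k4 k2] ip_commute[of k4 k3])
  qed
  ultimately obtain F where F: "induces F T" using ex_induces_isometry by blast
  moreover have "T g1 = k1" "T g2 = k2" "T g3 = k3" "T g4 = k4"
    using h by (simp_all add: T_def ip_commute[of _ h1] ip_commute[of _ h2]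
        ip_commute[of _ h3] ip_commute[of _ h4])
  ultimately show ?thesis using that by blast
qed

text \<open>Any \<open>e\<close> with \<open>ip x e \<noteq> 0\<close> completes \<open>a\<close>,
  \<open>b\<close>, \<open>c\<close> to a basis; after subtraction of the multiple of
  \<open>x\<close> that matches \<open>ip y e\<close>, the vector \<open>y\<close> is orthogonal to
  this basis.\<close>

lemma common_orthogonal_multiple:
  assumes indep: "\<And>\<alpha> \<beta> \<gamma>. \<alpha> *\<^sub>R a + \<beta> *\<^sub>R b + \<gamma> *\<^sub>R c = 0 \<Longrightarrow> \<alpha> = 0 \<and> \<beta> = 0 \<and> \<gamma> = 0"
    and x: "x \<noteq> 0" "ip a x = 0" "ip b x = 0" "ip c x = 0"
    and y: "ip a y = 0" "ip b y = 0" "ip c y = 0"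
  obtains l where "y = l *\<^sub>R x"
proof -
  obtain e where e: "ip x e \<noteq> 0" using x(1) ip_nondegenerate by blast
  define M :: "cvec \<Rightarrow> cvec" where
    "M p = fst p *\<^sub>R a + Re (fst (snd p)) *\<^sub>R b + Im (fst (snd p)) *\<^sub>R c + snd (snd p) *\<^sub>R e" for p
  have "linear M" by (rule linearI) (simp_all add: M_def scaleR_add_left scaleR_add_right)
  moreover have "inj M"
    unfolding linear_injective_0[OF \<open>linear M\<close>]
  proof (intro allI impI)
    fix p assume p: "M p = 0"
    have "ip (M p) x = snd (snd p) * ip x e"
      using x(2-4) by (simp add: M_def ip_commute[of e x])
    then have "snd (snd p) = 0" using p e by simp
    moreover from this have "fst p = 0 \<and> Re (fst (snd p)) = 0 \<and> Im (fst (snd p)) = 0"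
      using p by (intro indep) (simp add: M_def)
    ultimately show "p = 0" by (simp add: prod_eq_iff complex_eq_iff)
  qed
  ultimately have "surj M" using linear_injective_imp_surjective by blast
  define l where "l = ip y e / ip x e"
  have "ip (y - l *\<^sub>R x) (M p) = 0" for p
    using x y e by (simp add: M_def l_def ip_commute[of _ a] ip_commute[of _ b] ip_commute[of _ c])
  then have "ip (y - l *\<^sub>R x) z = 0" for z using \<open>surj M\<close> by (metis surjD)
  then have "y - l *\<^sub>R x = 0" by (rule ip_nondegenerate)
  then have "y = l *\<^sub>R x" by simp
  then show ?thesis by (rule that)
qed

text \<open>Four independent vectors would span, and \<open>n\<close> would be orthogonal to
  everything, in particular to \<open>e\<close>.\<close>

lemma ex_linear_relation:
  assumes "ip n e \<noteq> 0" "ip n g1 = 0" "ip n g2 = 0" "ip n g3 = 0" "ip n g4 = 0"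
  shows "\<exists>x1 x2 x3 x4. (x1, x2, x3, x4) \<noteq> (0, 0, 0, 0 :: real) \<and>
    x1 *\<^sub>R g1 + x2 *\<^sub>R g2 + x3 *\<^sub>R g3 + x4 *\<^sub>R g4 = 0"
proof (rule ccontr)
  assume no: "\<not> ?thesis"
  define M :: "cvec \<Rightarrow> cvec" where
    "M p = fst p *\<^sub>R g1 + Re (fst (snd p)) *\<^sub>R g2 + Im (fst (snd p)) *\<^sub>R g3 + snd (snd p) *\<^sub>R g4" for p
  have "linear M" by (rule linearI) (simp_all add: M_def scaleR_add_left scaleR_add_right)
  moreover have "inj M"
    unfolding linear_injective_0[OF \<open>linear M\<close>]
  proof (intro allI impI)
    fix p assume "M p = 0"
    then have "(fst p, Re (fst (snd p)), Im (fst (snd p)), snd (snd p)) = (0, 0, 0, 0)"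
      using no unfolding M_def by blast
    then show "p = 0" by (simp add: prod_eq_iff complex_eq_iff)
  qed
  ultimately have "surj M" using linear_injective_imp_surjective by blast
  then obtain p where "e = M p" by (metis surjD)
  then have "ip n e = 0" using assms(2-) by (simp add: M_def)
  then show False using assms(1) by simp
qed

section \<open>Counting lemmas, and lines given by unit normals\<close>

lemma card_4_obtain:
  assumes "card A = 4"
  obtains a b c d where "A = {a, b, c, d}" "distinct [a, b, c, d]"
proof -
  obtain xs where xs: "set xs = A" "distinct xs"
    using assms by (metis card.infinite finite_distinct_list zero_neq_numeral)
  then have "length xs = 4" using assms distinct_card by fastforce
  then obtain a b c d where "xs = [a, b, c, d]"
    by (auto simp: numeral_eq_Suc length_Suc_conv)
  then show ?thesis using that xs by auto
qed

lemma card_le_two_fibres: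
  assumes "finite A" "f ` A \<subseteq> B" "finite B"
    and "\<And>b. b \<in> B \<Longrightarrow> \<exists>x y. {a \<in> A. f a = b} \<subseteq> {x, y}"
  shows "card A \<le> 2 * card B"
proof -
  have "card {a \<in> A. f a = b} \<le> 2" if b: "b \<in> B" for b
  proof -
    obtain x y where "{a \<in> A. f a = b} \<subseteq> {x, y}" using assms(4)[OF b] by blast
    then have "card {a \<in> A. f a = b} \<le> card {x, y}" by (simp add: card_mono)
    also have "\<dots> \<le> 2" by (simp add: card_insert_if)
    finally show ?thesis .
  qed
  moreover have "A = (\<Union>b\<in>B. {a \<in> A. f a = b})" using assms(2) by blast
  then have "card A \<le> (\<Sum>b\<in>B. card {a \<in> A. f a = b})"
    using card_UN_le[OF assms(3), of "\<lambda>b. {a \<in> A. f a = b}"] by simp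
  ultimately show ?thesis
    using sum_bounded_above[of B "\<lambda>b. card {a \<in> A. f a = b}" 2] by simp
qed

lemma meeting_point_unique:
  fixes c c' x y :: complex
  assumes "Im (cnj c * c') \<noteq> 0" "c \<bullet> x = c \<bullet> y" "c' \<bullet> x = c' \<bullet> y"
  shows "x = y"
proof -
  define w where "w = x - y"
  have w: "Re c * Re w + Im c * Im w = 0" "Re c' * Re w + Im c' * Im w = 0"
    using assms(2,3) by (simp_all add: w_def inner_complex_def algebra_simps)
  have "Re w * Im (cnj c * c') = Im c' * (Re c * Re w + Im c * Im w) - Im c * (Re c' * Re w + Im c' * Im w)"
    "Im w * Im (cnj c * c') = Re c * (Re c' * Re w + Im c' * Im w) - Re c' * (Re c * Re w + Im c * Im w)"
    by (simp_all add: algebra_simps)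
  then have "w = 0" using w assms(1) by (simp add: complex_eq_iff)
  then show ?thesis by (simp add: w_def)
qed

lemma unit_inner_abs_1:
  fixes c c' :: complex
  assumes "norm c = 1" "norm c' = 1" "\<bar>c \<bullet> c'\<bar> = 1"
  shows "c' = c \<or> c' = - c"
proof -
  have "c \<bullet> c = 1" "c' \<bullet> c' = 1" using assms by (simp_all add: dot_square_norm)
  moreover have "c \<bullet> c' = 1 \<or> c \<bullet> c' = -1" using assms(3) by linarith
  ultimately have "(c' - c) \<bullet> (c' - c) = 0 \<or> (c' + c) \<bullet> (c' + c) = 0"
    by (auto simp: inner_simps inner_commute)
  then show ?thesis by (auto simp: eq_neg_iff_add_eq_0)
qed

lemma circline_through_infinity:
  assumes "circline X" "None \<in> X"
  obtains c d where "norm c = 1" "X = cyc (0, c, d)"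
proof -
  obtain b c d where v: "ip (b, c, d) (b, c, d) = 1" "X = cyc (b, c, d)"
    using assms(1) unfolding circline_iff by auto
  then have "b = 0" using assms(2) by (simp add: in_cyc_simps)
  then show ?thesis using that v line_unit_norm by blast
qed

lemma ip_line_unit: "norm c = 1 \<Longrightarrow> ip (0, c, d) (0, c, d) = 1"
  by (simp add: ip_triple dot_square_norm)

lemma cyc_line_sign:
  assumes "c' = c \<or> c' = - c"
  shows "\<exists>g. cyc (0, c', f) = cyc (0, c, g)"
proof (cases "c' = c")
  case False
  then have "(0, c', f) = - (0 :: real, c, - f)" using assms by simp
  then show ?thesis using cyc_uminus by metis
qed blast

section \<open>Given points and given lines through one point\<close>

text \<open>A point is treated as a circle of radius 0, so that tangency of a line uniformly
  prescribes its distance from the centre.\<close>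

lemma tangent_line_to_finite_gen_circle:
  assumes "gen_circle X" "None \<notin> X"
  shows "\<exists>z \<rho>. \<rho> \<ge> 0 \<and> X = Some ` sphere z \<rho> \<and>
    (\<forall>c d. norm c = 1 \<longrightarrow> tangent (cyc (0, c, d)) X \<longrightarrow> \<bar>c \<bullet> z - d / 2\<bar> = \<rho>)"
proof (cases "circline X")
  case True
  then obtain z r where r: "r > 0" "X = circle z r"
    using assms(2) by (auto simp: circline_def is_circle_def is_line_def line_def)
  have "\<bar>c \<bullet> z - d / 2\<bar> = r" if c: "norm c = 1" "tangent (cyc (0, c, d)) X" for c d
  proof -
    have u: "ip (1 / r, z /\<^sub>R r, (z \<bullet> z - r\<^sup>2) / r) (1 / r, z /\<^sub>R r, (z \<bullet> z - r\<^sup>2) / r) = 1"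
      using r by (simp add: ip_triple field_simps power2_eq_square)
    have "\<bar>ip (0, c, d) (1 / r, z /\<^sub>R r, (z \<bullet> z - r\<^sup>2) / r)\<bar> = 1"
      using c circle_eq_cyc[OF r(1)] r(2) tangent_cyc_iff[OF ip_line_unit[OF c(1)] u] by simp
    moreover have "ip (0, c, d) (1 / r, z /\<^sub>R r, (z \<bullet> z - r\<^sup>2) / r) = (c \<bullet> z - d / 2) / r"
      using r by (simp add: ip_triple field_simps)
    ultimately show ?thesis using r by (simp add: abs_divide)
  qed
  then show ?thesis
    using r by (intro exI[of _ z] exI[of _ r] conjI allI impI) (auto simp: circle_def)
next
  case False
  then obtain P where "X = {P}" using assms(1) by (auto simp: gen_circle_iff)
  moreover obtain z where z: "P = Some z" using assms(2) calculation by (cases P) auto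
  moreover have "\<bar>c \<bullet> z - d / 2\<bar> = 0" if "norm c = 1" "tangent (cyc (0, c, d)) X" for c d
    using that calculation tangent_point_cyc_iff(2)[OF ip_line_unit[OF that(1)]]
    by (simp add: in_cyc_simps)
  ultimately show ?thesis
    by (intro exI[of _ z] exI[of _ 0] conjI allI impI) auto
qed

text \<open>For families of solutions labelled by two signs, with room for one exceptional
  member.\<close>

lemma card_le_insert_image_signs:
  assumes "S \<subseteq> insert a (f ` ({1, -1 :: real} \<times> {1, -1 :: real}))"
  shows "card S \<le> 5"
proof -
  have "card S \<le> card (insert a (f ` ({1, -1 :: real} \<times> {1, -1 :: real})))"
    using assms by (intro card_mono) auto
  also have "\<dots> \<le> Suc (card (f ` ({1, -1 :: real} \<times> {1, -1 :: real})))"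
    by (simp add: card_insert_if)
  also have "\<dots> \<le> Suc (card ({1, -1 :: real} \<times> {1, -1 :: real}))"
    using card_image_le[of "{1, -1 :: real} \<times> {1, -1 :: real}" f] by simp
  finally show ?thesis by simp
qed

lemma card_le_insert_two:
  assumes "S \<subseteq> {a, b}"
  shows "card S \<le> 2"
proof -
  have "card S \<le> card {a, b}" using assms by (intro card_mono) auto
  also have "\<dots> \<le> 2" by (simp add: card_insert_if)
  finally show ?thesis .
qed

text \<open>Tangency to the point at infinity makes every solution a line. If another given one is a
  line, the solutions are parallel to it and at a prescribed distance from a centre; if two given
  ones are finite, the solutions are their common tangents, at most four.\<close>

lemma given_infinity_few_solutions:
  assumes inf: "{None} \<in> G" and G: "\<forall>X\<in>G. gen_circle X" "card G = 4"
    and ntan: "\<not> all_tangent_at_one_point G"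
    and S: "\<forall>Y\<in>S. gen_circle Y \<and> (\<forall>X\<in>G. tangent Y X)"
  shows "card S \<le> 5"
proof (cases "S = {}")
  case False
  have line: "\<exists>c d. norm c = 1 \<and> Y = cyc (0, c, d)" if "Y \<in> S" for Y
  proof -
    have t: "tangent Y {None}" using S inf that by blast
    then have "circline Y" using S that not_tangent_points by (auto simp: gen_circle_iff)
    then obtain v where "ip v v = 1" "Y = cyc v" using circline_iff by blast
    then have "None \<in> Y" using t tangent_point_cyc_iff by blast
    from circline_through_infinity[OF \<open>circline Y\<close> this] show ?thesis by blast
  qed
  \<comment> \<open>Otherwise all given lines are parallel to one solution line, and the four given
    ones are tangent at infinity.\<close>
  have "\<exists>X\<in>G. None \<notin> X"
  proof (rule ccontr)
    assume no: "\<not> ?thesis"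
    obtain Y where "Y \<in> S" using False by blast
    then obtain e f where Y: "norm e = 1" "Y = cyc (0, e, f)" using line by blast
    have X: "X = {None} \<or> (\<exists>d. X = cyc (0, e, d))" if X: "X \<in> G" for X
    proof (cases "circline X")
      case True
      have "None \<in> X" using no X by blast
      from circline_through_infinity[OF True this] obtain c d where c: "norm c = 1" "X = cyc (0, c, d)"
        by blast
      have "tangent Y X" using S \<open>Y \<in> S\<close> X by blast
      then have "\<bar>e \<bullet> c\<bar> = 1"
        using Y c tangent_cyc_iff[OF ip_line_unit ip_line_unit] by (simp add: ip_triple)
      then have "c = e \<or> c = - e" using unit_inner_abs_1 Y c by blast
      from cyc_line_sign[OF this] show ?thesis using c(2) by blast
    next
      case False
      then show ?thesis using G(1) no X by (auto simp: gen_circle_iff)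
    qed
    have "tangent_at X X' None" if "X \<in> G" "X' \<in> G" "X \<noteq> X'" for X X'
    proof -
      have i: "ip (0, e, d) (0, e, d) = 1" for d using ip_line_unit[OF Y(1)] .
      have t: "tangent_at {None} (cyc (0, e, d)) None" for d
        using circline_cyc[OF i] unfolding tangent_at_iff by (simp add: in_cyc_simps)
      have "tangent_at (cyc (0, e, d)) (cyc (0, e, d')) None" if "cyc (0, e, d) \<noteq> cyc (0, e, d')" for d d'
        unfolding tangent_at_cyc_iff[OF i i] using that Y(1)
        by (simp add: in_cyc_simps ip_triple dot_square_norm)
      then show ?thesis
        using X[OF that(1)] X[OF that(2)] that(3) t tangent_at_commute by metis
    qed
    then show False using ntan unfolding all_tangent_at_one_point_def by blast
  qed
  then obtain X1 where X1: "X1 \<in> G" "None \<notin> X1" by blast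
  have "gen_circle X1" using G(1) X1(1) by blast
    from tangent_line_to_finite_gen_circle[OF this X1(2)] obtain z1 r1 where
      1: "r1 \<ge> 0" "X1 = Some ` sphere z1 r1"
      "\<forall>c d. norm c = 1 \<longrightarrow> tangent (cyc (0, c, d)) X1 \<longrightarrow> \<bar>c \<bullet> z1 - d / 2\<bar> = r1"
      by (elim exE conjE)
  have "\<exists>X2\<in>G. X2 \<noteq> {None} \<and> X2 \<noteq> X1"
  proof (rule ccontr)
    assume "\<not> ?thesis"
    then have "G \<subseteq> {{None}, X1}" by blast
    then show False using card_le_insert_two[of G] G(2) by fastforce
  qed
  then obtain X2 where X2: "X2 \<in> G" "X2 \<noteq> {None}" "X2 \<noteq> X1" by blast
  have sol: "norm c = 1 \<Longrightarrow> cyc (0, c, d) \<in> S \<Longrightarrow> \<bar>c \<bullet> z1 - d / 2\<bar> = r1" for c d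
    using 1(3) S X1(1) by blast
  show ?thesis
  proof (cases "None \<in> X2")
    case True
    then have "circline X2" using G(1) X2 by (auto simp: gen_circle_iff)
    from circline_through_infinity[OF this True] obtain c d where c: "norm c = 1" "X2 = cyc (0, c, d)"
      by blast
    have "S \<subseteq> {cyc (0, c, 2 * (c \<bullet> z1 - r1)), cyc (0, c, 2 * (c \<bullet> z1 + r1))}"
    proof
      fix Y assume Y: "Y \<in> S"
      obtain e f where e: "norm e = 1" "Y = cyc (0, e, f)" using line[OF Y] by blast
      have "tangent Y X2" using S Y X2 by blast
      then have "\<bar>c \<bullet> e\<bar> = 1"
        using e c tangent_cyc_iff[OF ip_line_unit ip_line_unit] by (simp add: ip_triple inner_commute)
      then have "e = c \<or> e = - c" using unit_inner_abs_1 e c by blast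
      from cyc_line_sign[OF this] obtain g where g: "Y = cyc (0, c, g)" using e(2) by blast
      then have "\<bar>c \<bullet> z1 - g / 2\<bar> = r1" using sol c Y by blast
      then have "g = 2 * (c \<bullet> z1 - r1) \<or> g = 2 * (c \<bullet> z1 + r1)"
        by (auto simp: abs_if field_simps split: if_splits)
      then show "Y \<in> {cyc (0, c, 2 * (c \<bullet> z1 - r1)), cyc (0, c, 2 * (c \<bullet> z1 + r1))}"
        using g by blast
    qed
    then show ?thesis using card_le_insert_two by fastforce
  next
    case False
    have "gen_circle X2" using G(1) X2(1) by blast
    from tangent_line_to_finite_gen_circle[OF this False] obtain z2 r2 where
      2: "r2 \<ge> 0" "X2 = Some ` sphere z2 r2"
      "\<forall>c d. norm c = 1 \<longrightarrow> tangent (cyc (0, c, d)) X2 \<longrightarrow> \<bar>c \<bullet> z2 - d / 2\<bar> = r2"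
      by (elim exE conjE)
    have sol2: "norm c = 1 \<Longrightarrow> cyc (0, c, d) \<in> S \<Longrightarrow> \<bar>c \<bullet> z2 - d / 2\<bar> = r2" for c d
      using 2(3) S X2(1) by blast
    \<comment> \<open>The sign of the normal is chosen so that the signed distance from
      \<open>z1\<close> is \<open>r1\<close>; then \<open>e\<close> tells whether the second centre
      lies on the same side or on the other.\<close>
    have norm_sol: "\<exists>c d e. norm c = 1 \<and> Y = cyc (0, c, d) \<and> c \<bullet> z1 - d / 2 = r1 \<and>
        e \<in> {1, -1} \<and> c \<bullet> z2 - d / 2 = e * r2" if Y: "Y \<in> S" for Y
    proof -
      obtain c d where c: "norm c = 1" "Y = cyc (0, c, d)" using line[OF Y] by blast
      then have "\<bar>c \<bullet> z1 - d / 2\<bar> = r1" "\<bar>c \<bullet> z2 - d / 2\<bar> = r2" using sol sol2 Y by blast+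
      then consider "c \<bullet> z1 - d / 2 = r1" "c \<bullet> z2 - d / 2 = 1 * r2 \<or> c \<bullet> z2 - d / 2 = (-1) * r2"
        | "(- c) \<bullet> z1 - (- d) / 2 = r1"
          "(- c) \<bullet> z2 - (- d) / 2 = 1 * r2 \<or> (- c) \<bullet> z2 - (- d) / 2 = (-1) * r2"
        by (auto simp: abs_if split: if_splits)
      then show ?thesis
      proof cases
        case 1
        then show ?thesis using c by blast
      next
        case 2
        moreover have "Y = cyc (0, - c, - d)" "norm (- c) = 1"
          using c cyc_uminus[of "(0, c, d)"] by simp_all
        ultimately show ?thesis by blast
      qed
    qed
    \<comment> \<open>Concentric circles with a common tangent line have the same radius, and would
      coincide.\<close>
    have "z1 \<noteq> z2"
    proof
      assume "z1 = z2"
      moreover obtain Y where "Y \<in> S" using \<open>S \<noteq> {}\<close> by blast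
      then obtain c d e where "c \<bullet> z1 - d / 2 = r1" "e = 1 \<or> e = -1" "c \<bullet> z2 - d / 2 = e * r2"
        using norm_sol by blast
      ultimately have "r1 = r2" using 1(1) 2(1) by auto
      then show False using 1(2) 2(2) X2(3) \<open>z1 = z2\<close> by simp
    qed
    define u where "u = sgn (z1 - z2)"
    have u: "norm u = 1" "z1 - z2 = norm (z1 - z2) *\<^sub>R u"
      using \<open>z1 \<noteq> z2\<close> by (simp_all add: u_def norm_sgn sgn_div_norm)
    \<comment> \<open>The two distances prescribe the component \<open>k e\<close> of the unit
      normal along the line of centres; its orthogonal component is then known up to the sign
      \<open>s\<close>.\<close>
    define k where "k e = (r1 - e * r2) / norm (z1 - z2)" for e
    define c where "c e s = k e *\<^sub>R u + (s * sqrt (1 - (k e)\<^sup>2)) *\<^sub>R (\<i> * u)" for e s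
    define f where "f = (\<lambda>(e, s). cyc (0, c e s, 2 * (c e s \<bullet> z1 - r1)))"
    have "S \<subseteq> f ` ({1, -1} \<times> {1, -1})"
    proof
      fix Y assume "Y \<in> S"
      then obtain a d e where a: "norm a = 1" "Y = cyc (0, a, d)" "a \<bullet> z1 - d / 2 = r1"
        "e \<in> {1, -1}" "a \<bullet> z2 - d / 2 = e * r2"
        using norm_sol by blast
      have "a \<bullet> (z1 - z2) = r1 - e * r2" using a by (simp add: inner_diff_right)
      then have "norm (z1 - z2) * (a \<bullet> u) = r1 - e * r2" by (subst (asm) u(2)) simp
      then have au: "a \<bullet> u = k e" using \<open>z1 \<noteq> z2\<close> by (simp add: k_def field_simps)
      define t where "t = a \<bullet> (\<i> * u)"
      have at: "a = k e *\<^sub>R u + t *\<^sub>R (\<i> * u)"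
        using complex_orthogonal_decomposition[OF u(1), of a] by (simp add: au t_def)
      have o: "u \<bullet> u = 1" "(\<i> * u) \<bullet> (\<i> * u) = 1" "u \<bullet> (\<i> * u) = 0" "(\<i> * u) \<bullet> u = 0"
        using u(1) by (simp_all add: dot_square_norm norm_mult) (simp_all add: inner_complex_def)
      have "a \<bullet> a = k e * k e + t * t"
        by (subst (1 2) at) (simp only: inner_add_left inner_add_right inner_scaleR_left
            inner_scaleR_right o, simp)
      then have "t\<^sup>2 = 1 - (k e)\<^sup>2" using a(1) by (simp add: dot_square_norm power2_eq_square)
      then have "\<bar>t\<bar> = sqrt (1 - (k e)\<^sup>2)" by (metis real_sqrt_abs)
      then have "t = 1 * sqrt (1 - (k e)\<^sup>2) \<or> t = (-1) * sqrt (1 - (k e)\<^sup>2)" by linarith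
      then obtain s where s: "s \<in> {1, -1}" "t = s * sqrt (1 - (k e)\<^sup>2)" by blast
      then have "a = c e s" using at by (simp add: c_def)
      moreover have "d = 2 * (a \<bullet> z1 - r1)" using a(3) by simp
      ultimately have "Y = f (e, s)" using a(2) by (simp add: f_def)
      then show "Y \<in> f ` ({1, -1} \<times> {1, -1})" using a(4) s(1) by blast
    qed
    \<comment> \<open>Two signs label at most four lines; \<open>undefined\<close> fills the place
      of the exceptional member that the counting lemma admits.\<close>
    then show ?thesis
      by (intro card_le_insert_image_signs[of S undefined f] order_trans[OF _ subset_insertI])
  qed
qed simp

text \<open>The line \<open>x \<bullet> w = 1\<close> meets the unit circle in at most two
  points.\<close>

lemma unit_vectors_on_common_line:
  fixes a b c w :: complex
  assumes "norm a = 1" "norm b = 1" "norm c = 1" "a \<bullet> w = 1" "b \<bullet> w = 1" "c \<bullet> w = 1"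
  shows "a = b \<or> b = c \<or> a = c"
proof -
  have w: "w \<noteq> 0" using assms(4) by auto
  define u where "u = sgn w"
  have u: "norm u = 1" using w by (simp add: u_def norm_sgn)
  have wu: "w = norm w *\<^sub>R u" using w by (simp add: u_def sgn_div_norm)
  have au: "x \<bullet> u = 1 / norm w" if "x \<bullet> w = 1" for x
    using that w by (subst (asm) wu) (simp add: field_simps)
  have sq: "(x \<bullet> (\<i> * u))\<^sup>2 = 1 - (1 / norm w)\<^sup>2" if "norm x = 1" "x \<bullet> w = 1" for x
  proof -
    have "x \<bullet> x = (x \<bullet> u) * (x \<bullet> u) + (x \<bullet> (\<i> * u)) * (x \<bullet> (\<i> * u))"
      by (subst (2) complex_orthogonal_decomposition[OF u, of x])
         (simp only: inner_add_right inner_scaleR_right)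
    then show ?thesis using au[OF that(2)] that(1) by (simp add: dot_square_norm power2_eq_square)
  qed
  have eq: "x = y" if "x \<bullet> w = 1" "y \<bullet> w = 1" "x \<bullet> (\<i> * u) = y \<bullet> (\<i> * u)" for x y
    using complex_orthogonal_decomposition[OF u, of x] complex_orthogonal_decomposition[OF u, of y]
      au that by metis
  have "(a \<bullet> (\<i> * u))\<^sup>2 = (b \<bullet> (\<i> * u))\<^sup>2" "(c \<bullet> (\<i> * u))\<^sup>2 = (b \<bullet> (\<i> * u))\<^sup>2"
    using sq assms by simp_all
  then have "a \<bullet> (\<i> * u) = b \<bullet> (\<i> * u) \<or> b \<bullet> (\<i> * u) = c \<bullet> (\<i> * u) \<or> a \<bullet> (\<i> * u) = c \<bullet> (\<i> * u)"
    unfolding power2_eq_iff by argo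
  then show ?thesis
    using eq[OF assms(4,5)] eq[OF assms(5,6)] eq[OF assms(4,6)] by blast
qed

text \<open>Here a common point of the given ones is at infinity, so they are lines, not all
  parallel. If some line misses the meeting point \<open>z\<close> of two others, a solution circle
  is determined by two signs and infinity is the only possible point solution, five in all. If all
  lines pass through \<open>z\<close>, no circle touches three of them, and only the points
  \<open>z\<close> and infinity are left.\<close>

lemma given_lines_few_solutions:
  assumes G: "\<forall>X\<in>G. circline X \<and> None \<in> X" "card G = 4"
    and ntan: "\<not> all_tangent_at_one_point G"
    and S: "\<forall>Y\<in>S. gen_circle Y \<and> (\<forall>X\<in>G. tangent Y X)"
  shows "card S \<le> 5"
proof -
  have line: "\<exists>c d. norm c = 1 \<and> X = cyc (0, c, d)" if "X \<in> G" for X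
    using circline_through_infinity[of X] G(1) that by blast
  obtain X1 X2 where X: "X1 \<in> G" "X2 \<in> G" "X1 \<noteq> X2" "\<not> tangent_at X1 X2 None"
    using ntan unfolding all_tangent_at_one_point_def by blast
  obtain c1 d1 where 1: "norm c1 = 1" "X1 = cyc (0, c1, d1)" using line X by blast
  obtain c2 d2 where 2: "norm c2 = 1" "X2 = cyc (0, c2, d2)" using line X by blast
  have npar: "c2 \<noteq> c1" "c2 \<noteq> - c1"
    using X(3,4) 1 2 tangent_at_cyc_iff[OF ip_line_unit[OF 1(1)] ip_line_unit[OF 2(1)]]
    by (auto simp: in_cyc_simps ip_triple dot_square_norm)
  then have im: "Im (cnj c1 * c2) \<noteq> 0" using unit_parallel 1(1) 2(1) by blast
  obtain z where z: "c1 \<bullet> z = d1 / 2" "c2 \<bullet> z = d2 / 2" using ex_meeting_point[OF im] by blast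
  have "\<forall>e. \<exists>x. c1 \<bullet> x = 1 \<and> c2 \<bullet> x = e" using ex_meeting_point[OF im] by blast
  then obtain g where g: "\<And>e. c1 \<bullet> g e = 1" "\<And>e. c2 \<bullet> g e = e" by metis
  \<comment> \<open>Expansion about \<open>z\<close>: for lines through \<open>z\<close> the second
    summand vanishes, so tangency becomes a linear equation for
    \<open>a - b *\<^sub>R z\<close>.\<close>
  have ipz: "ip (b, a, d) (0, c, f) = (a - b *\<^sub>R z) \<bullet> c + b * (c \<bullet> z - f / 2)" for b a d c f
    by (simp add: ip_triple inner_diff_left inner_commute algebra_simps)
  have sol: "\<bar>(a - b *\<^sub>R z) \<bullet> c + b * (c \<bullet> z - f / 2)\<bar> = 1"
    if "ip (b, a, d) (b, a, d) = 1" "cyc (b, a, d) \<in> S" "norm c = 1" "cyc (0, c, f) \<in> G" for b a d c f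
  proof -
    have "tangent (cyc (b, a, d)) (cyc (0, c, f))" using S that by blast
    then have "\<bar>ip (b, a, d) (0, c, f)\<bar> = 1"
      using tangent_cyc_iff[OF that(1) ip_line_unit[OF that(3)]] by blast
    then show ?thesis unfolding ipz .
  qed
  have circ: "\<exists>b a d. ip (b, a, d) (b, a, d) = 1 \<and> Y = cyc (b, a, d) \<and> b \<noteq> 0 \<and> (a - b *\<^sub>R z) \<bullet> c1 = 1"
    if Y: "Y \<in> S" "circline Y" for Y
  proof -
    obtain b a d where v: "ip (b, a, d) (b, a, d) = 1" "Y = cyc (b, a, d)"
      using Y(2) unfolding circline_iff by auto
    have s1: "\<bar>(a - b *\<^sub>R z) \<bullet> c1\<bar> = 1" using sol[OF v(1), of c1 d1] v Y(1) X(1) 1 z by simp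
    have s2: "\<bar>(a - b *\<^sub>R z) \<bullet> c2\<bar> = 1" using sol[OF v(1), of c2 d2] v Y(1) X(2) 2 z by simp
    \<comment> \<open>A solution that is a line would be parallel to \<open>X1\<close> and to
      \<open>X2\<close>, which are not parallel to each other.\<close>
    have "b \<noteq> 0"
    proof
      assume "b = 0"
      then have "norm a = 1" using v(1) line_unit_norm by blast
      then have "c1 = a \<or> c1 = - a" "c2 = a \<or> c2 = - a"
        using unit_inner_abs_1[of a c1] unit_inner_abs_1[of a c2] 1(1) 2(1) s1 s2 \<open>b = 0\<close> by simp_all
      then show False using npar by auto
    qed
    consider "(a - b *\<^sub>R z) \<bullet> c1 = 1" | "(- a - (- b) *\<^sub>R z) \<bullet> c1 = 1"
      using s1 by (auto simp: inner_diff_left abs_if split: if_splits)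
    then show ?thesis
    proof cases
      case 1
      then show ?thesis using v \<open>b \<noteq> 0\<close> by blast
    next
      case 2
      moreover have "Y = cyc (- b, - a, - d)" using v cyc_uminus[of "(b, a, d)"] by simp
      moreover have "ip (- b, - a, - d) (- b, - a, - d) = 1" using v(1) by (simp add: ip_triple)
      moreover have "- b \<noteq> 0" using \<open>b \<noteq> 0\<close> by simp
      ultimately show ?thesis by blast
    qed
  qed
  have point: "P = None \<or> P = Some z" "P \<noteq> None \<Longrightarrow> norm c = 1 \<Longrightarrow> cyc (0, c, f) \<in> G \<Longrightarrow> c \<bullet> z = f / 2"
    if P: "{P} \<in> S" for P c f
  proof -
    have on: "Some x \<in> cyc (0, c, f) \<Longrightarrow> c \<bullet> x = f / 2" for c f x by (simp add: in_cyc_simps)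
    have mem: "P \<in> cyc (0, c, f)" if "norm c = 1" "cyc (0, c, f) \<in> G" for c f
      using S P that tangent_point_cyc_iff(1)[OF ip_line_unit] by blast
    show *: "P = None \<or> P = Some z"
    proof (cases P)
      case (Some x)
      then have "c1 \<bullet> x = d1 / 2" "c2 \<bullet> x = d2 / 2"
        using on mem X 1 2 by metis+
      then have "x = z" using meeting_point_unique[OF im] z by simp
      then show ?thesis using Some by simp
    qed simp
    show "c \<bullet> z = f / 2" if "P \<noteq> None" "norm c = 1" "cyc (0, c, f) \<in> G"
      using * on mem that by blast
  qed
  show ?thesis
  proof (cases "\<exists>c f. norm c = 1 \<and> cyc (0, c, f) \<in> G \<and> c \<bullet> z \<noteq> f / 2")
    case True
    then obtain c3 d3 where 3: "norm c3 = 1" "cyc (0, c3, d3) \<in> G" "c3 \<bullet> z - d3 / 2 \<noteq> 0" by auto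
    \<comment> \<open>\<open>g e\<close> solves the tangency equations of the first two lines, with
      signs 1 and \<open>e\<close>, for \<open>a - b *\<^sub>R z\<close>. The equation of the third
      line, with sign \<open>e'\<close>, then gives \<open>b\<close>, because this line misses
      \<open>z\<close>.\<close>
    define \<beta> where "\<beta> = (\<lambda>(e, e'). (e' - g e \<bullet> c3) / (c3 \<bullet> z - d3 / 2))"
    define \<gamma> where "\<gamma> = (\<lambda>(e, e' :: real). g e + \<beta> (e, e') *\<^sub>R z)"
    define f where "f p = cyc (\<beta> p, \<gamma> p, (\<gamma> p \<bullet> \<gamma> p - 1) / \<beta> p)" for p
    have "S \<subseteq> insert {None} (f ` ({1, -1} \<times> {1, -1}))"
    proof
      fix Y assume Y: "Y \<in> S"
      show "Y \<in> insert {None} (f ` ({1, -1} \<times> {1, -1}))"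
      proof (cases "circline Y")
        case True
        obtain b a d where v: "ip (b, a, d) (b, a, d) = 1" "Y = cyc (b, a, d)" "b \<noteq> 0"
          "(a - b *\<^sub>R z) \<bullet> c1 = 1" using circ[OF Y True] by blast
        define e where "e = (a - b *\<^sub>R z) \<bullet> c2"
        define e' where "e' = (a - b *\<^sub>R z) \<bullet> c3 + b * (c3 \<bullet> z - d3 / 2)"
        have "\<bar>e\<bar> = 1" using sol[OF v(1), of c2 d2] v Y X(2) 2 z by (simp add: e_def)
        then have e: "e \<in> {1, -1}" by auto
        have "\<bar>e'\<bar> = 1" using sol[OF v(1), of c3 d3] v Y 3 by (simp add: e'_def)
        then have e': "e' \<in> {1, -1}" by auto
        have "c1 \<bullet> (a - b *\<^sub>R z) = c1 \<bullet> g e"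
          unfolding g(1) using v(4) inner_commute by metis
        moreover have "c2 \<bullet> (a - b *\<^sub>R z) = c2 \<bullet> g e"
          unfolding g(2) unfolding e_def by (rule inner_commute)
        ultimately have g': "a - b *\<^sub>R z = g e" by (rule meeting_point_unique[OF im])
        then have b: "b = \<beta> (e, e')" using 3(3) by (simp add: \<beta>_def e'_def)
        have a: "a = \<gamma> (e, e')" using g' b by (simp add: \<gamma>_def algebra_simps)
        have "d = (a \<bullet> a - 1) / b" using v(1,3) by (simp add: ip_triple field_simps)
        then have "Y = f (e, e')" using v(2) a b by (simp add: f_def)
        then show ?thesis using e e' by blast
      next
        case False
        then obtain P where "Y = {P}" using S Y by (auto simp: gen_circle_iff)
        then have "{P} \<in> S" using Y by simp
        have "P = None"
        proof (rule ccontr)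
          assume "P \<noteq> None"
          from point(2)[OF \<open>{P} \<in> S\<close> this 3(1,2)] show False using 3(3) by simp
        qed
        then show ?thesis using \<open>Y = {P}\<close> by simp
      qed
    qed
    then show ?thesis by (rule card_le_insert_image_signs)
  next
    case False
    then have conc: "c \<bullet> z = f / 2" if "norm c = 1" "cyc (0, c, f) \<in> G" for c f using that by blast
    obtain X3 where X3: "X3 \<in> G" "X3 \<noteq> X1" "X3 \<noteq> X2"
    proof -
      have "\<not> G \<subseteq> {X1, X2}" using card_le_insert_two[of G] G(2) by fastforce
      then show ?thesis using that by blast
    qed
    obtain c3 d3 where 3: "norm c3 = 1" "X3 = cyc (0, c3, d3)" using line X3 by blast
    have z3: "c3 \<bullet> z = d3 / 2" using conc 3 X3 by blast
    have diff: "c \<noteq> c' \<and> c \<noteq> - c'"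
      if diff: "cyc (0, c, f) \<noteq> cyc (0, c', f')" "c \<bullet> z = f / 2" "c' \<bullet> z = f' / 2" for c c' f f'
    proof (intro conjI notI)
      show False if "c = c'" using diff that by simp
      assume "c = - c'"
      then have "(0, c, f) = - (0 :: real, c', f')" using diff(2,3) by simp
      then show False using diff(1) cyc_uminus by metis
    qed
    have "\<not> circline Y" if Y: "Y \<in> S" for Y
    proof
      assume "circline Y"
      then obtain b a d where v: "ip (b, a, d) (b, a, d) = 1" "Y = cyc (b, a, d)"
        "(a - b *\<^sub>R z) \<bullet> c1 = 1" using circ[OF Y] by blast
      define w where "w = a - b *\<^sub>R z"
      have "\<bar>c2 \<bullet> w\<bar> = 1" using sol[OF v(1), of c2 d2] v Y X(2) 2 z by (simp add: w_def inner_commute)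
      define s2 where "s2 = c2 \<bullet> w"
      have s2: "s2 = 1 \<or> s2 = -1" "(s2 *\<^sub>R c2) \<bullet> w = 1"
        using \<open>\<bar>c2 \<bullet> w\<bar> = 1\<close> by (auto simp: s2_def abs_if split: if_splits)
      have "\<bar>c3 \<bullet> w\<bar> = 1" using sol[OF v(1), of c3 d3] v Y X3(1) 3 z3 by (simp add: w_def inner_commute)
      define s3 where "s3 = c3 \<bullet> w"
      have s3: "s3 = 1 \<or> s3 = -1" "(s3 *\<^sub>R c3) \<bullet> w = 1"
        using \<open>\<bar>c3 \<bullet> w\<bar> = 1\<close> by (auto simp: s3_def abs_if split: if_splits)
      have "c1 \<bullet> w = 1" using v(3) by (simp add: w_def inner_commute)
      moreover have "norm (s2 *\<^sub>R c2) = 1" "norm (s3 *\<^sub>R c3) = 1" using s2(1) s3(1) 2 3 by auto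
      ultimately have "c1 = s2 *\<^sub>R c2 \<or> s2 *\<^sub>R c2 = s3 *\<^sub>R c3 \<or> c1 = s3 *\<^sub>R c3"
        using unit_vectors_on_common_line 1(1) s2(2) s3(2) by blast
      moreover have "c3 \<noteq> c1 \<and> c3 \<noteq> - c1" "c3 \<noteq> c2 \<and> c3 \<noteq> - c2"
        using diff X3(2,3) 1(2) 2(2) 3(2) z z3 by metis+
      ultimately show False using s2(1) s3(1) npar by auto
    qed
    then have "S \<subseteq> {{None}, {Some z}}" using S point(1) by (fastforce simp: gen_circle_iff)
    then show ?thesis using card_le_insert_two by fastforce
  qed
qed

section \<open>Linearly independent given circles\<close>

text \<open>Stated for vectors rather than circles, so that signs can be changed without changing
  the circles. The empty intersection will exclude null vectors orthogonal to all four.\<close>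

definition six_tangent :: "cvec \<Rightarrow> cvec \<Rightarrow> cvec \<Rightarrow> cvec \<Rightarrow> epoint set set \<Rightarrow> bool" where
  "six_tangent g1 g2 g3 g4 S \<longleftrightarrow>
     ip g1 g1 = 1 \<and> ip g2 g2 = 1 \<and> ip g3 g3 = 1 \<and> ip g4 g4 = 1 \<and>
     distinct [cyc g1, cyc g2, cyc g3, cyc g4] \<and>
     cyc g1 \<inter> cyc g2 \<inter> cyc g3 \<inter> cyc g4 = {} \<and> card S = 6 \<and>
     (\<forall>Y\<in>S. circline Y \<and> tangent Y (cyc g1) \<and> tangent Y (cyc g2) \<and> tangent Y (cyc g3) \<and> tangent Y (cyc g4))"

text \<open>Products of three unit circles centred at -a, 0, a on a line, with a^2 = 4/5 and the
  middle circle taken with reversed sign; the fourth vector is the line of centres, orthogonal to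
  all three.\<close>

definition gram3 :: "cvec \<Rightarrow> cvec \<Rightarrow> cvec \<Rightarrow> cvec \<Rightarrow> bool" where
  "gram3 g1 g2 g3 g4 \<longleftrightarrow> ip g1 g2 = -3/5 \<and> ip g1 g3 = -3/5 \<and> ip g2 g3 = -3/5 \<and>
     ip g1 g4 = 0 \<and> ip g2 g4 = 0 \<and> ip g3 g4 = 0"

text \<open>Concentric circles with ratio of radii R, one taken with reversed sign, have product -
  (R + 1/R) / 2, which is -3 for R = 3 + 2 sqrt 2. The other pair has the same product, and
  \<open>x\<close> will be plus or minus sqrt 3.\<close>

definition gram4 :: "real \<Rightarrow> cvec \<Rightarrow> cvec \<Rightarrow> cvec \<Rightarrow> cvec \<Rightarrow> bool" where
  "gram4 x g1 g2 g3 g4 \<longleftrightarrow> ip g1 g2 = -3 \<and> ip g3 g4 = -3 \<and>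
     ip g1 g3 = x \<and> ip g1 g4 = x \<and> ip g2 g3 = x \<and> ip g2 g4 = x"

text \<open>The nine equations make the symmetric matrix with diagonal 1 and entries
  \<open>z\<close>, \<open>y\<close>, \<open>x\<close> inverse to the one with diagonal
  \<open>a\<close>, \<open>b\<close>, \<open>c\<close> and all other entries \<open>k\<close>. The
  trace condition excludes entries -1, and then the three entries agree; eliminating
  \<open>k\<close> between the two equations left, the quadratic terms cancel and
  \<open>5 * x = -3\<close> remains.\<close>

lemma gram3_arithmetic:
  fixes x y z k a b c :: real
  assumes "a + z * k + y * k = 1" "k + z * b + y * k = 0" "k + z * k + y * c = 0"
    and "z * a + k + x * k = 0" "z * k + b + x * k = 1" "z * k + k + x * c = 0"
    and "y * a + x * k + k = 0" "y * k + x * b + k = 0" "y * k + x * k + c = 1"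
    and "a + b + c = 2 * k"
  shows "x = -3/5 \<and> y = -3/5 \<and> z = -3/5"
proof -
  have a: "a = 1 - k * (y + z)" and b: "b = 1 - k * (x + z)" and c: "c = 1 - k * (x + y)"
    using assms by (simp_all add: algebra_simps)
  have s: "3 - 2 * k * (x + y + z) = 2 * k" using assms(10) a b c by (simp add: algebra_simps)
  have "k \<noteq> 0" using s by auto
  have z: "z \<noteq> -1"
  proof
    assume "z = -1"
    then have "k * (x + y) = 1" using assms(2) b by (simp add: algebra_simps)
    then show False using s \<open>z = -1\<close> by (simp add: algebra_simps)
  qed
  have y: "y \<noteq> -1"
  proof
    assume "y = -1"
    then have "k * (x + z) = 1" using assms(3) c by (simp add: algebra_simps)
    then show False using s \<open>y = -1\<close> by (simp add: algebra_simps)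
  qed
  have "k * ((y - x) * (z + 1)) = 0" using assms(2,4) unfolding a b by (simp add: algebra_simps)
  then have "y = x" using \<open>k \<noteq> 0\<close> z by simp
  have "k * ((z - x) * (y + 1)) = 0" using assms(3,7) unfolding a c by (simp add: algebra_simps)
  then have "z = x" using \<open>k \<noteq> 0\<close> y by simp
  have 1: "k * (1 + x - 2 * x * x) = - x"
    using assms(2) b \<open>y = x\<close> \<open>z = x\<close> by (simp add: algebra_simps)
  have 2: "k * (2 + 6 * x) = 3" using s \<open>y = x\<close> \<open>z = x\<close> by (simp add: algebra_simps)
  have "3 * (1 + x - 2 * x * x) = (k * (1 + x - 2 * x * x)) * (2 + 6 * x)"
    unfolding 2[symmetric] by (simp add: algebra_simps)
  then have "3 * (1 + x - 2 * x * x) = - x * (2 + 6 * x)" unfolding 1 .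
  then have "x = -3/5" by (simp add: algebra_simps)
  then show ?thesis using \<open>y = x\<close> \<open>z = x\<close> by simp
qed

text \<open>Again a product of mutually inverse matrices: the second one has diagonal
  \<open>a\<close>, \<open>b\<close>, \<open>c\<close>, \<open>d\<close>, zeros within the two
  pairs, and \<open>k\<close> between them. Comparing rows gives
  \<open>(b - a) * (p + 1) = 0\<close> and \<open>(c - d) * (q + 1) = 0\<close>. Once
  \<open>p\<close> and \<open>q\<close> are known to differ from -1, the diagonal is constant, hence
  1/4 by the trace.\<close>

lemma gram4_arithmetic:
  fixes a b c d k p q x13 x14 x23 x24 :: real
  assumes 1: "a + k * (x13 + x14) = 1" "p * b + k * (x13 + x14) = 0" "k + p * k + x13 * c = 0" "k + p * k + x14 * d = 0"
    and 2: "p * a + k * (x23 + x24) = 0" "b + k * (x23 + x24) = 1" "k + p * k + x23 * c = 0" "k + p * k + x24 * d = 0"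
    and 3: "x13 * a + k * (1 + q) = 0" "x23 * b + k * (1 + q) = 0" "k * (x13 + x23) + c = 1" "k * (x13 + x23) + q * d = 0"
    and 4: "x14 * a + k * (1 + q) = 0" "x24 * b + k * (1 + q) = 0" "k * (x14 + x24) + q * c = 0" "k * (x14 + x24) + d = 1"
    and s: "a + b + c + d = 1"
  shows "p = -3 \<and> q = -3 \<and> x13 * x13 = 3 \<and> x14 = x13 \<and> x23 = x13 \<and> x24 = x13"
proof -
  have pb: "p * b = a - 1" "p * a = b - 1" and qd: "q * d = c - 1" "q * c = d - 1"
    using 1 2 3 4 by linarith+
  have c0: "c \<noteq> 0 \<or> d \<noteq> 0" using qd by auto
  have a0: "a \<noteq> 0 \<or> b \<noteq> 0" using pb by auto
  have "p \<noteq> -1"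
  proof
    assume p: "p = -1"
    then have "a + b = 1" using pb by simp
    then have "c + d = 0" using s by simp
    then have "c \<noteq> 0" "d \<noteq> 0" using c0 by auto
    then have "x13 = 0" "x14 = 0" "x23 = 0" "x24 = 0" using 1 2 p by auto
    then show False using 1(1) 2(2) \<open>a + b = 1\<close> by simp
  qed
  have "q \<noteq> -1"
  proof
    assume q: "q = -1"
    then have "c + d = 1" using qd by simp
    then have "a + b = 0" using s by simp
    then have "a \<noteq> 0" "b \<noteq> 0" using a0 by auto
    then have "x13 = 0" "x14 = 0" "x23 = 0" "x24 = 0" using 3 4 q by auto
    then show False using 3(3) 4(4) \<open>c + d = 1\<close> by simp
  qed
  have "(b - a) * (p + 1) = 0" using pb by (simp add: algebra_simps)
  then have ab: "b = a" using \<open>p \<noteq> -1\<close> by simp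
  have "(c - d) * (q + 1) = 0" using qd by (simp add: algebra_simps)
  then have cd: "d = c" using \<open>q \<noteq> -1\<close> by simp
  have "a \<noteq> 0" "c \<noteq> 0" using a0 c0 ab cd by auto
  have x: "x14 = x13" "x23 = x13"
  proof -
    have "x14 * c = x13 * c" "x23 * c = x13 * c" using 1 2 unfolding cd by linarith+
    then show "x14 = x13" "x23 = x13" using \<open>c \<noteq> 0\<close> by simp_all
  qed
  have x': "x24 = x13"
  proof -
    have "x24 * c = x13 * c" using 1 2 unfolding cd by linarith
    then show ?thesis using \<open>c \<noteq> 0\<close> by simp
  qed
  have "c = a" using 1(1) 3(3) x by simp
  then have "a = 1/4" "c = 1/4" "b = 1/4" using s ab cd by simp_all
  have p: "p = -3" "q = -3" using pb qd cd \<open>a = 1/4\<close> \<open>b = 1/4\<close> \<open>c = 1/4\<close> by simp_all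
  have "x13 = 8 * k" using 1(3) p \<open>c = 1/4\<close> by simp
  moreover have "2 * k * x13 = 3/4" using 1(1) x \<open>a = 1/4\<close> by simp
  ultimately have "x13 * x13 = 3" by simp
  then show ?thesis using p x x' by simp
qed

lemma gram_inverse:
  assumes "spanning g1 g2 g3 g4" "dual_basis g1 g2 g3 g4 h1 h2 h3 h4"
  shows "ip v k = ip v g1 * ip h1 k + ip v g2 * ip h2 k + ip v g3 * ip h3 k + ip v g4 * ip h4 k"
proof -
  have "v = ip v g1 *\<^sub>R h1 + ip v g2 *\<^sub>R h2 + ip v g3 *\<^sub>R h3 + ip v g4 *\<^sub>R h4"
    by (rule dual_basis_expansion[OF assms])
  then have "ip v k = ip (ip v g1 *\<^sub>R h1 + ip v g2 *\<^sub>R h2 + ip v g3 *\<^sub>R h3 + ip v g4 *\<^sub>R h4) k"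
    by presburger
  then show ?thesis by simp
qed

text \<open>\<open>h4\<close> is orthogonal to the other dual vectors, hence a multiple of
  \<open>g4\<close> and in fact equal to it. So \<open>g4\<close> is orthogonal to the other given
  vectors and a 3 by 3 problem remains.\<close>

lemma gram3I:
  assumes sp: "spanning g1 g2 g3 g4" and d: "dual_basis g1 g2 g3 g4 h1 h2 h3 h4"
    and u: "ip g1 g1 = 1" "ip g2 g2 = 1" "ip g3 g3 = 1" "ip g4 g4 = 1"
    and h: "ip h1 h4 = 0" "ip h2 h4 = 0" "ip h3 h4 = 0" "ip h1 h3 = ip h1 h2" "ip h2 h3 = ip h1 h2"
    and tr: "ip h1 h1 + ip h2 h2 + ip h3 h3 + ip h4 h4 = 1 + 2 * ip h1 h2"
  shows "gram3 g1 g2 g3 g4"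
proof -
  note G = gram_inverse[OF sp d]
  have c: "ip h2 h1 = ip h1 h2" "ip h3 h1 = ip h1 h2" "ip h3 h2 = ip h1 h2"
    "ip h4 h1 = 0" "ip h4 h2 = 0" "ip h4 h3 = 0"
    using h ip_commute by metis+
  have g: "ip g2 g1 = ip g1 g2" "ip g3 g1 = ip g1 g3" "ip g4 g1 = ip g1 g4" "ip g3 g2 = ip g2 g3"
    "ip g4 g2 = ip g2 g4" "ip g4 g3 = ip g3 g4"
    using ip_commute by metis+
  have gh: "ip g1 h1 = 1" "ip g1 h2 = 0" "ip g1 h3 = 0" "ip g1 h4 = 0"
     "ip g2 h1 = 0" "ip g2 h2 = 1" "ip g2 h3 = 0" "ip g2 h4 = 0"
     "ip g3 h1 = 0" "ip g3 h2 = 0" "ip g3 h3 = 1" "ip g3 h4 = 0"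
     "ip g4 h1 = 0" "ip g4 h2 = 0" "ip g4 h3 = 0" "ip g4 h4 = 1"
    using d ip_commute unfolding dual_basis_def by metis+
  have "ip h4 h4 = 1" using G[of g4 h4] by (simp only: gh u h g)
  then have z: "ip g1 g4 = 0" "ip g2 g4 = 0" "ip g3 g4 = 0"
    using G[of g1 h4] G[of g2 h4] G[of g3 h4] by (simp_all only: gh u h g)
  note R = G[of g1 h1, unfolded gh u h c g z] G[of g1 h2, unfolded gh u h c g z]
    G[of g1 h3, unfolded gh u h c g z] G[of g2 h1, unfolded gh u h c g z]
    G[of g2 h2, unfolded gh u h c g z] G[of g2 h3, unfolded gh u h c g z]
    G[of g3 h1, unfolded gh u h c g z] G[of g3 h2, unfolded gh u h c g z]
    G[of g3 h3, unfolded gh u h c g z]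
  have "ip g2 g3 = -3/5 \<and> ip g1 g3 = -3/5 \<and> ip g1 g2 = -3/5"
    by (rule gram3_arithmetic[of "ip h1 h1" "ip g1 g2" "ip h1 h2" "ip g1 g3" "ip h2 h2" "ip h3 h3" "ip g2 g3"])
       (use R \<open>ip h4 h4 = 1\<close> tr in linarith)+
  then show ?thesis using z by (simp add: gram3_def)
qed

lemma gram4I:
  assumes sp: "spanning g1 g2 g3 g4" and d: "dual_basis g1 g2 g3 g4 h1 h2 h3 h4"
    and u: "ip g1 g1 = 1" "ip g2 g2 = 1" "ip g3 g3 = 1" "ip g4 g4 = 1"
    and h: "ip h1 h2 = 0" "ip h3 h4 = 0" "ip h1 h4 = ip h1 h3" "ip h2 h3 = ip h1 h3" "ip h2 h4 = ip h1 h3"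
    and tr: "ip h1 h1 + ip h2 h2 + ip h3 h3 + ip h4 h4 = 1"
  shows "\<exists>x. x * x = 3 \<and> gram4 x g1 g2 g3 g4"
proof -
  note G = gram_inverse[OF sp d]
  have c: "ip h2 h1 = 0" "ip h4 h3 = 0" "ip h3 h1 = ip h1 h3" "ip h3 h2 = ip h1 h3"
    "ip h4 h1 = ip h1 h3" "ip h4 h2 = ip h1 h3"
    using h ip_commute by metis+
  have g: "ip g2 g1 = ip g1 g2" "ip g3 g1 = ip g1 g3" "ip g4 g1 = ip g1 g4" "ip g3 g2 = ip g2 g3"
    "ip g4 g2 = ip g2 g4" "ip g4 g3 = ip g3 g4"
    using ip_commute by metis+
  have gh: "ip g1 h1 = 1" "ip g1 h2 = 0" "ip g1 h3 = 0" "ip g1 h4 = 0"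
     "ip g2 h1 = 0" "ip g2 h2 = 1" "ip g2 h3 = 0" "ip g2 h4 = 0"
     "ip g3 h1 = 0" "ip g3 h2 = 0" "ip g3 h3 = 1" "ip g3 h4 = 0"
     "ip g4 h1 = 0" "ip g4 h2 = 0" "ip g4 h3 = 0" "ip g4 h4 = 1"
    using d ip_commute unfolding dual_basis_def by metis+
  have "ip g1 g2 = -3 \<and> ip g3 g4 = -3 \<and> ip g1 g3 * ip g1 g3 = 3 \<and>
      ip g1 g4 = ip g1 g3 \<and> ip g2 g3 = ip g1 g3 \<and> ip g2 g4 = ip g1 g3"
    by (rule gram4_arithmetic[of "ip h1 h1" "ip h1 h3" _ _ "ip g1 g2" "ip h2 h2" "ip h3 h3" "ip h4 h4"
          "ip g2 g3" "ip g2 g4" "ip g3 g4"])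
       (use G[of g1 h1] G[of g1 h2] G[of g1 h3] G[of g1 h4] G[of g2 h1] G[of g2 h2] G[of g2 h3] G[of g2 h4]
          G[of g3 h1] G[of g3 h2] G[of g3 h3] G[of g3 h4] G[of g4 h1] G[of g4 h2] G[of g4 h3] G[of g4 h4] tr in
        \<open>simp_all only: gh u h c g\<close>, simp_all add: algebra_simps)
  then show ?thesis unfolding gram4_def by blast
qed

text \<open>The free sign of the vector is spent on the first given circle; the other three products
  then form one of eight patterns.\<close>

lemma six_tangent_solution:
  assumes "six_tangent g1 g2 g3 g4 S" "Y \<in> S"
  obtains v where "ip v v = 1" "Y = cyc v" "ip v g1 = 1" "\<bar>ip v g2\<bar> = 1" "\<bar>ip v g3\<bar> = 1" "\<bar>ip v g4\<bar> = 1"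
proof -
  have u: "ip g1 g1 = 1" "ip g2 g2 = 1" "ip g3 g3 = 1" "ip g4 g4 = 1"
    using assms(1) by (auto simp: six_tangent_def)
  have Y: "circline Y" "tangent Y (cyc g1)" "tangent Y (cyc g2)" "tangent Y (cyc g3)" "tangent Y (cyc g4)"
    using assms unfolding six_tangent_def by blast+
  obtain v where v: "ip v v = 1" "Y = cyc v" using Y(1) circline_iff by blast
  have t: "\<bar>ip v g1\<bar> = 1" "\<bar>ip v g2\<bar> = 1" "\<bar>ip v g3\<bar> = 1" "\<bar>ip v g4\<bar> = 1"
    using Y v(2) tangent_cyc_iff[OF v(1)] u by blast+
  show ?thesis
  proof (cases "ip v g1 = 1")
    case True
    then show ?thesis using that v t by blast
  next
    case False
    then have "ip (- v) g1 = 1" using t(1) by auto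
    then show ?thesis using that[of "- v"] v t by simp
  qed
qed

lemma abs_eq_1_sign: "\<bar>x :: real\<bar> = 1 \<longleftrightarrow> x \<in> {1, -1}"
  by auto

lemma cyc_sign: "a \<in> {1, -1 :: real} \<Longrightarrow> cyc (a *\<^sub>R v) = cyc v"
  by auto

lemma sign_square: "a \<in> {1, -1 :: real} \<Longrightarrow> a * a = 1" "a \<in> {1, -1 :: real} \<Longrightarrow> a * (a * b) = b"
  by auto

lemma six_tangent_signs:
  assumes "six_tangent g1 g2 g3 g4 S" "{a, b, c, d} \<subseteq> {1, -1 :: real}"
  shows "six_tangent (a *\<^sub>R g1) (b *\<^sub>R g2) (c *\<^sub>R g3) (d *\<^sub>R g4) S"
  using assms unfolding six_tangent_def by (simp add: cyc_sign sign_square)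

lemma six_tangent_permute:
  assumes "six_tangent g1 g2 g3 g4 S"
  shows "six_tangent g2 g1 g3 g4 S" "six_tangent g1 g3 g2 g4 S" "six_tangent g1 g2 g4 g3 S"
  using assms unfolding six_tangent_def by (auto simp: Int_ac)

text \<open>If fewer than two patterns are missing, the list is padded, so that two distinct ones
  can be named in every case.\<close>

lemma ex_missing_signs:
  assumes "E \<subseteq> C" "card C = 8" "6 \<le> card E"
  shows "\<exists>\<alpha>\<in>C. \<exists>\<beta>\<in>C. \<alpha> \<noteq> \<beta> \<and> C - E \<subseteq> {\<alpha>, \<beta>}"
proof -
  have fin: "finite C" using assms(2) by (metis card.infinite zero_neq_numeral)
  have "card (C - E) \<le> 2" using assms fin by (simp add: card_Diff_subset finite_subset)
  have "\<exists>D. C - E \<subseteq> D \<and> D \<subseteq> C \<and> card D = 2"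
    using exists_subset_between[of "C - E" 2 C] \<open>card (C - E) \<le> 2\<close> assms fin by auto
  then obtain D where "C - E \<subseteq> D" "D \<subseteq> C" "card D = 2" by blast
  moreover from this obtain \<alpha> \<beta> where "D = {\<alpha>, \<beta>}" "\<alpha> \<noteq> \<beta>" by (auto simp: card_2_iff)
  ultimately show ?thesis by blast
qed

text \<open>The constant and the six products in the form are all characters of the group of sign
  patterns except \<open>a * b * c\<close>. So the deviation of the form from 1, carried by (1, 1,
  1) and \<beta>, is orthogonal to \<open>a * b * c\<close>. This fixes it up to a factor: its two
  values are equal if \<open>a * b * c\<close> is -1 at \<beta>, the first four claims, and opposite
  otherwise, the last three. Expanding it in characters gives the stated coefficients.\<close>

lemma quadratic_form_signs:
  fixes t x12 x13 x14 x23 x24 x34 :: real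
  assumes q: "\<forall>a\<in>{1, -1}. \<forall>b\<in>{1, -1}. \<forall>c\<in>{1, -1}. (a, b, c) \<noteq> (1, 1, 1) \<longrightarrow> (a, b, c) \<noteq> \<beta> \<longrightarrow>
    t + 2 * (a * x12 + b * x13 + c * x14 + (a * b) * x23 + (a * c) * x24 + (b * c) * x34) = 1"
  shows "\<beta> = (1, 1, -1) \<Longrightarrow> x14 = 0 \<and> x24 = 0 \<and> x34 = 0 \<and> x13 = x12 \<and> x23 = x12 \<and> t = 1 + 2 * x12"
    and "\<beta> = (1, -1, 1) \<Longrightarrow> x13 = 0 \<and> x23 = 0 \<and> x34 = 0 \<and> x14 = x12 \<and> x24 = x12 \<and> t = 1 + 2 * x12"
    and "\<beta> = (-1, 1, 1) \<Longrightarrow> x12 = 0 \<and> x23 = 0 \<and> x24 = 0 \<and> x14 = x13 \<and> x34 = x13 \<and> t = 1 + 2 * x13"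
    and "\<beta> = (-1, -1, -1) \<Longrightarrow> x12 = 0 \<and> x13 = 0 \<and> x14 = 0 \<and> x24 = x23 \<and> x34 = x23 \<and> t = 1 + 2 * x23"
    and "\<beta> = (1, -1, -1) \<Longrightarrow> x12 = 0 \<and> x34 = 0 \<and> x14 = x13 \<and> x23 = x13 \<and> x24 = x13 \<and> t = 1"
    and "\<beta> = (-1, 1, -1) \<Longrightarrow> x13 = 0 \<and> x24 = 0 \<and> x14 = x12 \<and> x23 = x12 \<and> x34 = x12 \<and> t = 1"
    and "\<beta> = (-1, -1, 1) \<Longrightarrow> x14 = 0 \<and> x23 = 0 \<and> x13 = x12 \<and> x24 = x12 \<and> x34 = x12 \<and> t = 1"
proof -
  show "x14 = 0 \<and> x24 = 0 \<and> x34 = 0 \<and> x13 = x12 \<and> x23 = x12 \<and> t = 1 + 2 * x12" if \<beta>: "\<beta> = (1, 1, -1)"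
  proof -
    have "t + 2 * ( x12 - x13 + x14 - x23 + x24 - x34) = 1"
      "t + 2 * ( x12 - x13 - x14 - x23 - x24 + x34) = 1"
      "t + 2 * (- x12 + x13 + x14 - x23 - x24 + x34) = 1"
      "t + 2 * (- x12 + x13 - x14 - x23 + x24 - x34) = 1"
      "t + 2 * (- x12 - x13 + x14 + x23 - x24 - x34) = 1"
      "t + 2 * (- x12 - x13 - x14 + x23 + x24 + x34) = 1"
      using q[rule_format, of "1" "-1" "1"]
      q[rule_format, of "1" "-1" "-1"]
      q[rule_format, of "-1" "1" "1"]
      q[rule_format, of "-1" "1" "-1"]
      q[rule_format, of "-1" "-1" "1"]
      q[rule_format, of "-1" "-1" "-1"]
      by (simp_all add: \<beta>)
    then show ?thesis by auto
  qed
  show "x13 = 0 \<and> x23 = 0 \<and> x34 = 0 \<and> x14 = x12 \<and> x24 = x12 \<and> t = 1 + 2 * x12" if \<beta>: "\<beta> = (1, -1, 1)"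
  proof -
    have "t + 2 * ( x12 + x13 - x14 + x23 - x24 - x34) = 1"
      "t + 2 * ( x12 - x13 - x14 - x23 - x24 + x34) = 1"
      "t + 2 * (- x12 + x13 + x14 - x23 - x24 + x34) = 1"
      "t + 2 * (- x12 + x13 - x14 - x23 + x24 - x34) = 1"
      "t + 2 * (- x12 - x13 + x14 + x23 - x24 - x34) = 1"
      "t + 2 * (- x12 - x13 - x14 + x23 + x24 + x34) = 1"
      using q[rule_format, of "1" "1" "-1"]
      q[rule_format, of "1" "-1" "-1"]
      q[rule_format, of "-1" "1" "1"]
      q[rule_format, of "-1" "1" "-1"]
      q[rule_format, of "-1" "-1" "1"]
      q[rule_format, of "-1" "-1" "-1"]
      by (simp_all add: \<beta>)
    then show ?thesis by auto
  qed
  show "x12 = 0 \<and> x23 = 0 \<and> x24 = 0 \<and> x14 = x13 \<and> x34 = x13 \<and> t = 1 + 2 * x13" if \<beta>: "\<beta> = (-1, 1, 1)"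
  proof -
    have "t + 2 * ( x12 + x13 - x14 + x23 - x24 - x34) = 1"
      "t + 2 * ( x12 - x13 + x14 - x23 + x24 - x34) = 1"
      "t + 2 * ( x12 - x13 - x14 - x23 - x24 + x34) = 1"
      "t + 2 * (- x12 + x13 - x14 - x23 + x24 - x34) = 1"
      "t + 2 * (- x12 - x13 + x14 + x23 - x24 - x34) = 1"
      "t + 2 * (- x12 - x13 - x14 + x23 + x24 + x34) = 1"
      using q[rule_format, of "1" "1" "-1"]
      q[rule_format, of "1" "-1" "1"]
      q[rule_format, of "1" "-1" "-1"]
      q[rule_format, of "-1" "1" "-1"]
      q[rule_format, of "-1" "-1" "1"]
      q[rule_format, of "-1" "-1" "-1"]
      by (simp_all add: \<beta>)
    then show ?thesis by auto
  qed
  show "x12 = 0 \<and> x13 = 0 \<and> x14 = 0 \<and> x24 = x23 \<and> x34 = x23 \<and> t = 1 + 2 * x23" if \<beta>: "\<beta> = (-1, -1, -1)"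
  proof -
    have "t + 2 * ( x12 + x13 - x14 + x23 - x24 - x34) = 1"
      "t + 2 * ( x12 - x13 + x14 - x23 + x24 - x34) = 1"
      "t + 2 * ( x12 - x13 - x14 - x23 - x24 + x34) = 1"
      "t + 2 * (- x12 + x13 + x14 - x23 - x24 + x34) = 1"
      "t + 2 * (- x12 + x13 - x14 - x23 + x24 - x34) = 1"
      "t + 2 * (- x12 - x13 + x14 + x23 - x24 - x34) = 1"
      using q[rule_format, of "1" "1" "-1"]
      q[rule_format, of "1" "-1" "1"]
      q[rule_format, of "1" "-1" "-1"]
      q[rule_format, of "-1" "1" "1"]
      q[rule_format, of "-1" "1" "-1"]
      q[rule_format, of "-1" "-1" "1"]
      by (simp_all add: \<beta>)
    then show ?thesis by auto
  qed
  show "x12 = 0 \<and> x34 = 0 \<and> x14 = x13 \<and> x23 = x13 \<and> x24 = x13 \<and> t = 1" if \<beta>: "\<beta> = (1, -1, -1)"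
  proof -
    have "t + 2 * ( x12 + x13 - x14 + x23 - x24 - x34) = 1"
      "t + 2 * ( x12 - x13 + x14 - x23 + x24 - x34) = 1"
      "t + 2 * (- x12 + x13 + x14 - x23 - x24 + x34) = 1"
      "t + 2 * (- x12 + x13 - x14 - x23 + x24 - x34) = 1"
      "t + 2 * (- x12 - x13 + x14 + x23 - x24 - x34) = 1"
      "t + 2 * (- x12 - x13 - x14 + x23 + x24 + x34) = 1"
      using q[rule_format, of "1" "1" "-1"]
      q[rule_format, of "1" "-1" "1"]
      q[rule_format, of "-1" "1" "1"]
      q[rule_format, of "-1" "1" "-1"]
      q[rule_format, of "-1" "-1" "1"]
      q[rule_format, of "-1" "-1" "-1"]
      by (simp_all add: \<beta>)
    then show ?thesis by auto
  qed
  show "x13 = 0 \<and> x24 = 0 \<and> x14 = x12 \<and> x23 = x12 \<and> x34 = x12 \<and> t = 1" if \<beta>: "\<beta> = (-1, 1, -1)"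
  proof -
    have "t + 2 * ( x12 + x13 - x14 + x23 - x24 - x34) = 1"
      "t + 2 * ( x12 - x13 + x14 - x23 + x24 - x34) = 1"
      "t + 2 * ( x12 - x13 - x14 - x23 - x24 + x34) = 1"
      "t + 2 * (- x12 + x13 + x14 - x23 - x24 + x34) = 1"
      "t + 2 * (- x12 - x13 + x14 + x23 - x24 - x34) = 1"
      "t + 2 * (- x12 - x13 - x14 + x23 + x24 + x34) = 1"
      using q[rule_format, of "1" "1" "-1"]
      q[rule_format, of "1" "-1" "1"]
      q[rule_format, of "1" "-1" "-1"]
      q[rule_format, of "-1" "1" "1"]
      q[rule_format, of "-1" "-1" "1"]
      q[rule_format, of "-1" "-1" "-1"]
      by (simp_all add: \<beta>)
    then show ?thesis by auto
  qed
  show "x14 = 0 \<and> x23 = 0 \<and> x13 = x12 \<and> x24 = x12 \<and> x34 = x12 \<and> t = 1" if \<beta>: "\<beta> = (-1, -1, 1)"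
  proof -
    have "t + 2 * ( x12 + x13 - x14 + x23 - x24 - x34) = 1"
      "t + 2 * ( x12 - x13 + x14 - x23 + x24 - x34) = 1"
      "t + 2 * ( x12 - x13 - x14 - x23 - x24 + x34) = 1"
      "t + 2 * (- x12 + x13 + x14 - x23 - x24 + x34) = 1"
      "t + 2 * (- x12 + x13 - x14 - x23 + x24 - x34) = 1"
      "t + 2 * (- x12 - x13 - x14 + x23 + x24 + x34) = 1"
      using q[rule_format, of "1" "1" "-1"]
      q[rule_format, of "1" "-1" "1"]
      q[rule_format, of "1" "-1" "-1"]
      q[rule_format, of "-1" "1" "1"]
      q[rule_format, of "-1" "1" "-1"]
      q[rule_format, of "-1" "-1" "-1"]
      by (simp_all add: \<beta>)
    then show ?thesis by auto
  qed
qed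

text \<open>With the sign of the first vector included, and up to a common sign, \<beta> differs
  from (1, 1, 1) in one sign (four cases, told apart by the vector concerned) or in two (three
  cases, one for each division into pairs). Renumbering brings the distinguished vector to the end,
  or the pairs next to each other.\<close>

lemma gram_of_missing_signs:
  assumes six: "six_tangent g1 g2 g3 g4 S" and sp: "spanning g1 g2 g3 g4"
    and dual: "dual_basis g1 g2 g3 g4 h1 h2 h3 h4"
    and q: "\<And>a b c. {a, b, c} \<subseteq> {1, -1} \<Longrightarrow> (a, b, c) \<noteq> (1, 1, 1) \<Longrightarrow> (a, b, c) \<noteq> \<beta> \<Longrightarrow>
      ip (h1 + a *\<^sub>R h2 + b *\<^sub>R h3 + c *\<^sub>R h4) (h1 + a *\<^sub>R h2 + b *\<^sub>R h3 + c *\<^sub>R h4) = (1 :: real)"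
    and \<beta>: "\<beta> \<in> {1, -1} \<times> {1, -1} \<times> {1, -1}" "\<beta> \<noteq> (1, 1, 1)"
  shows "\<exists>k1 k2 k3 k4. {cyc k1, cyc k2, cyc k3, cyc k4} = {cyc g1, cyc g2, cyc g3, cyc g4} \<and>
    six_tangent k1 k2 k3 k4 S \<and> spanning k1 k2 k3 k4 \<and>
    (gram3 k1 k2 k3 k4 \<or> (\<exists>x. x * x = 3 \<and> gram4 x k1 k2 k3 k4))"
    (is "\<exists>k1 k2 k3 k4. ?P k1 k2 k3 k4")
proof -
  have u: "ip g1 g1 = 1" "ip g2 g2 = 1" "ip g3 g3 = 1" "ip g4 g4 = 1"
    using six by (auto simp: six_tangent_def)
  define t where "t = ip h1 h1 + ip h2 h2 + ip h3 h3 + ip h4 h4"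
  have q': "t + 2 * (a * ip h1 h2 + b * ip h1 h3 + c * ip h1 h4 + (a * b) * ip h2 h3 + (a * c) * ip h2 h4
      + (b * c) * ip h3 h4) = 1"
    if "a \<in> {1, -1}" "b \<in> {1, -1}" "c \<in> {1, -1}" "(a, b, c) \<noteq> (1, 1, 1)" "(a, b, c) \<noteq> \<beta>" for a b c
  proof -
    have "ip (h1 + a *\<^sub>R h2 + b *\<^sub>R h3 + c *\<^sub>R h4) (h1 + a *\<^sub>R h2 + b *\<^sub>R h3 + c *\<^sub>R h4) =
       ip h1 h1 + (a * a) * ip h2 h2 + (b * b) * ip h3 h3 + (c * c) * ip h4 h4
        + 2 * (a * ip h1 h2 + b * ip h1 h3 + c * ip h1 h4 + (a * b) * ip h2 h3 + (a * c) * ip h2 h4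
        + (b * c) * ip h3 h4)"
      by (simp add: ip_commute[of h2 h1] ip_commute[of h3 h1] ip_commute[of h4 h1]
          ip_commute[of h3 h2] ip_commute[of h4 h2] ip_commute[of h4 h3] algebra_simps)
    then show ?thesis using q[of a b c] that by (simp add: sign_square t_def)
  qed
  have "\<forall>a\<in>{1, -1}. \<forall>b\<in>{1, -1}. \<forall>c\<in>{1, -1}. (a, b, c) \<noteq> (1, 1, 1) \<longrightarrow> (a, b, c) \<noteq> \<beta> \<longrightarrow>
      t + 2 * (a * ip h1 h2 + b * ip h1 h3 + c * ip h1 h4 + (a * b) * ip h2 h3 + (a * c) * ip h2 h4
      + (b * c) * ip h3 h4) = 1"
    using q' by blast
  note signs = quadratic_form_signs[OF this]
  have perm: "?P k1 k2 k3 k4" if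
    "{cyc k1, cyc k2, cyc k3, cyc k4} = {cyc g1, cyc g2, cyc g3, cyc g4}"
    "six_tangent k1 k2 k3 k4 S" "spanning k1 k2 k3 k4"
    "gram3 k1 k2 k3 k4 \<or> (\<exists>x. x * x = 3 \<and> gram4 x k1 k2 k3 k4)" for k1 k2 k3 k4
    using that by blast
  have cm: "ip h2 h1 = ip h1 h2" "ip h3 h1 = ip h1 h3" "ip h4 h1 = ip h1 h4"
    "ip h3 h2 = ip h2 h3" "ip h4 h2 = ip h2 h4" "ip h4 h3 = ip h3 h4" using ip_commute by metis+
  note sps = sp[unfolded spanning_def]
  note duals = dual[unfolded dual_basis_def]
  note sixs = six_tangent_permute[OF six] six
  consider "\<beta> = (1, 1, -1)" | "\<beta> = (1, -1, 1)" | "\<beta> = (-1, 1, 1)" | "\<beta> = (-1, -1, -1)"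
    | "\<beta> = (1, -1, -1)" | "\<beta> = (-1, 1, -1)" | "\<beta> = (-1, -1, 1)"
    using \<beta> by auto
  then show ?thesis
  proof cases
    case 1
    have "gram3 g1 g2 g3 g4"
      by (rule gram3I[OF sp dual u]; use signs(1)[OF 1] t_def cm in argo)
    then show ?thesis using six sp by blast
  next
    case 2
    have sp': "spanning g1 g2 g4 g3" using sps unfolding spanning_def by blast
    have d': "dual_basis g1 g2 g4 g3 h1 h2 h4 h3" using duals unfolding dual_basis_def by simp
    have gr: "gram3 g1 g2 g4 g3"
      by (rule gram3I[OF sp' d' u(1,2,4,3)]; use signs(2)[OF 2] t_def cm in argo)
    have "{cyc g1, cyc g2, cyc g4, cyc g3} = {cyc g1, cyc g2, cyc g3, cyc g4}" by blast
    from perm[OF this sixs(3) sp' disjI1[OF gr]] show ?thesis by (intro exI)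
  next
    case 3
    have sp': "spanning g1 g3 g4 g2" using sps unfolding spanning_def by blast
    have d': "dual_basis g1 g3 g4 g2 h1 h3 h4 h2" using duals unfolding dual_basis_def by simp
    have gr: "gram3 g1 g3 g4 g2"
      by (rule gram3I[OF sp' d' u(1,3,4,2)]; use signs(3)[OF 3] t_def cm in argo)
    have "{cyc g1, cyc g3, cyc g4, cyc g2} = {cyc g1, cyc g2, cyc g3, cyc g4}" by blast
    from perm[OF this six_tangent_permute(3)[OF sixs(2)] sp' disjI1[OF gr]] show ?thesis by (intro exI)
  next
    case 4
    have sp': "spanning g2 g3 g4 g1" using sps unfolding spanning_def by blast
    have d': "dual_basis g2 g3 g4 g1 h2 h3 h4 h1" using duals unfolding dual_basis_def by simp
    have gr: "gram3 g2 g3 g4 g1"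
      by (rule gram3I[OF sp' d' u(2,3,4,1)]; use signs(4)[OF 4] t_def cm in argo)
    have "{cyc g2, cyc g3, cyc g4, cyc g1} = {cyc g1, cyc g2, cyc g3, cyc g4}" by blast
    from perm[OF this six_tangent_permute(3)[OF six_tangent_permute(2)[OF sixs(1)]] sp' disjI1[OF gr]] show ?thesis by (intro exI)
  next
    case 5
    have "\<exists>x. x * x = 3 \<and> gram4 x g1 g2 g3 g4"
      by (rule gram4I[OF sp dual u]; use signs(5)[OF 5] t_def cm in argo)
    then show ?thesis using six sp by blast
  next
    case 6
    have sp': "spanning g1 g3 g2 g4" using sps unfolding spanning_def by blast
    have d': "dual_basis g1 g3 g2 g4 h1 h3 h2 h4" using duals unfolding dual_basis_def by simp
    have gr: "\<exists>x. x * x = 3 \<and> gram4 x g1 g3 g2 g4"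
      by (rule gram4I[OF sp' d' u(1,3,2,4)]; use signs(6)[OF 6] t_def cm in argo)
    have "{cyc g1, cyc g3, cyc g2, cyc g4} = {cyc g1, cyc g2, cyc g3, cyc g4}" by blast
    from perm[OF this sixs(2) sp' disjI2[OF gr]] show ?thesis by (intro exI)
  next
    case 7
    have sp': "spanning g1 g4 g2 g3" using sps unfolding spanning_def by blast
    have d': "dual_basis g1 g4 g2 g3 h1 h4 h2 h3" using duals unfolding dual_basis_def by simp
    have gr: "\<exists>x. x * x = 3 \<and> gram4 x g1 g4 g2 g3"
      by (rule gram4I[OF sp' d' u(1,4,2,3)]; use signs(7)[OF 7] t_def cm in argo)
    have "{cyc g1, cyc g4, cyc g2, cyc g3} = {cyc g1, cyc g2, cyc g3, cyc g4}" by blast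
    from perm[OF this six_tangent_permute(2)[OF sixs(3)] sp' disjI2[OF gr]] show ?thesis by (intro exI)
  qed
qed

lemma gram_of_spanning:
  assumes six: "six_tangent g1 g2 g3 g4 S" and sp: "spanning g1 g2 g3 g4"
  shows "\<exists>k1 k2 k3 k4. {cyc k1, cyc k2, cyc k3, cyc k4} = {cyc g1, cyc g2, cyc g3, cyc g4} \<and>
    six_tangent k1 k2 k3 k4 S \<and> spanning k1 k2 k3 k4 \<and>
    (gram3 k1 k2 k3 k4 \<or> (\<exists>x. x * x = 3 \<and> gram4 x k1 k2 k3 k4))"
proof -
  obtain h1 h2 h3 h4 where d: "dual_basis g1 g2 g3 g4 h1 h2 h3 h4"
    using ex_dual_basis[OF sp] by blast
  define W where "W = (\<lambda>(a, b, c). h1 + a *\<^sub>R h2 + b *\<^sub>R h3 + c *\<^sub>R h4)"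
  define C where "C = {1, -1 :: real} \<times> {1, -1 :: real} \<times> {1, -1 :: real}"
  define E where "E = {e \<in> C. ip (W e) (W e) = 1}"
  have C: "finite C" "card C = 8" by (simp_all add: C_def)
  have "S \<subseteq> (cyc \<circ> W) ` E"
  proof
    fix Y assume "Y \<in> S"
    from six_tangent_solution[OF six this] obtain v where v: "ip v v = 1" "Y = cyc v" "ip v g1 = 1"
      "\<bar>ip v g2\<bar> = 1" "\<bar>ip v g3\<bar> = 1" "\<bar>ip v g4\<bar> = 1" by blast
    have "v = ip v g1 *\<^sub>R h1 + ip v g2 *\<^sub>R h2 + ip v g3 *\<^sub>R h3 + ip v g4 *\<^sub>R h4"
      by (rule dual_basis_expansion[OF sp d])
    then have w: "v = W (ip v g2, ip v g3, ip v g4)" using v(3) by (simp add: W_def)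
    moreover have "(ip v g2, ip v g3, ip v g4) \<in> C" using v(4-6) unfolding C_def abs_eq_1_sign by blast
    ultimately have "(ip v g2, ip v g3, ip v g4) \<in> E" using v(1) unfolding E_def by simp
    then show "Y \<in> (cyc \<circ> W) ` E" using w v(2) by (metis comp_apply imageI)
  qed
  moreover have "finite E" using C by (simp add: E_def)
  ultimately have "card S \<le> card E" by (meson card_image_le card_mono finite_imageI le_trans)
  then have "6 \<le> card E" using six by (simp add: six_tangent_def)
  moreover have "E \<subseteq> C" by (auto simp: E_def)
  ultimately obtain \<alpha> \<beta> where ab: "\<alpha> \<in> C" "\<beta> \<in> C" "\<alpha> \<noteq> \<beta>" "C - E \<subseteq> {\<alpha>, \<beta>}"
    using ex_missing_signs[OF _ C(2)] by blast
  obtain a2 a3 a4 where a: "\<alpha> = (a2, a3, a4)" "a2 \<in> {1, -1}" "a3 \<in> {1, -1}" "a4 \<in> {1, -1}"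
    using ab(1) by (auto simp: C_def)
  obtain b2 b3 b4 where b: "\<beta> = (b2, b3, b4)" "b2 \<in> {1, -1}" "b3 \<in> {1, -1}" "b4 \<in> {1, -1}"
    using ab(2) by (auto simp: C_def)
  have prod: "p * r \<in> {1, -1}" if "p \<in> {1, -1}" "r \<in> {1, -1}" for p r :: real using that by auto
  \<comment> \<open>Multiplying the given vectors by the signs of the missing class \<alpha> turns
    \<alpha> into (1, 1, 1), and \<beta> into the componentwise product of the two.\<close>
  have "six_tangent g1 (a2 *\<^sub>R g2) (a3 *\<^sub>R g3) (a4 *\<^sub>R g4) S"
    using six_tangent_signs[OF six, of 1 a2 a3 a4] a by simp
  moreover have "spanning g1 (a2 *\<^sub>R g2) (a3 *\<^sub>R g3) (a4 *\<^sub>R g4)"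
    using sp a unfolding spanning_def by auto
  moreover have "dual_basis g1 (a2 *\<^sub>R g2) (a3 *\<^sub>R g3) (a4 *\<^sub>R g4) h1 (a2 *\<^sub>R h2) (a3 *\<^sub>R h3) (a4 *\<^sub>R h4)"
    using d a(2-4) by (simp add: dual_basis_def sign_square)
  moreover have "ip (h1 + x *\<^sub>R a2 *\<^sub>R h2 + y *\<^sub>R a3 *\<^sub>R h3 + z *\<^sub>R a4 *\<^sub>R h4)
      (h1 + x *\<^sub>R a2 *\<^sub>R h2 + y *\<^sub>R a3 *\<^sub>R h3 + z *\<^sub>R a4 *\<^sub>R h4) = 1"
    if x: "{x, y, z} \<subseteq> {1, -1}" "(x, y, z) \<noteq> (1, 1, 1)" "(x, y, z) \<noteq> (a2 * b2, a3 * b3, a4 * b4)" for x y z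
  proof -
    have div: "p = r * w" if "p * r = w" "r \<in> {1, -1}" for p r w :: real using that by auto
    have "(x * a2, y * a3, z * a4) \<in> C"
      unfolding C_def using x(1) a(2-4) by (intro SigmaI prod) simp_all
    moreover have "(x * a2, y * a3, z * a4) \<noteq> \<alpha>"
      using x(2) a(2-4) unfolding a(1) by auto
    moreover have "(x * a2, y * a3, z * a4) \<noteq> \<beta>"
      using x(3) div[OF _ a(2)] div[OF _ a(3)] div[OF _ a(4)] unfolding b(1) by blast
    ultimately have "(x * a2, y * a3, z * a4) \<in> E" using ab(4) by blast
    then show ?thesis by (simp add: E_def W_def)
  qed
  moreover have "(a2 * b2, a3 * b3, a4 * b4) \<in> {1, -1} \<times> {1, -1} \<times> {1, -1}"
    by (intro SigmaI prod a(2-4) b(2-4))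
  moreover have "(a2 * b2, a3 * b3, a4 * b4) \<noteq> (1, 1, 1)"
  proof
    assume "(a2 * b2, a3 * b3, a4 * b4) = (1, 1, 1)"
    then have 1: "a2 * b2 = 1" "a3 * b3 = 1" "a4 * b4 = 1" by simp_all
    have inv: "r = p" if "p * r = 1" "p \<in> {1, -1}" for p r :: real using that by auto
    show False
      using inv[OF 1(1) a(2)] inv[OF 1(2) a(3)] inv[OF 1(3) a(4)] ab(3) a(1) b(1) by simp
  qed
  ultimately show ?thesis
    using gram_of_missing_signs[of g1 "a2 *\<^sub>R g2" "a3 *\<^sub>R g3" "a4 *\<^sub>R g4" S h1 "a2 *\<^sub>R h2" "a3 *\<^sub>R h3"
        "a4 *\<^sub>R h4" "(a2 * b2, a3 * b3, a4 * b4)", unfolded cyc_sign[OF a(2)] cyc_sign[OF a(3)] cyc_sign[OF a(4)]]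
    by blast
qed

section \<open>Models of configurations 3 and 4\<close>

text \<open>The device behind all models: when the tangency equations admit only six listed
  candidates and there are six solutions, every candidate is a solution and no two candidates
  coincide.\<close>

lemma six_list:
  assumes "card S = 6" "S \<subseteq> set xs" "length xs = 6"
  shows "S = set xs" and "distinct xs"
proof -
  have "card (set xs) \<le> 6" using assms(3) card_length[of xs] by simp
  then show eq: "S = set xs" using assms card_seteq[of "set xs" S] by simp
  then show "distinct xs" using assms by (simp add: card_distinct)
qed

text \<open>The law of cosines, with the product of the two vectors as the cosine of the angle
  between the radii.\<close>

lemma centre_distance:
  assumes "ip (b, c, d) (b, c, d) = 1" "ip (b', c', d') (b', c', d') = 1" "b > 0" "b' > 0"
  shows "(dist (c /\<^sub>R b) (c' /\<^sub>R b'))\<^sup>2 = (1 / b)\<^sup>2 + (1 / b')\<^sup>2 - 2 * (1 / b) * (1 / b') * ip (b, c, d) (b', c', d')"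
proof -
  have c: "c \<bullet> c = 1 + b * d" "c' \<bullet> c' = 1 + b' * d'" using assms(1,2) by (simp_all add: ip_triple)
  define k where "k = c \<bullet> c'"
  have "(x - y) \<bullet> (x - y) = x \<bullet> x + y \<bullet> y - 2 * (x \<bullet> y)" for x y :: complex
    by (simp add: inner_diff_left inner_diff_right inner_commute)
  then have "(dist (c /\<^sub>R b) (c' /\<^sub>R b'))\<^sup>2 =
      (c /\<^sub>R b) \<bullet> (c /\<^sub>R b) + (c' /\<^sub>R b') \<bullet> (c' /\<^sub>R b') - 2 * ((c /\<^sub>R b) \<bullet> (c' /\<^sub>R b'))"
    unfolding dist_norm power2_norm_eq_inner .
  also have "\<dots> = (1 + b * d) / (b * b) + (1 + b' * d') / (b' * b') - 2 * k / (b * b')"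
    unfolding inner_scaleR_left inner_scaleR_right c k_def[symmetric] by (simp add: divide_inverse)
  also have "(1 + b * d) / (b * b) = (1 / b)\<^sup>2 + d / b"
    using assms(3) by (simp add: field_simps power2_eq_square)
  also have "(1 + b' * d') / (b' * b') = (1 / b')\<^sup>2 + d' / b'"
    using assms(4) by (simp add: field_simps power2_eq_square)
  also have "(1 / b)\<^sup>2 + d / b + ((1 / b')\<^sup>2 + d' / b') - 2 * k / (b * b') =
      (1 / b)\<^sup>2 + (1 / b')\<^sup>2 - 2 * (1 / b) * (1 / b') * (k - (b * d' + d * b') / 2)"
    using assms(3,4) by (simp add: field_simps)
  finally show ?thesis by (simp add: ip_triple k_def)
qed

text \<open>For positive first entries the product -1 makes the distance of the centres the sum of
  the radii.\<close>

lemma ext_tangent_cyc: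
  assumes u: "ip (b, c, d) (b, c, d) = 1" "ip (b', c', d') (b', c', d') = 1" "b > 0" "b' > 0"
    and t: "ip (b, c, d) (b', c', d') = -1" "cyc (b, c, d) \<noteq> cyc (b', c', d')"
  shows "ext_tangent (cyc (b, c, d)) (cyc (b', c', d'))"
proof -
  have "(dist (c /\<^sub>R b) (c' /\<^sub>R b'))\<^sup>2 = (1 / b + 1 / b')\<^sup>2"
    unfolding centre_distance[OF u] t(1) by (simp add: power2_sum)
  then have D: "dist (c /\<^sub>R b) (c' /\<^sub>R b') = 1 / b + 1 / b'"
    using u(3,4) by (simp add: power2_eq_iff_nonneg)
  have "ball (c /\<^sub>R b) (1 / b) \<inter> ball (c' /\<^sub>R b') (1 / b') = {}"
  proof -
    have False if "dist (c /\<^sub>R b) z < 1 / b" "dist (c' /\<^sub>R b') z < 1 / b'" for z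
      using that D dist_triangle2[of "c /\<^sub>R b" "c' /\<^sub>R b'" z] by linarith
    then show ?thesis by (intro equals0I) (auto simp only: mem_ball Int_iff)
  qed
  then show ?thesis
    unfolding ext_tangent_def using tangent_cyc_iff[OF u(1,2)] t u(3,4)
      cyc_eq_circle[OF u(1)] cyc_eq_circle[OF u(2)]
    by (intro conjI exI[of _ "c /\<^sub>R b"] exI[of _ "1 / b"] exI[of _ "c' /\<^sub>R b'"] exI[of _ "1 / b'"]) auto
qed

text \<open>For positive first entries the product 1 makes the distance of the centres the
  difference of the radii.\<close>

lemma int_tangent_cyc:
  assumes u: "ip (b, c, d) (b, c, d) = 1" "ip (b', c', d') (b', c', d') = 1" "b > 0" "b' > 0"
    and t: "ip (b, c, d) (b', c', d') = 1" "cyc (b, c, d) \<noteq> cyc (b', c', d')"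
  shows "int_tangent (cyc (b, c, d)) (cyc (b', c', d'))"
proof -
  have "(dist (c /\<^sub>R b) (c' /\<^sub>R b'))\<^sup>2 = (1 / b - 1 / b')\<^sup>2"
    unfolding centre_distance[OF u] t(1) by (simp add: power2_diff)
  then have D: "dist (c /\<^sub>R b) (c' /\<^sub>R b') = \<bar>1 / b - 1 / b'\<bar>"
    by (metis abs_of_nonneg power2_eq_iff_nonneg power2_abs abs_ge_zero zero_le_dist)
  have "ball (c /\<^sub>R b) (1 / b) \<subseteq> ball (c' /\<^sub>R b') (1 / b') \<or> ball (c' /\<^sub>R b') (1 / b') \<subseteq> ball (c /\<^sub>R b) (1 / b)"
  proof (cases "1 / b \<le> 1 / b'")
    case True
    have "dist (c' /\<^sub>R b') z < 1 / b'" if "dist (c /\<^sub>R b) z < 1 / b" for z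
      using that D True dist_triangle[of "c' /\<^sub>R b'" z "c /\<^sub>R b"] dist_commute[of "c' /\<^sub>R b'" "c /\<^sub>R b"]
      by linarith
    then show ?thesis by (auto simp only: mem_ball subset_iff)
  next
    case False
    have "dist (c /\<^sub>R b) z < 1 / b" if "dist (c' /\<^sub>R b') z < 1 / b'" for z
      using that D False dist_triangle[of "c /\<^sub>R b" z "c' /\<^sub>R b'"] by linarith
    then show ?thesis by (auto simp only: mem_ball subset_iff)
  qed
  then show ?thesis
    unfolding int_tangent_def using tangent_cyc_iff[OF u(1,2)] t u(3,4)
      cyc_eq_circle[OF u(1)] cyc_eq_circle[OF u(2)]
    by (intro conjI exI[of _ "c /\<^sub>R b"] exI[of _ "1 / b"] exI[of _ "c' /\<^sub>R b'"] exI[of _ "1 / b'"]) auto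
qed

section \<open>Configuration 3 in coordinates\<close>

lemma config3_arithmetic:
  fixes a b d x :: real
  assumes "a * a = 4/5" "\<bar>(d - b) / 2\<bar> = 1" "\<bar>- (a * x) + (b / 5 - d) / 2\<bar> = 1"
    "\<bar>a * x + (b / 5 - d) / 2\<bar> = 1" "x * x = b * d"
  shows "b = 0 \<and> x = 0 \<and> (d = 2 \<or> d = -2) \<or>
    (b = 5/2 \<and> d = 1/2 \<or> b = -5/2 \<and> d = -1/2) \<and> (x = 5/4 * a \<or> x = - 5/4 * a)"
proof -
  have "a \<noteq> 0" using assms(1) by auto
  \<comment> \<open>The numbers \<open>w - p\<close> and \<open>w + p\<close> are equal or opposite.
    With \<open>a * x\<close> for \<open>p\<close>, the first case yields the two parallel lines,
    the second the four circles.\<close>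
  have "p = 0 \<and> \<bar>w\<bar> = 1 \<or> w = 0 \<and> (p = 1 \<or> p = -1)" if "\<bar>- p + w\<bar> = 1" "\<bar>p + w\<bar> = 1" for p w :: real
    using that by (auto simp: abs_if split: if_splits)
  from this[OF assms(3,4)]
  consider "a * x = 0" "\<bar>(b / 5 - d) / 2\<bar> = 1" | "(b / 5 - d) / 2 = 0" "a * x = 1 \<or> a * x = -1"
    by blast
  then show ?thesis
  proof cases
    case 1
    then have "x = 0" using \<open>a \<noteq> 0\<close> by simp
    then have "b = 0 \<or> d = 0" using assms(5) by simp
    then show ?thesis using assms(2) 1(2) \<open>x = 0\<close> by auto
  next
    case 2
    have "x = 5/4 * (a * a) * x" using assms(1) by simp
    then have xa: "x = 5/4 * a * (a * x)" by (simp only: mult.assoc)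
    have "x = 5/4 * a \<or> x = - 5/4 * a"
    proof (cases "a * x = 1")
      case True
      show ?thesis using xa unfolding True by simp
    next
      case False
      then have "a * x = -1" using 2(2) by simp
      then show ?thesis using xa by (simp only:) simp
    qed
    moreover have "d = b / 5" using 2(1) by simp
    then have "b = 5/2 \<and> d = 1/2 \<or> b = -5/2 \<and> d = -1/2" using assms(2) by (auto simp: abs_if split: if_splits)
    ultimately show ?thesis by blast
  qed
qed

lemma six_tangent_in:
  assumes "six_tangent g1 g2 g3 g4 S" "Y \<in> S" "X \<in> {cyc g1, cyc g2, cyc g3, cyc g4}"
  shows "tangent Y X" and "tangent X Y"
  using assms unfolding six_tangent_def tangent_commute[of X] by blast+

lemma is_circle_cyc:
  assumes "ip (b, c, d) (b, c, d) = 1" "b \<noteq> 0"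
  shows "is_circle (cyc (b, c, d))"
  unfolding is_circle_def using cyc_eq_circle[OF assms] assms(2)
  by (intro exI[of _ "c /\<^sub>R b"] exI[of _ "1 / \<bar>b\<bar>"]) simp

text \<open>The unit circles have centres \<open>- a\<close>, 0 and \<open>a\<close> on the real
  axis; the entry -1/5 is the power a^2 - 1 of the origin, and the middle circle carries the
  opposite sign.\<close>

lemma config3_model:
  fixes a :: real
  assumes a: "a = 2 / sqrt 5"
    and six: "six_tangent (1, - of_real a, -1/5) (-1, 0, 1) (1, of_real a, -1/5) (0, \<i>, 0) S"
      (is "six_tangent ?k1 ?k2 ?k3 ?k4 S")
  shows "config3 {cyc ?k1, cyc ?k2, cyc ?k3, cyc ?k4} S"
proof -
  have aa: "a * a = 4/5" by (simp add: a)
  have "a > 0" by (simp add: a)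
  \<comment> \<open>With the real axis in first place, the normalization of a solution reads
    \<open>Im c = 1\<close>, and one unknown disappears.\<close>
  have six': "six_tangent ?k4 ?k1 ?k2 ?k3 S"
    using six_tangent_permute(1)[OF six_tangent_permute(2)[OF six_tangent_permute(3)[OF six]]] .
  define T where "T = [cyc (5/2, Complex (5/4 * a) 1, 1/2), cyc (5/2, Complex (-5/4 * a) 1, 1/2),
    cyc (-5/2, Complex (5/4 * a) 1, -1/2), cyc (-5/2, Complex (-5/4 * a) 1, -1/2)]"
  define L where "L = cyc (0, \<i>, 2)"
  define M where "M = cyc (0, \<i>, -2)"
  have sub: "S \<subseteq> set (L # M # T)"
  proof
    fix Y assume "Y \<in> S"
    from six_tangent_solution[OF six' this] obtain v where v: "ip v v = 1" "Y = cyc v" "ip v ?k4 = 1"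
      "\<bar>ip v ?k1\<bar> = 1" "\<bar>ip v ?k2\<bar> = 1" "\<bar>ip v ?k3\<bar> = 1" by blast
    obtain b c d where v': "v = (b, c, d)" by (cases v)
    define x where "x = Re c"
    have "Im c = 1" using v(3) by (simp add: v' ip_triple inner_complex_def)
    then have c: "c = Complex x 1" by (simp add: x_def complex_eq_iff)
    have "ip v ?k2 = (d - b) / 2" "ip v ?k1 = - (a * x) + (b / 5 - d) / 2"
      "ip v ?k3 = a * x + (b / 5 - d) / 2" "ip v v = x * x + 1 - b * d"
      by (simp_all add: v' c ip_triple inner_complex_def field_simps)
    then have *: "b = 0 \<and> x = 0 \<and> (d = 2 \<or> d = -2) \<or>
      (b = 5/2 \<and> d = 1/2 \<or> b = -5/2 \<and> d = -1/2) \<and> (x = 5/4 * a \<or> x = - 5/4 * a)"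
      using v by (intro config3_arithmetic[OF aa]) simp_all
    have i: "Complex 0 1 = \<i>" by (simp add: complex_eq_iff)
    show "Y \<in> set (L # M # T)"
      using * unfolding v(2) v' c L_def M_def T_def list.set i[symmetric]
      by (elim disjE conjE) (simp_all only: insert_iff simp_thms)
  qed
  have cS: "card S = 6" using six unfolding six_tangent_def by blast
  have len: "length (L # M # T) = 6" by (simp add: T_def)
  have S: "S = {L, M} \<union> set T" using six_list(1)[OF cS sub len] by simp
  have dist: "distinct (L # M # T)" using six_list(2)[OF cS sub len] .
  have LM: "L \<in> S" "M \<in> S" using S by simp_all
  have circ: "circle (- of_real a) 1 = cyc ?k1" "circle 0 1 = cyc ?k2" "circle (of_real a) 1 = cyc ?k3"
  proof -
    show "circle (- of_real a) 1 = cyc ?k1" "circle (of_real a) 1 = cyc ?k3"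
      by (simp_all add: circle_eq_cyc inner_complex_def aa)
    have "?k2 = - (1, 0, -1)" by simp
    then show "circle 0 1 = cyc ?k2" by (simp only: cyc_uminus) (simp add: circle_eq_cyc)
  qed
  have lines: "line (0 + \<i> * 1) 1 = L" "line (0 - \<i> * 1) 1 = M" "line 0 1 = cyc ?k4"
    by (simp_all add: line_eq_cyc L_def M_def inner_complex_def)
  show ?thesis
    unfolding config3_def
  proof (intro exI conjI)
    show "norm (1 :: complex) = 1" by simp
    show "L = line (0 + \<i> * 1) 1" "M = line (0 - \<i> * 1) 1" using lines by simp_all
    show "(0 :: complex) \<in> closed_segment (- of_real a) (of_real a)"
      unfolding closed_segment_def by (simp add: exI[of _ "1/2"])
    show "dist (- of_real a) (0 :: complex) = 2 / sqrt 5" "dist (0 :: complex) (of_real a) = 2 / sqrt 5"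
      using \<open>a > 0\<close> by (simp_all add: dist_norm flip: a)
    show "{cyc ?k1, cyc ?k2, cyc ?k3, cyc ?k4} =
        {line 0 1, circle (- of_real a) 1, circle 0 1, circle (of_real a) 1}"
      unfolding circ lines by blast
    show "\<forall>X\<in>{circle (- of_real a) 1, circle 0 1, circle (of_real a) 1}. tangent X L \<and> tangent X M"
      (is "\<forall>X\<in>?C. _")
    proof
      fix X assume "X \<in> ?C"
      then have "X \<in> {cyc ?k1, cyc ?k2, cyc ?k3, cyc ?k4}" unfolding circ by blast
      then show "tangent X L \<and> tangent X M"
        using six_tangent_in(2)[OF six LM(1)] six_tangent_in(2)[OF six LM(2)] by blast
    qed
    show "S = {L, M} \<union> set T" by (rule S)
    have "distinct T" using dist by simp
    then show "card (set T) = 4" using distinct_card[of T] len by simp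
    show "\<forall>X\<in>set T. is_circle X \<and> (\<forall>Y\<in>{cyc ?k1, cyc ?k2, cyc ?k3, cyc ?k4}. tangent X Y)"
    proof
      fix X assume "X \<in> set T"
      then have "X \<in> S" using S by blast
      have "ip (s * 5/2, Complex (t * 5/4 * a) 1, s/2) (s * 5/2, Complex (t * 5/4 * a) 1, s/2) = 1"
        if "s * s = 1" "t * t = 1" for s t :: real
      proof -
        have "ip (s * 5/2, Complex (t * 5/4 * a) 1, s/2) (s * 5/2, Complex (t * 5/4 * a) 1, s/2) =
            25/16 * (t * t) * (a * a) + 1 - 5/4 * (s * s)"
          by (simp add: ip_triple inner_complex_def algebra_simps)
        then show ?thesis using that aa by simp
      qed
      from this[of 1 1] this[of 1 "-1"] this[of "-1" 1] this[of "-1" "-1"]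
      have "is_circle X" using \<open>X \<in> set T\<close> by (auto simp: T_def intro!: is_circle_cyc)
      then show "is_circle X \<and> (\<forall>Y\<in>{cyc ?k1, cyc ?k2, cyc ?k3, cyc ?k4}. tangent X Y)"
        using six_tangent_in(1)[OF six \<open>X \<in> S\<close>] by blast
    qed
  qed simp_all
qed

section \<open>Configuration 4 in coordinates\<close>

lemma config4_arithmetic:
  fixes b d X Y q r :: real
  assumes q: "q * q = 2" and r: "r * r = 3" "r > 0"
    and 1: "(b - d) / 2 = 1" and 2: "\<bar>(d * (3 - 2 * q) - b * (3 + 2 * q)) / 2\<bar> = 1"
    and 3: "\<bar>2 * X + (b * (r * (q + 1)) + d * (r * (q - 1))) / 2\<bar> = 1"
    and 4: "\<bar>2 * Y + (b * (r * (q + 1)) + d * (r * (q - 1))) / 2\<bar> = 1"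
    and 5: "X * X + Y * Y - b * d = 1"
  shows "b = 1 - q / 2 \<and> d = -1 - q / 2 \<and> (X = 1/2 \<or> X = -1/2) \<and> (Y = 1/2 \<or> Y = -1/2) \<or>
    b = 1 - q \<and> d = -1 - q \<and> (X = (r + 1) / 2 \<and> Y = (r - 1) / 2 \<or> X = (r - 1) / 2 \<and> Y = (r + 1) / 2)"
proof -
  have b: "b = d + 2" using 1 by simp
  have "(d * (3 - 2 * q) - b * (3 + 2 * q)) / 2 = - 2 * (q * d) - 3 - 2 * q"
    by (simp add: b field_simps)
  then have "- 2 * (q * d) - 3 - 2 * q = 1 \<or> - 2 * (q * d) - 3 - 2 * q = -1" using 2 by linarith
  \<comment> \<open>Tangency to the smaller concentric circle gives \<open>b = d + 2\<close>; the
    two signs for the larger one separate the circles of type B, listed here by the first value of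
    \<open>d\<close>, from those of type A.\<close>
  then consider "q * d = - 1 - q" | "q * d = - 2 - q" by fastforce
  then show ?thesis
  proof cases
    case 1
    then have "q * (q * d) = q * (- 1 - q)" by simp
    then have "(q * q) * d = - q - q * q" by (simp add: algebra_simps)
    then have d: "d = -1 - q / 2" unfolding q by simp
    have "b * (r * (q + 1)) + d * (r * (q - 1)) = r * (2 - q * q)"
      unfolding b d by (simp add: field_simps)
    then have "b * (r * (q + 1)) + d * (r * (q - 1)) = 0" unfolding q by simp
    then have "\<bar>2 * X\<bar> = 1" "\<bar>2 * Y\<bar> = 1" using 3 4 by simp_all
    then have "X = 1/2 \<or> X = -1/2" "Y = 1/2 \<or> Y = -1/2" by linarith+
    then show ?thesis using b d by simp
  next
    case 2
    then have "q * (q * d) = q * (- 2 - q)" by simp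
    then have "(q * q) * d = - 2 * q - q * q" by (simp add: algebra_simps)
    then have d: "d = -1 - q" unfolding q by simp
    have "b * (r * (q + 1)) + d * (r * (q - 1)) = 2 * r * (1 - q * q)"
      unfolding b d by (simp add: algebra_simps)
    then have "(b * (r * (q + 1)) + d * (r * (q - 1))) / 2 = - r" unfolding q by simp
    then have "\<bar>2 * X - r\<bar> = 1" "\<bar>2 * Y - r\<bar> = 1" using 3 4 by simp_all
    then have XY: "X = (r + 1) / 2 \<or> X = (r - 1) / 2" "Y = (r + 1) / 2 \<or> Y = (r - 1) / 2"
      by (auto simp: abs_if split: if_splits)
    have "b * d = q * q - 1" unfolding b d by (simp add: algebra_simps)
    \<comment> \<open>Up to here four pairs \<open>X\<close>, \<open>Y\<close> are possible; the
      unit condition excludes the two with \<open>X = Y\<close>.\<close>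
    then have s: "X * X + Y * Y = 2" using 5 q by simp
    have sq: "(r + 1) / 2 * ((r + 1) / 2) = 1 + r / 2" "(r - 1) / 2 * ((r - 1) / 2) = 1 - r / 2"
      using r(1) by (simp_all add: field_simps)
    have "\<not> (X = (r + 1) / 2 \<and> Y = (r + 1) / 2)" "\<not> (X = (r - 1) / 2 \<and> Y = (r - 1) / 2)"
    proof -
      have "t = 0" if "X = t'" "Y = t'" "t' * t' = 1 + t / 2" for t t' using s that by simp
      from this[OF _ _ sq(1)] this[of "(r - 1) / 2" "- r"] sq(2) r(2)
      show "\<not> (X = (r + 1) / 2 \<and> Y = (r + 1) / 2)" "\<not> (X = (r - 1) / 2 \<and> Y = (r - 1) / 2)" by auto
    qed
    then show ?thesis using XY b d by fastforce
  qed
qed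

text \<open>The two points of the circle on the line of centres would be equally far from the other
  centre, which is not the midpoint between them.\<close>

lemma circle_centre_unique:
  assumes "circle c s = circle c' s'" "s > 0" "s' > 0"
  shows "c = c'"
proof (rule ccontr)
  assume ne: "c \<noteq> c'"
  have S: "sphere c s = sphere c' s'" using assms(1) by (auto simp: circle_def inj_image_eq_iff)
  define e where "e = sgn (c - c')"
  have e: "norm e = 1" "c - c' = norm (c - c') *\<^sub>R e" using ne by (simp_all add: e_def norm_sgn sgn_div_norm)
  have "norm (c - c') > 0" using ne by simp
  have "c + s *\<^sub>R e \<in> sphere c s" "c - s *\<^sub>R e \<in> sphere c s" using e assms(2) by (simp_all add: dist_norm)
  then have "norm (c - c' + s *\<^sub>R e) = s'" "norm (c - c' - s *\<^sub>R e) = s'"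
    unfolding S by (simp_all add: dist_norm norm_minus_commute algebra_simps)
  moreover have "c - c' + s *\<^sub>R e = (norm (c - c') + s) *\<^sub>R e" "c - c' - s *\<^sub>R e = (norm (c - c') - s) *\<^sub>R e"
    using e(2) by (simp_all add: scaleR_left_distrib scaleR_left_diff_distrib)
  ultimately have "\<bar>norm (c - c') + s\<bar> = \<bar>norm (c - c') - s\<bar>" using e(1) by (metis mult.right_neutral norm_scaleR)
  then show False using \<open>norm (c - c') > 0\<close> assms(2) by linarith
qed

text \<open>The first two vectors are the circles about 0 with radii 1 and R = 3 + 2 q, the second
  reversed, where 1/R = 3 - 2 q. Product \<open>r\<close> with both forces the outer entries
  \<open>- (r * (q - 1))\<close> and \<open>- (r * (q + 1))\<close> of the last two vectors. Their
  product is 3, so a unit vector has a middle entry of length 2, and the product -3 of the last two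
  makes their middle entries perpendicular.\<close>

lemma config4_model:
  fixes q r :: real
  assumes qr: "q = sqrt 2" "r = sqrt 3"
    and six: "six_tangent (1, 0, -1) (2 * q - 3, 0, 3 + 2 * q)
      (- (r * (q - 1)), 2, - (r * (q + 1))) (- (r * (q - 1)), 2 * \<i>, - (r * (q + 1))) S"
      (is "six_tangent ?k1 ?k2 ?k3 ?k4 S")
  shows "config4 {cyc ?k1, cyc ?k2, cyc ?k3, cyc ?k4} S"
proof -
  have q: "q * q = 2" "q > 1" "q < 2" and r: "r * r = 3" "r > 0"
    by (simp_all add: qr real_less_lsqrt)
  have u: "ip ?k1 ?k1 = 1" "ip ?k2 ?k2 = 1" "ip ?k3 ?k3 = 1" "ip ?k4 ?k4 = 1"
    using six unfolding six_tangent_def by blast+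
  define bB dB where "bB = 1 - q / 2" and "dB = -1 - q / 2"
  define bA dA where "bA = 1 - q" and "dA = -1 - q"
  define B where "B = [cyc (bB, Complex (1/2) (1/2), dB), cyc (bB, Complex (1/2) (-1/2), dB),
    cyc (bB, Complex (-1/2) (1/2), dB), cyc (bB, Complex (-1/2) (-1/2), dB)]"
  define T where "T = [cyc (bA, Complex ((r + 1) / 2) ((r - 1) / 2), dA),
    cyc (bA, Complex ((r - 1) / 2) ((r + 1) / 2), dA)]"
  have sub: "S \<subseteq> set (B @ T)"
  proof
    fix Y assume "Y \<in> S"
    from six_tangent_solution[OF six this] obtain v where v: "ip v v = 1" "Y = cyc v" "ip v ?k1 = 1"
      "\<bar>ip v ?k2\<bar> = 1" "\<bar>ip v ?k3\<bar> = 1" "\<bar>ip v ?k4\<bar> = 1" by blast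
    obtain b c d where v': "v = (b, c, d)" by (cases v)
    define x y where "x = Re c" and "y = Im c"
    have c: "c = Complex x y" by (simp add: x_def y_def complex_eq_iff)
    have e: "ip v ?k1 = (b - d) / 2" "ip v ?k2 = (d * (3 - 2 * q) - b * (3 + 2 * q)) / 2"
      "ip v ?k3 = 2 * x + (b * (r * (q + 1)) + d * (r * (q - 1))) / 2"
      "ip v ?k4 = 2 * y + (b * (r * (q + 1)) + d * (r * (q - 1))) / 2"
      "ip v v = x * x + y * y - b * d"
      by (simp_all add: v' c ip_triple inner_complex_def field_simps)
    have "b = 1 - q / 2 \<and> d = -1 - q / 2 \<and> (x = 1/2 \<or> x = -1/2) \<and> (y = 1/2 \<or> y = -1/2) \<or>
      b = 1 - q \<and> d = -1 - q \<and> (x = (r + 1) / 2 \<and> y = (r - 1) / 2 \<or> x = (r - 1) / 2 \<and> y = (r + 1) / 2)"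
      using v(1,3-6) unfolding e by (rule config4_arithmetic[OF q(1) r, rotated 4])
    then show "Y \<in> set (B @ T)"
      unfolding v(2) v' c B_def T_def append.simps list.set bB_def dB_def bA_def dA_def
      by (elim disjE conjE) (simp_all only: insert_iff simp_thms)
  qed
  have cS: "card S = 6" using six unfolding six_tangent_def by blast
  have len: "length (B @ T) = 6" by (simp add: B_def T_def)
  have S: "S = set B \<union> set T" using six_list(1)[OF cS sub len] by simp
  have dist: "distinct (B @ T)" using six_list(2)[OF cS sub len] .
  have unitB: "ip (bB, Complex x y, dB) (bB, Complex x y, dB) = 1" if "x * x = 1/4" "y * y = 1/4" for x y
    using that q(1) by (simp add: ip_triple inner_complex_def bB_def dB_def field_simps)
  have "bB > 0" using q by (simp add: bB_def)
  \<comment> \<open>The radius 2 + q of a type B circle is half the sum of the radii 1 and 3 + 2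
    q.\<close>
  have inv: "inverse bB = 2 + q"
  proof -
    have "bB * (2 + q) = 1" using q(1) by (simp add: bB_def field_simps)
    then show ?thesis using \<open>bB > 0\<close> by (metis inverse_unique)
  qed
  have scale: "(2 + q) *\<^sub>R Complex x y = Complex ((2 + q) * x) ((2 + q) * y)" for x y
    by (simp add: complex_eq_iff)
  have circB: "cyc (bB, Complex x y, dB) = circle (Complex ((2 + q) * x) ((2 + q) * y)) (2 + q)"
    if "x * x = 1/4" "y * y = 1/4" for x y
    unfolding cyc_eq_circle[OF unitB[OF that] less_imp_neq[OF \<open>bB > 0\<close>, symmetric]]
    using \<open>bB > 0\<close> inv scale[of x y] by (simp flip: inverse_eq_divide)
  have quarter: "(1/2) * (1/2) = (1/4 :: real)" "(-1/2) * (-1/2) = (1/4 :: real)" by simp_all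
  have inB: "\<exists>x y. x * x = 1/4 \<and> y * y = 1/4 \<and> X = cyc (bB, Complex x y, dB)" if "X \<in> set B" for X
    using that quarter unfolding B_def list.set by blast
  define R where "R = 3 + 2 * q"
  have R: "R > 0" "R * (3 - 2 * q) = 1" using q by (simp_all add: R_def algebra_simps)
  have W: "circle 0 1 = cyc ?k1" by (simp add: circle_eq_cyc)
  have V: "circle 0 R = cyc ?k2"
  proof -
    have "1 / R = 3 - 2 * q" using R by (simp add: field_simps)
    then have "circle 0 R = cyc (- ?k2)"
      using R(1) by (simp add: circle_eq_cyc power2_eq_square) (simp add: R_def)
    then show ?thesis by (simp only: cyc_uminus)
  qed
  define m where "m = r * (q - 1)"
  have m: "m > 0" using q r by (simp add: m_def)
  have P1: "cyc ?k3 = circle (2 /\<^sub>R (- m)) (1 / m)" and P2: "cyc ?k4 = circle ((2 * \<i>) /\<^sub>R (- m)) (1 / m)"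
    using cyc_eq_circle[OF u(3)] cyc_eq_circle[OF u(4)] m by (simp_all flip: m_def)
  have tW: "tangent X (cyc ?k1)" "tangent X (cyc ?k2)" "tangent (cyc ?k3) X" "tangent (cyc ?k4) X"
    if "X \<in> S" for X
    using six_tangent_in[OF six that] by simp_all
  show ?thesis
    unfolding config4_def
  proof (intro exI conjI)
    show "R = (3 + 2 * sqrt 2) * 1" by (simp add: R_def qr)
    show "cyc ?k1 = circle 0 1" "cyc ?k2 = circle 0 R" using W V by simp_all
    have "distinct B" using dist by simp
    then show "card (set B) = 4" using distinct_card[of B] by (simp add: B_def)
    show "\<forall>X\<in>set B. type_B (cyc ?k1) (cyc ?k2) X"
    proof
      fix X assume X: "X \<in> set B"
      then have "X \<in> S" using S by blast
      obtain x y where xy: "x * x = 1/4" "y * y = 1/4" "X = cyc (bB, Complex x y, dB)" using inB[OF X] by blast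
      note un = unitB[OF xy(1,2)]
      have ip: "ip (bB, Complex x y, dB) ?k1 = 1" by (simp add: ip_triple bB_def dB_def)
      have "cyc (bB, Complex x y, dB) \<noteq> cyc ?k1"
        using tW(1)[OF \<open>X \<in> S\<close>] tangent_cyc_iff[OF un u(1)] xy(3) by simp
      from int_tangent_cyc[OF un u(1) \<open>bB > 0\<close> zero_less_one ip this]
      have "int_tangent X (cyc ?k1)" using xy(3) by simp
      moreover have "is_circle X" using is_circle_cyc[OF un] \<open>bB > 0\<close> xy(3) by simp
      ultimately show "type_B (cyc ?k1) (cyc ?k2) X" using tW(2)[OF \<open>X \<in> S\<close>] by (simp add: type_B_def)
    qed
    show "square_vertices {c. \<exists>s>0. circle c s \<in> set B}"
    proof -
      define k where "k = (2 + q) / 2"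
      have "k > 0" using q by (simp add: k_def)
      have B: "B = [circle (Complex k k) (2 + q), circle (Complex k (- k)) (2 + q),
          circle (Complex (- k) k) (2 + q), circle (Complex (- k) (- k)) (2 + q)]"
        unfolding B_def by (simp add: circB k_def)
      have "2 + q > 0" using q by simp
      have "{c. \<exists>s>0. circle c s \<in> set B} = {Complex k k, Complex k (- k), Complex (- k) k, Complex (- k) (- k)}"
        unfolding B list.set using circle_centre_unique \<open>2 + q > 0\<close> by blast
      also have "\<dots> = {Complex (- k) (- k), Complex (- k) (- k) + of_real (2 * k),
          Complex (- k) (- k) + of_real (2 * k) + \<i> * of_real (2 * k), Complex (- k) (- k) + \<i> * of_real (2 * k)}"
      proof -
        have "Complex (- k) (- k) + of_real (2 * k) = Complex k (- k)"
          "Complex (- k) (- k) + of_real (2 * k) + \<i> * of_real (2 * k) = Complex k k"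
          "Complex (- k) (- k) + \<i> * of_real (2 * k) = Complex (- k) k"
          by (simp_all add: complex_eq_iff)
        then show ?thesis by (simp only:) blast
      qed
      finally show ?thesis
        unfolding square_vertices_def using \<open>k > 0\<close>
        by (intro exI[of _ "Complex (- k) (- k)"] exI[of _ "of_real (2 * k)"]) simp
    qed
    show "1 / m > 0" "1 / m > 0" using m by simp_all
    show "\<forall>X\<in>set B. tangent (circle (2 /\<^sub>R (- m)) (1 / m)) X \<and> tangent (circle ((2 * \<i>) /\<^sub>R (- m)) (1 / m)) X"
      unfolding P1[symmetric] P2[symmetric] using tW S by blast
    show "2 /\<^sub>R (- m) \<noteq> (0 :: complex)" "(2 * \<i>) /\<^sub>R (- m) \<noteq> 0" using m by simp_all
    show "(2 /\<^sub>R (- m) - 0) \<bullet> ((2 * \<i>) /\<^sub>R (- m) - 0) = 0" by (simp add: inner_complex_def)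
    show "{cyc ?k1, cyc ?k2, cyc ?k3, cyc ?k4} =
        {cyc ?k1, cyc ?k2, circle (2 /\<^sub>R (- m)) (1 / m), circle ((2 * \<i>) /\<^sub>R (- m)) (1 / m)}"
      unfolding P1 P2 ..
    show "S = set B \<union> set T" by (rule S)
    have "distinct T" using dist by simp
    then show "card (set T) = 2" using distinct_card[of T] by (simp add: T_def)
    show "\<forall>X\<in>set T. type_A (cyc ?k1) (cyc ?k2) X \<and> (\<forall>Y\<in>{cyc ?k1, cyc ?k2, cyc ?k3, cyc ?k4}. tangent X Y)"
    proof
      fix X assume X: "X \<in> set T"
      then have "X \<in> S" using S by blast
      obtain x y where xy: "x * x + y * y = 2" "X = cyc (bA, Complex x y, dA)"
      proof -
        have "(r + 1) / 2 * ((r + 1) / 2) + (r - 1) / 2 * ((r - 1) / 2) = 2"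
          using r(1) by (simp add: field_simps)
        then show ?thesis using that X unfolding T_def list.set by (metis add.commute empty_iff insert_iff)
      qed
      \<comment> \<open>The first entry \<open>bA\<close> is negative. After the change of sign that
        makes it positive, the product with the inner circle is -1, which means external
        tangency.\<close>
      have X_eq: "X = cyc (- bA, - Complex x y, - dA)" using xy(2) cyc_uminus[of "(bA, Complex x y, dA)"] by simp
      have un: "ip (- bA, - Complex x y, - dA) (- bA, - Complex x y, - dA) = 1"
        using xy(1) q(1) by (simp add: ip_triple inner_complex_def bA_def dA_def algebra_simps)
      have ip: "ip (- bA, - Complex x y, - dA) ?k1 = -1" by (simp add: ip_triple bA_def dA_def)
      have pos: "- bA > 0" using q by (simp add: bA_def)
      have "cyc (- bA, - Complex x y, - dA) \<noteq> cyc ?k1"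
        using tW(1)[OF \<open>X \<in> S\<close>] tangent_cyc_iff[OF un u(1)] X_eq by simp
      from ext_tangent_cyc[OF un u(1) pos zero_less_one ip this]
      have "ext_tangent X (cyc ?k1)" using X_eq by simp
      moreover have "is_circle X" using is_circle_cyc[OF un] pos X_eq by simp
      ultimately have "type_A (cyc ?k1) (cyc ?k2) X" using tW(2)[OF \<open>X \<in> S\<close>] by (simp add: type_A_def)
      then show "type_A (cyc ?k1) (cyc ?k2) X \<and> (\<forall>Y\<in>{cyc ?k1, cyc ?k2, cyc ?k3, cyc ?k4}. tangent X Y)"
        using six_tangent_in(1)[OF six \<open>X \<in> S\<close>] by blast
    qed
  qed simp
qed

text \<open>Applies to any circle or line tangent to the four given ones, whether or not it belongs
  to the set of solutions: configuration 1 demands that every tangent circle of type I or II be a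
  solution.\<close>

lemma tangent_vector:
  assumes "circline Y" "ip g1 g1 = 1" "ip g2 g2 = 1" "ip g3 g3 = 1" "ip g4 g4 = 1"
    and "\<forall>X\<in>{cyc g1, cyc g2, cyc g3, cyc g4}. tangent Y X"
  shows "\<exists>v. ip v v = 1 \<and> Y = cyc v \<and> ip v g1 = 1 \<and> \<bar>ip v g2\<bar> = 1 \<and> \<bar>ip v g3\<bar> = 1 \<and> \<bar>ip v g4\<bar> = 1"
proof -
  obtain v where v: "ip v v = 1" "Y = cyc v" using assms(1) circline_iff by blast
  have "tangent (cyc v) (cyc g1)" "tangent (cyc v) (cyc g2)" "tangent (cyc v) (cyc g3)" "tangent (cyc v) (cyc g4)"
    using assms(6) v(2) by simp_all
  then have t: "\<bar>ip v g1\<bar> = 1" "\<bar>ip v g2\<bar> = 1" "\<bar>ip v g3\<bar> = 1" "\<bar>ip v g4\<bar> = 1"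
    using tangent_cyc_iff[OF v(1)] assms(2-5) by simp_all
  show ?thesis
  proof (cases "ip v g1 = 1")
    case True
    then show ?thesis using v t by blast
  next
    case False
    then have "ip (- v) g1 = 1" using t(1) by auto
    then show ?thesis using v t by (intro exI[of _ "- v"]) simp
  qed
qed

section \<open>Models of configurations 2 and 1\<close>

text \<open>Cramer's rule: the coordinates of \<open>z\<close> with respect to \<open>u\<close>,
  \<open>v\<close> are its products with the inner normals of the sides, divided by the sine
  \<open>k\<close> of the angle.\<close>

lemma sectorI:
  assumes "crossing_directions u v" "z \<bullet> (\<i> * u) \<ge> 0" "z \<bullet> (- \<i> * v) \<ge> 0"
  shows "z \<in> sector 0 u v"
proof -
  define k where "k = Im (cnj u * v)"
  have k: "k > 0" using assms(1) by (simp add: k_def crossing_directions_def)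
  have "k *\<^sub>R z = (z \<bullet> (- \<i> * v)) *\<^sub>R u + (z \<bullet> (\<i> * u)) *\<^sub>R v"
    by (simp add: complex_eq_iff k_def inner_complex_def algebra_simps)
  then have "z = inverse k *\<^sub>R ((z \<bullet> (- \<i> * v)) *\<^sub>R u + (z \<bullet> (\<i> * u)) *\<^sub>R v)"
    using k by (metis scaleR_scaleR left_inverse less_irrefl scaleR_one)
  also have "\<dots> = (inverse k * (z \<bullet> (- \<i> * v))) *\<^sub>R u + (inverse k * (z \<bullet> (\<i> * u))) *\<^sub>R v"
    by (simp only: scaleR_right_distrib scaleR_scaleR)
  finally have "z = 0 + (inverse k * (z \<bullet> (- \<i> * v))) *\<^sub>R u + (inverse k * (z \<bullet> (\<i> * u))) *\<^sub>R v"
    by simp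
  moreover have "inverse k * (z \<bullet> (- \<i> * v)) \<ge> 0" "inverse k * (z \<bullet> (\<i> * u)) \<ge> 0"
    using k by (intro mult_nonneg_nonneg assms(2,3); simp)+
  ultimately show ?thesis unfolding sector_def by blast
qed

text \<open>The product of \<open>c\<close> with an inner normal is the signed distance of the
  centre from that side in units of the radius; a value of at least 1 keeps the circle in the
  half-plane.\<close>

lemma inscribed_cycI:
  assumes uv: "crossing_directions u v"
    and w: "ip (b, c, d) (b, c, d) = 1" "b > 0" "c \<bullet> (\<i> * u) \<ge> 1" "c \<bullet> (- \<i> * v) \<ge> 1"
    and t: "tangent (cyc (b, c, d)) (line 0 u)" "tangent (cyc (b, c, d)) (line 0 v)"
  shows "inscribed 0 u v (cyc (b, c, d))"
proof -
  have half: "z \<bullet> n \<ge> 0" if "norm n = 1" "c \<bullet> n \<ge> 1" "dist (c /\<^sub>R b) z = 1 / b" for z n :: complex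
  proof -
    have "(c /\<^sub>R b - z) \<bullet> n \<le> norm (c /\<^sub>R b - z) * norm n" by (rule norm_cauchy_schwarz)
    also have "\<dots> = 1 / b" using that by (simp add: dist_norm)
    finally have "(c \<bullet> n) / b - z \<bullet> n \<le> 1 / b" by (simp add: inner_diff_left divide_inverse_commute)
    moreover have "1 / b \<le> (c \<bullet> n) / b" using that(2) w(2) by (simp add: divide_right_mono)
    ultimately show ?thesis by linarith
  qed
  have n: "norm (\<i> * u) = 1" "norm (- \<i> * v) = 1"
    using uv by (simp_all add: crossing_directions_def norm_mult)
  have eq: "cyc (b, c, d) = circle (c /\<^sub>R b) (1 / b)" using cyc_eq_circle[OF w(1)] w(2) by simp
  have "cyc (b, c, d) \<subseteq> Some ` sector 0 u v"
    unfolding eq circle_def using half[OF n(1) w(3)] half[OF n(2) w(4)] sectorI[OF uv]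
    by (intro image_mono subsetI) (simp only: mem_sphere)
  moreover have "is_circle (cyc (b, c, d))" using is_circle_cyc[OF w(1)] w(2) by simp
  ultimately show ?thesis unfolding inscribed_def using t by blast
qed

text \<open>The quantity \<open>\<bar>c \<bullet> n\<bar>\<close> is the distance of the centre from
  the line in units of the radius. The intersection points are the roots of a quadratic in the
  parameter along the line, whose discriminant is four times D = 1 - (c.n)^2.\<close>

lemma card_cyc_Int_line:
  assumes v: "ip (b, c, d) (b, c, d) = 1" "b \<noteq> 0" and n: "norm n = 1" "\<bar>c \<bullet> n\<bar> < 1"
  shows "card (cyc (b, c, d) \<inter> cyc (0, n, 0)) = 2"
proof -
  define e where "e = c \<bullet> (\<i> * n)"
  have nn: "n \<bullet> n = 1" "(\<i> * n) \<bullet> (\<i> * n) = 1" using n(1) by (simp_all add: dot_square_norm norm_mult)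
  have cc: "c \<bullet> c = (c \<bullet> n) * (c \<bullet> n) + e * e"
    by (subst (2) complex_orthogonal_decomposition[OF n(1), of c])
       (simp only: inner_add_right inner_scaleR_right e_def)
  define D where "D = e * e - b * d"
  have "D = 1 - (c \<bullet> n) * (c \<bullet> n)" using v(1) cc by (simp add: D_def ip_triple)
  moreover have "(c \<bullet> n) * (c \<bullet> n) < 1"
    using n(2) by (metis abs_square_less_1 power2_eq_square)
  ultimately have "D > 0" by simp
  define t where "t k = (e + k * sqrt D) / b" for k
  have root: "b * (x * x) + d = 2 * (x * e) \<longleftrightarrow> x = t 1 \<or> x = t (-1)" for x
  proof -
    have "(b * x - e) * (b * x - e) = D + b * (b * (x * x) + d - 2 * (x * e))"
      by (simp add: D_def algebra_simps)
    then have "b * (x * x) + d = 2 * (x * e) \<longleftrightarrow> (b * x - e)\<^sup>2 = (sqrt D)\<^sup>2"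
      using v(2) \<open>D > 0\<close> by (auto simp: power2_eq_square)
    also have "\<dots> \<longleftrightarrow> b * x - e = sqrt D \<or> b * x - e = - sqrt D" by (simp add: power2_eq_iff)
    also have "\<dots> \<longleftrightarrow> x = t 1 \<or> x = t (-1)"
      using v(2) by (auto simp: t_def field_simps)
    finally show ?thesis .
  qed
  have L: "cyc (0, n, 0) = line 0 (\<i> * n)" using cyc_eq_line[OF n(1), of 0] by simp
  have on: "Some (x *\<^sub>R (\<i> * n)) \<in> cyc (b, c, d) \<longleftrightarrow> b * (x * x) + d = 2 * (x * e)" for x
    by (auto simp: in_cyc_simps nn e_def simp del: mult_scaleR_right)
  have "cyc (b, c, d) \<inter> cyc (0, n, 0) = {Some (t 1 *\<^sub>R (\<i> * n)), Some (t (-1) *\<^sub>R (\<i> * n))}"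
  proof (intro equalityI subsetI)
    fix Q assume Q: "Q \<in> cyc (b, c, d) \<inter> cyc (0, n, 0)"
    have "Q \<noteq> None"
    proof
      assume "Q = None"
      then have "b = 0" using Q in_cyc_simps(1)[of b c d] by simp
      then show False using v(2) by simp
    qed
    then obtain x where "Q = Some (x *\<^sub>R (\<i> * n))" using Q unfolding L line_def by auto
    moreover from this have "x = t 1 \<or> x = t (-1)" using Q unfolding on[symmetric] root[symmetric] by blast
    ultimately show "Q \<in> {Some (t 1 *\<^sub>R (\<i> * n)), Some (t (-1) *\<^sub>R (\<i> * n))}" by auto
  next
    fix Q assume "Q \<in> {Some (t 1 *\<^sub>R (\<i> * n)), Some (t (-1) *\<^sub>R (\<i> * n))}"
    then obtain x where x: "Q = Some (x *\<^sub>R (\<i> * n))" "x = t 1 \<or> x = t (-1)" by blast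
    then have "Q \<in> cyc (b, c, d)" using on root by blast
    moreover have "Q \<in> cyc (0, n, 0)" unfolding L line_def x(1) by auto
    ultimately show "Q \<in> cyc (b, c, d) \<inter> cyc (0, n, 0)" by blast
  qed
  moreover have "t 1 \<noteq> t (-1)" using v(2) \<open>D > 0\<close> by (simp add: t_def)
  moreover have "n \<noteq> 0" using n(1) by auto
  ultimately show ?thesis by simp
qed

text \<open>The quotient \<open>d / b\<close> is the power of the origin with respect to the
  circle.\<close>

lemma centre_distance_0:
  assumes "ip (b, c, d) (b, c, d) = 1" "b > 0"
  shows "d < 0 \<Longrightarrow> dist (c /\<^sub>R b) 0 < 1 / b" and "d > 0 \<Longrightarrow> dist (c /\<^sub>R b) 0 > 1 / b"
proof -
  have "(norm c)\<^sup>2 = 1 + b * d" using assms(1) by (simp add: ip_triple dot_square_norm)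
  moreover have D: "dist (c /\<^sub>R b) 0 = norm c / b" using assms(2) by (simp add: divide_inverse_commute)
  ultimately show "d < 0 \<Longrightarrow> dist (c /\<^sub>R b) 0 < 1 / b" "d > 0 \<Longrightarrow> dist (c /\<^sub>R b) 0 > 1 / b"
    using assms(2) by (simp_all add: D divide_strict_right_mono mult_pos_neg power2_less_imp_less[of _ 1]
        power2_less_imp_less[of 1])
qed

lemma type_I_cycI:
  assumes "ip (b, c, d) (b, c, d) = 1" "b > 0" "d < 0"
    and "card (cyc (b, c, d) \<inter> line 0 u) = 2" "card (cyc (b, c, d) \<inter> line 0 v) = 2"
  shows "type_I 0 u v (cyc (b, c, d))"
  unfolding type_I_def using cyc_eq_circle[OF assms(1)] centre_distance_0(1)[OF assms(1,2,3)] assms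
  by (intro conjI exI[of _ "c /\<^sub>R b"] exI[of _ "1 / b"]) simp_all

lemma type_II_cycI:
  assumes "ip (b, c, d) (b, c, d) = 1" "b > 0" "d > 0"
    and "card (cyc (b, c, d) \<inter> line 0 u) = 2" "card (cyc (b, c, d) \<inter> line 0 v) = 2"
  shows "type_II 0 u v (cyc (b, c, d))"
  unfolding type_II_def using cyc_eq_circle[OF assms(1)] centre_distance_0(2)[OF assms(1,2,3)] assms
  by (intro conjI exI[of _ "c /\<^sub>R b"] exI[of _ "1 / b"]) simp_all

lemma image_cyc_involution:
  assumes "\<And>P. f (f P) = P" "\<And>P. f P \<in> cyc v' \<longleftrightarrow> P \<in> cyc v"
  shows "f ` cyc v = cyc v'"
proof (intro equalityI subsetI)
  fix P assume "P \<in> cyc v'"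
  then have "f P \<in> cyc v" using assms by metis
  then show "P \<in> f ` cyc v" using assms(1) by (metis imageI)
qed (use assms(2) in blast)

lemma point_symmetry_cyc: "point_symmetry 0 ` cyc (b, c, d) = cyc (b, - c, d)"
proof (rule image_cyc_involution)
  show "point_symmetry 0 (point_symmetry 0 P) = P" for P
    by (cases P) (simp_all add: point_symmetry_def)
  show "point_symmetry 0 P \<in> cyc (b, - c, d) \<longleftrightarrow> P \<in> cyc (b, c, d)" for P
    by (cases P) (simp_all add: point_symmetry_def in_cyc_simps)
qed

lemma line_symmetry_cyc:
  assumes "k \<noteq> 0"
  shows "line_symmetry 0 (Complex 0 k) ` cyc (b, Complex x y, d) = cyc (b, Complex (- x) y, d)"
proof (rule image_cyc_involution)
  have eq: "2 * (0 + (((z - 0) \<bullet> Complex 0 k) / (Complex 0 k \<bullet> Complex 0 k)) *\<^sub>R Complex 0 k) - z = - cnj z" for z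
    using assms by (simp add: complex_eq_iff inner_complex_def)
  show "line_symmetry 0 (Complex 0 k) (line_symmetry 0 (Complex 0 k) P) = P" for P
    unfolding line_symmetry_def eq by (cases P) simp_all
  show "line_symmetry 0 (Complex 0 k) P \<in> cyc (b, Complex (- x) y, d) \<longleftrightarrow> P \<in> cyc (b, Complex x y, d)" for P
    unfolding line_symmetry_def eq by (cases P) (simp_all add: in_cyc_simps inner_complex_def)
qed

text \<open>The lines have the unit normals \<open>s \<plusminus> \<i> c\<close>, so that sectors I and III are bisected by the real
  axis.\<close>

lemma crossing_lines:
  fixes s c :: real
  assumes "s > 0" "c > 0" "s * s + c * c = 1"
  shows "crossing_directions (Complex c (- s)) (Complex c s)"
    and "crossing_directions (Complex c s) (- Complex c (- s))"
    and "crossing_directions (- Complex c s) (Complex c (- s))"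
    and "line 0 (Complex c (- s)) = cyc (0, Complex s c, 0)"
    and "line 0 (Complex c s) = cyc (0, Complex s (- c), 0)"
    and "line 0 (- Complex c s) = line 0 (Complex c s)"
    and "line 0 (- Complex c (- s)) = line 0 (Complex c (- s))"
    and "norm (Complex s c) = 1" "norm (Complex s (- c)) = 1"
proof -
  have n: "norm (Complex c (- s)) = 1" "norm (Complex c s) = 1"
    using assms(3) by (simp_all add: complex_norm power2_eq_square add.commute)
  show "norm (Complex s c) = 1" "norm (Complex s (- c)) = 1"
    using assms(3) by (simp_all add: complex_norm power2_eq_square)
  show "crossing_directions (Complex c (- s)) (Complex c s)"
    "crossing_directions (Complex c s) (- Complex c (- s))"
    "crossing_directions (- Complex c s) (Complex c (- s))"
    using n assms unfolding crossing_directions_def norm_minus_cancel by simp_all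
  have "\<i> * Complex c (- s) = Complex s c" by (simp add: complex_eq_iff)
  then show "line 0 (Complex c (- s)) = cyc (0, Complex s c, 0)" using line_eq_cyc[OF n(1), of 0] by simp
  have "(0, \<i> * Complex c s, 0) = - (0 :: real, Complex s (- c), 0 :: real)" by (simp add: complex_eq_iff)
  then show "line 0 (Complex c s) = cyc (0, Complex s (- c), 0)"
    using line_eq_cyc[OF n(2), of 0] by (metis cyc_uminus inner_zero_left mult_zero_right)
  show "line 0 (- Complex c s) = line 0 (Complex c s)" "line 0 (- Complex c (- s)) = line 0 (Complex c (- s))"
    using line_scaleR[of "-1" 0 "Complex c s"] line_scaleR[of "-1" 0 "Complex c (- s)"] by simp_all
qed

section \<open>Configuration 2 in coordinates\<close>

lemma config2_arithmetic:
  fixes s c b e \<beta> \<delta> x y :: real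
  assumes p: "s > 0" "c > 0" "b > 0" "s * s + c * c = 1"
    and 1: "s * x + c * y = 1" and 2: "\<bar>s * x - c * y\<bar> = 1"
    and 3: "\<bar>- (s * x) + e * y + b * (\<beta> - \<delta>) / 2\<bar> = 1"
    and 4: "\<bar>- (s * x) - e * y - b * (\<beta> - \<delta>) / 2\<bar> = 1"
    and 5: "x * x + y * y - \<beta> * \<delta> = 1"
  defines "k \<equiv> \<lambda>t. 2 * (t - e / c) / b"
  shows "x = 1 / s \<and> y = 0 \<and> \<delta> = \<beta> \<and> (\<beta> = c / s \<or> \<beta> = - (c / s)) \<or>
    x = 0 \<and> y = 1 / c \<and> (\<exists>t\<in>{1, -1}. \<delta> = \<beta> - k t \<and>
      (\<exists>r\<in>{1, -1}. \<beta> = (k t + r * sqrt ((k t)\<^sup>2 + 4 * (s / c)\<^sup>2)) / 2))"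
proof -
  define w where "w = b * (\<beta> - \<delta>) / 2"
  \<comment> \<open>Equal signs for the two lines put the centre on the bisector of sectors I and
    III, opposite signs on that of II and IV.\<close>
  have "s * x - c * y = 1 \<or> s * x - c * y = -1" using 2 by (simp add: abs_if split: if_splits)
  then consider "s * x = 1" "c * y = 0" | "s * x = 0" "c * y = 1" using 1 by fastforce
  then show ?thesis
  proof cases
    case 1
    then have xy: "x = 1 / s" "y = 0" using p by (simp_all add: field_simps)
    have "\<bar>- 1 + w\<bar> = 1" "\<bar>- 1 - w\<bar> = 1" using 3 4 1 xy by (simp_all add: w_def)
    then have "w = 0" by (auto simp: abs_if split: if_splits)
    then have d: "\<delta> = \<beta>" using p by (simp add: w_def)
    have "(1 / s) * (1 / s) - \<beta> * \<beta> = 1" using 5 xy d by simp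
    then have "(s * \<beta>) * (s * \<beta>) = 1 - s * s" using p by (simp add: field_simps)
    then have "(s * \<beta>)\<^sup>2 = c\<^sup>2" using p(4) by (simp add: power2_eq_square)
    then have "s * \<beta> = c \<or> s * \<beta> = - c" by (simp add: power2_eq_iff)
    then have "\<beta> = c / s \<or> \<beta> = - (c / s)" using p by (auto simp: field_simps)
    then show ?thesis using xy d by blast
  next
    case 2
    then have xy: "x = 0" "y = 1 / c" using p by (simp_all add: field_simps)
    define t where "t = e / c + w"
    have "\<bar>t\<bar> = 1" using 3 xy by (simp add: w_def t_def)
    then have t: "t \<in> {1, -1}" by auto
    have "b * (\<beta> - \<delta>) = 2 * (t - e / c)" by (simp add: t_def w_def)
    then have d: "\<delta> = \<beta> - k t" using p(3) by (simp add: k_def field_simps)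
    have "(1 / c) * (1 / c) - \<beta> * \<delta> = 1" using 5 xy by simp
    then have "c * c * (\<beta> * \<delta>) = 1 - c * c" using p(2) by (simp add: field_simps)
    then have "c * c * (\<beta> * \<delta>) = s * s" using p(4) by simp
    then have bd: "\<beta> * \<delta> = (s / c)\<^sup>2" using p(2) by (simp add: power2_eq_square field_simps)
    \<comment> \<open>Completing the square in
      \<open>\<beta> * (\<beta> - k t) = (s / c)\<^sup>2\<close>. The two roots have opposite signs,
      one for each of the sectors II and IV.\<close>
    have "(2 * \<beta> - k t)\<^sup>2 = (k t)\<^sup>2 + 4 * (\<beta> * \<delta>)" unfolding d by (simp add: power2_eq_square algebra_simps)
    then have "(2 * \<beta> - k t)\<^sup>2 = (sqrt ((k t)\<^sup>2 + 4 * (s / c)\<^sup>2))\<^sup>2" unfolding bd by simp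
    then have "2 * \<beta> - k t = sqrt ((k t)\<^sup>2 + 4 * (s / c)\<^sup>2) \<or> 2 * \<beta> - k t = - sqrt ((k t)\<^sup>2 + 4 * (s / c)\<^sup>2)"
      unfolding power2_eq_iff .
    then have "\<beta> = (k t + 1 * sqrt ((k t)\<^sup>2 + 4 * (s / c)\<^sup>2)) / 2 \<or>
        \<beta> = (k t + (-1) * sqrt ((k t)\<^sup>2 + 4 * (s / c)\<^sup>2)) / 2"
      by (elim disjE) simp_all
    then show ?thesis using xy d t by blast
  qed
qed

text \<open>All four vectors are orthogonal to (1, 0, 1), so the origin has power -1 with respect to
  the third circle, which makes it of type I once it meets the lines. The fourth vector is the
  reversed mirror image of the third in the imaginary axis, and \<open>b * b = c * c - e * e\<close>
  says that both are unit vectors.\<close>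

lemma config2_model:
  fixes s c b e :: real
  assumes p: "s > 0" "c > 0" "b > 0" "s * s + c * c = 1" "b * b = c * c - e * e"
    and six: "six_tangent (0, Complex s c, 0) (0, Complex s (- c), 0)
      (b, Complex (- s) e, - b) (- b, Complex (- s) (- e), b) S"
      (is "six_tangent ?k1 ?k2 ?k3 ?k4 S")
  shows "config2 {cyc ?k1, cyc ?k2, cyc ?k3, cyc ?k4} S"
proof -
  have un: "ip ?k1 ?k1 = 1" "ip ?k2 ?k2 = 1" "ip ?k3 ?k3 = 1" "ip ?k4 ?k4 = 1"
    using six unfolding six_tangent_def by blast+
  define k where "k t = 2 * (t - e / c) / b" for t
  define \<beta> where "\<beta> t r = (k t + r * sqrt ((k t)\<^sup>2 + 4 * (s / c)\<^sup>2)) / 2" for t r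
  define f where "f t r = cyc (\<beta> t r, Complex 0 (1 / c), \<beta> t r - k t)" for t r
  define T where "T = [f 1 1, f 1 (-1), f (-1) 1, f (-1) (-1)]"
  define W where "W = cyc (c / s, Complex (1 / s) 0, c / s)"
  define W' where "W' = cyc (- (c / s), Complex (1 / s) 0, - (c / s))"
  have sub: "S \<subseteq> set (W # W' # T)"
  proof
    fix Y assume "Y \<in> S"
    from six_tangent_solution[OF six this] obtain v where v: "ip v v = 1" "Y = cyc v" "ip v ?k1 = 1"
      "\<bar>ip v ?k2\<bar> = 1" "\<bar>ip v ?k3\<bar> = 1" "\<bar>ip v ?k4\<bar> = 1" by blast
    obtain bt g d where v': "v = (bt, g, d)" by (cases v)
    define x y where "x = Re g" and "y = Im g"
    have g: "g = Complex x y" by (simp add: x_def y_def complex_eq_iff)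
    have ips: "ip v ?k1 = s * x + c * y" "ip v ?k2 = s * x - c * y"
      "ip v ?k3 = - (s * x) + e * y + b * (bt - d) / 2"
      "ip v ?k4 = - (s * x) - e * y - b * (bt - d) / 2"
      "ip v v = x * x + y * y - bt * d"
      by (simp_all add: v' g ip_triple inner_complex_def field_simps)
    from config2_arithmetic[OF p(1-4) v(3-6,1)[unfolded ips], folded k_def]
    consider "x = 1 / s" "y = 0" "d = bt" "bt = c / s \<or> bt = - (c / s)"
      | t r where "x = 0" "y = 1 / c" "t \<in> {1, -1}" "r \<in> {1, -1}" "d = bt - k t" "bt = \<beta> t r"
      unfolding \<beta>_def by blast
    then show "Y \<in> set (W # W' # T)"
    proof cases
      case 1
      then show ?thesis unfolding v(2) v' g by (elim disjE) (simp_all add: W_def W'_def)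
    next
      case 2
      then have "Y = f t r" unfolding v(2) v' g by (simp add: f_def)
      then show ?thesis using 2(3,4) by (auto simp: T_def)
    qed
  qed
  have cS: "card S = 6" using six unfolding six_tangent_def by blast
  have len: "length (W # W' # T) = 6" by (simp add: T_def)
  have S: "S = {W, W'} \<union> set T" using six_list(1)[OF cS sub len] by simp
  have dist: "distinct (W # W' # T)" using six_list(2)[OF cS sub len] .
  define u where "u = Complex c (- s)"
  define v where "v = Complex c s"
  note L = crossing_lines[OF p(1,2,4), folded u_def v_def]
  have tu: "tangent X (line 0 u)" "tangent X (line 0 v)" "tangent (cyc ?k3) X" "tangent X (cyc ?k3)"
    if "X \<in> S" for X
    using six_tangent_in[OF six that] L(4,5) by simp_all
  have WS: "W \<in> S" "W' \<in> S" using S by simp_all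
  have uW: "ip (c / s, Complex (1 / s) 0, c / s) (c / s, Complex (1 / s) 0, c / s) = 1"
    using p by (simp add: ip_triple inner_complex_def field_simps)
  have W'_eq: "W' = cyc (c / s, - Complex (1 / s) 0, c / s)"
    using cyc_uminus[of "(c / s, - Complex (1 / s) 0, c / s)"] by (simp add: W'_def)
  have uW': "ip (c / s, - Complex (1 / s) 0, c / s) (c / s, - Complex (1 / s) 0, c / s) = 1"
    using p by (simp add: ip_triple inner_complex_def field_simps)
  have cs: "c / s > 0" using p by simp
  have insW: "inscribed 0 u v W"
    unfolding W_def
    by (rule inscribed_cycI[OF L(1) uW cs])
       (use p tu[OF WS(1)] in \<open>simp_all add: inner_complex_def u_def v_def W_def\<close>)
  \<comment> \<open>This bound makes the third circle cross both lines: its products with their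
    normals are \<open>- (s * s) + e * c\<close> and \<open>- (s * s) - e * c\<close>, both smaller
    than 1 in absolute value.\<close>
  have "\<bar>e\<bar> < c"
  proof -
    have "b * b > 0" using p(3) by simp
    then have "\<bar>e\<bar>\<^sup>2 < c\<^sup>2" using p(5) by (simp add: power2_eq_square)
    then show ?thesis using p(2) power2_less_imp_less[of "\<bar>e\<bar>" c] by simp
  qed
  then have "\<bar>e * c\<bar> < c * c" using p(2) by (simp add: abs_mult)
  then have ec: "e * c < c * c" "- (e * c) < c * c" by (simp_all add: abs_less_iff)
  have "0 < s * s" using p(1) by simp
  have "\<bar>- (s * s) + e * c\<bar> < 1" "\<bar>- (s * s) - e * c\<bar> < 1"
    unfolding abs_less_iff using ec \<open>0 < s * s\<close> p(4) by linarith+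
  then have "\<bar>Complex (- s) e \<bullet> Complex s c\<bar> < 1" "\<bar>Complex (- s) e \<bullet> Complex s (- c)\<bar> < 1"
    by (simp_all add: inner_complex_def)
  then have cards: "card (cyc ?k3 \<inter> line 0 u) = 2" "card (cyc ?k3 \<inter> line 0 v) = 2"
    unfolding L(4,5) using card_cyc_Int_line[OF un(3)] L(8,9) p(3) by simp_all
  have insT: "inscribed 0 v (- u) X \<or> inscribed 0 (- v) u X" if X: "X \<in> set T" for X
  proof -
    have XS: "X \<in> S" using X S by blast
    obtain t r where tr: "X = f t r" "r = 1 \<or> r = -1" using X unfolding T_def by auto
    define g where "g = \<beta> t r"
    have "2 * ((a + x) / 2) - a = x" for a x :: real by (simp add: field_simps)
    then have "(2 * g - k t)\<^sup>2 = (r * sqrt ((k t)\<^sup>2 + 4 * (s / c)\<^sup>2))\<^sup>2"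
      unfolding g_def \<beta>_def by presburger
    also have "\<dots> = (k t)\<^sup>2 + 4 * (s / c)\<^sup>2" using tr(2) by (auto simp: power_mult_distrib)
    finally have sq: "(2 * g - k t)\<^sup>2 = (k t)\<^sup>2 + 4 * (s / c)\<^sup>2" .
    have "g * (g - k t) = q" if "(2 * g - k t)\<^sup>2 = (k t)\<^sup>2 + 4 * q" for q
      using that by (simp add: power2_eq_square algebra_simps)
    from this[OF sq] have gk: "g * (g - k t) = (s / c)\<^sup>2" .
    then have "g \<noteq> 0" using p by auto
    have unit: "ip (g, Complex 0 (1 / c), g - k t) (g, Complex 0 (1 / c), g - k t) = 1"
    proof -
      have "ip (g, Complex 0 (1 / c), g - k t) (g, Complex 0 (1 / c), g - k t) = (1 / c) * (1 / c) - g * (g - k t)"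
        by (simp add: ip_triple inner_complex_def)
      also have "\<dots> = 1" unfolding gk using p by (simp add: field_simps power2_eq_square)
      finally show ?thesis .
    qed
    have X_eq: "X = cyc (g, Complex 0 (1 / c), g - k t)" by (simp add: tr(1) f_def g_def)
    show ?thesis
    \<comment> \<open>The centre is i / (c g), so the sign of \<open>g\<close> decides between
      sector II and sector IV.\<close>
    proof (cases "g > 0")
      case True
      have "inscribed 0 v (- u) (cyc (g, Complex 0 (1 / c), g - k t))"
        by (rule inscribed_cycI[OF L(2) unit True])
           (use p tu[OF XS] X_eq L(7) in \<open>simp_all add: inner_complex_def u_def v_def\<close>)
      then show ?thesis using X_eq by simp
    next
      case False
      then have neg: "- g > 0" using \<open>g \<noteq> 0\<close> by simp
      have X_eq': "X = cyc (- g, - Complex 0 (1 / c), - (g - k t))"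
        using X_eq cyc_uminus[of "(g, Complex 0 (1 / c), g - k t)"] by simp
      have unit': "ip (- g, - Complex 0 (1 / c), - (g - k t)) (- g, - Complex 0 (1 / c), - (g - k t)) = 1"
        using unit by (simp only: uminus_Pair[symmetric] ip_bilinear minus_minus)
      have "inscribed 0 (- v) u (cyc (- g, - Complex 0 (1 / c), - (g - k t)))"
        by (rule inscribed_cycI[OF L(3) unit' neg])
           (use p tu[OF XS] X_eq' L(6) in \<open>simp_all add: inner_complex_def u_def v_def\<close>)
      then show ?thesis using X_eq' by simp
    qed
  qed
  have vu: "v - u = Complex 0 (2 * s)" by (simp add: u_def v_def complex_eq_iff)
  have sym: "line_symmetry 0 (v - u) ` cyc ?k3 = cyc ?k4"
  proof -
    have "2 * s \<noteq> 0" using p by simp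
    from line_symmetry_cyc[OF this, of b "- s" e "- b"]
    have "line_symmetry 0 (v - u) ` cyc ?k3 = cyc (b, Complex s e, - b)" by (simp add: vu)
    also have "(b, Complex s e, - b) = - ?k4" by (simp add: complex_eq_iff)
    finally show ?thesis by (simp only: cyc_uminus)
  qed
  have ne: "cyc ?k3 \<noteq> W" "cyc ?k3 \<noteq> W'"
    using tu(3)[OF WS(1)] tu(3)[OF WS(2)] tangent_cyc_iff[OF un(3) uW] tangent_cyc_iff[OF un(3) uW']
    unfolding W_def[symmetric] W'_eq[symmetric] by simp_all
  show ?thesis
    unfolding config2_def
  proof (intro exI conjI)
    show "crossing_directions u v" by (rule L(1))
    show "inscribed 0 u v W" by (rule insW)
    show "W' = point_symmetry 0 ` W" unfolding W_def W'_eq point_symmetry_cyc ..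
    show "type_I 0 u v (cyc ?k3)"
      by (rule type_I_cycI[OF un(3) p(3) _ cards]) (use p in simp)
    show "ext_tangent (cyc ?k3) W"
      unfolding W_def
      by (rule ext_tangent_cyc[OF un(3) uW p(3) cs])
         (use p ne in \<open>simp_all add: ip_triple inner_complex_def flip: W_def\<close>)
    show "int_tangent (cyc ?k3) W'"
      unfolding W'_eq
      by (rule int_tangent_cyc[OF un(3) uW' p(3) cs])
         (use p ne in \<open>simp_all add: ip_triple inner_complex_def flip: W'_eq\<close>)
    show "{cyc ?k1, cyc ?k2, cyc ?k3, cyc ?k4} = {line 0 u, line 0 v, cyc ?k3, line_symmetry 0 (v - u) ` cyc ?k3}"
      unfolding sym L(4,5) ..
    show "S = {W, W'} \<union> set T" by (rule S)
    have "distinct T" using dist by simp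
    then show "card (set T) = 4" using distinct_card[of T] by (simp add: T_def)
    show "\<forall>X\<in>set T. (inscribed 0 v (- u) X \<or> inscribed 0 (- v) u X) \<and>
        (\<forall>Y\<in>{cyc ?k1, cyc ?k2, cyc ?k3, cyc ?k4}. tangent X Y)"
      using insT six_tangent_in(1)[OF six] S by blast
  qed
qed

section \<open>Configuration 1 in coordinates\<close>

lemma config1_arithmetic:
  fixes s c P \<beta> \<delta> x y :: real
  assumes p: "s > 0" "c > 0" "P > 1" "s * s + c * c = 1"
    and 1: "x - (\<beta> * (c * c) + \<delta>) / 2 = s" and 2: "\<bar>x + (\<beta> * (c * c) + \<delta>) / 2\<bar> = s"
    and 3: "\<bar>x - (\<beta> * (c * c) * P + \<delta> / P) / 2\<bar> = s" and 4: "\<bar>x + (\<beta> * (c * c) * P + \<delta> / P) / 2\<bar> = s"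
    and 5: "x * x + y * y - \<beta> * \<delta> = 1"
  shows "\<beta> = 0 \<and> \<delta> = 0 \<and> x = s \<and> (y = c \<or> y = - c) \<or>
    x = 0 \<and> y * y = 1 + \<beta> * \<delta> \<and>
      (\<beta> = 2 * s / (c * c * (P - 1)) \<and> \<delta> = - (2 * s * P / (P - 1)) \<or>
       \<beta> = - (2 * s / (c * c * (P + 1))) \<and> \<delta> = - (2 * s * P / (P + 1)))"
proof -
  define f g where "f = (\<beta> * (c * c) + \<delta>) / 2" and "g = (\<beta> * (c * c) * P + \<delta> / P) / 2"
  have gP: "\<beta> * (c * c) * (P * P) + \<delta> = 2 * g * P" using p(3) by (simp add: g_def field_simps)
  have cc: "c * c > 0" using p(2) by simp
  \<comment> \<open>The three compatible sign patterns. They belong, in this order, to the two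
    lines, the circles of type I and the circles of type II.\<close>
  consider "x = s" "f = 0" "g = 0" | "x = 0" "f = - s" "g = s" | "x = 0" "f = - s" "g = - s"
    using 1 2 3 4 p(1) unfolding f_def[symmetric] g_def[symmetric]
    by (auto simp: abs_if split: if_splits)
  then show ?thesis
  proof cases
    case 1
    then have d: "\<delta> = - (\<beta> * (c * c))" by (simp add: f_def)
    have "\<beta> * (c * c) * (P * P - 1) = 0" using gP 1(3) d by (simp add: algebra_simps)
    moreover have "P * P - 1 > 0" using p(3) less_1_mult[of P P] by simp
    ultimately have b: "\<beta> = 0" using p(2) by simp
    then have "\<delta> = 0" using d by simp
    moreover have "y\<^sup>2 = c\<^sup>2" using 5 1(1) b p(4) by (simp add: power2_eq_square)
    then have "y = c \<or> y = - c" by (simp add: power2_eq_iff)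
    ultimately show ?thesis using 1(1) b by blast
  next
    case 2
    have d: "\<delta> = - 2 * s - \<beta> * (c * c)" using 2(2) by (simp add: f_def)
    have "(P + 1) * (\<beta> * (c * c) * (P - 1)) = (P + 1) * (2 * s)"
      using gP 2(3) d by (simp add: algebra_simps)
    then have b: "\<beta> * (c * c) * (P - 1) = 2 * s" using p(3) by simp
    then have "\<beta> = 2 * s / (c * c * (P - 1))" using p(2,3) by (simp add: field_simps)
    moreover have "\<delta> * (P - 1) = - 2 * s * (P - 1) - \<beta> * (c * c) * (P - 1)"
      by (simp add: d algebra_simps)
    then have "\<delta> * (P - 1) = - 2 * s * P" unfolding b by (simp add: algebra_simps)
    then have "\<delta> = - (2 * s * P / (P - 1))" using p(3) by (simp add: field_simps)
    moreover have "y * y = 1 + \<beta> * \<delta>" using 5 2(1) by simp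
    ultimately show ?thesis using 2(1) by blast
  next
    case 3
    have d: "\<delta> = - 2 * s - \<beta> * (c * c)" using 3(2) by (simp add: f_def)
    have "(P - 1) * (\<beta> * (c * c) * (P + 1)) = (P - 1) * (- 2 * s)"
      using gP 3(3) d by (simp add: algebra_simps)
    moreover have "P - 1 \<noteq> 0" using p(3) by simp
    ultimately have b: "\<beta> * (c * c) * (P + 1) = - 2 * s" by (metis mult_left_cancel)
    have "P + 1 \<noteq> 0" using p(3) by simp
    then have "c * c * (P + 1) \<noteq> 0" using p(2) by simp
    moreover have "\<beta> * (c * c * (P + 1)) = - (2 * s)" using b by (simp add: mult.assoc)
    ultimately have "\<beta> = - (2 * s) / (c * c * (P + 1))" by (metis nonzero_eq_divide_eq)
    then have "\<beta> = - (2 * s / (c * c * (P + 1)))" by simp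
    moreover have "\<delta> * (P + 1) = - 2 * s * (P + 1) - \<beta> * (c * c) * (P + 1)"
      by (simp add: d algebra_simps)
    then have "\<delta> * (P + 1) = - 2 * s * P" unfolding b by (simp add: algebra_simps)
    then have "\<delta> = - (2 * s * P / (P + 1))" using \<open>P + 1 \<noteq> 0\<close> by (simp add: field_simps)
    moreover have "y * y = 1 + \<beta> * \<delta>" using 5 3(1) by simp
    ultimately show ?thesis using 3(1) by blast
  qed
qed

text \<open>The circles have centres 1, P, -1, -P on the bisector of sector I and radii s, s P, s, s
  P, where s is the distance of 1 from the lines. The second and third carry the opposite sign,
  which makes the four vectors sum to zero; they are orthogonal to the bisector.\<close>

lemma config1_model:
  fixes s c P :: real
  assumes p: "s > 0" "c > 0" "P > 1" "s * s + c * c = 1"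
    and six: "six_tangent (1 / s, Complex (1 / s) 0, c * c / s)
      (- (1 / (s * P)), Complex (- (1 / s)) 0, - (P * (c * c) / s))
      (- (1 / s), Complex (1 / s) 0, - (c * c / s))
      (1 / (s * P), Complex (- (1 / s)) 0, P * (c * c) / s) S"
      (is "six_tangent ?k1 ?k2 ?k3 ?k4 S")
  shows "config1 {cyc ?k1, cyc ?k2, cyc ?k3, cyc ?k4} S"
proof -
  let ?G = "{cyc ?k1, cyc ?k2, cyc ?k3, cyc ?k4}"
  have un: "ip ?k1 ?k1 = 1" "ip ?k2 ?k2 = 1" "ip ?k3 ?k3 = 1" "ip ?k4 ?k4 = 1"
    using six unfolding six_tangent_def by blast+
  define \<beta>1 \<delta>1 where "\<beta>1 = 2 * s / (c * c * (P - 1))" and "\<delta>1 = - (2 * s * P / (P - 1))"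
  define \<beta>2 \<delta>2 where "\<beta>2 = - (2 * s / (c * c * (P + 1)))" and "\<delta>2 = - (2 * s * P / (P + 1))"
  have sol: "\<exists>b x y d. Y = cyc (b, Complex x y, d) \<and> ip (b, Complex x y, d) (b, Complex x y, d) = 1 \<and>
      (b = 0 \<and> d = 0 \<and> x = s \<and> (y = c \<or> y = - c) \<or>
       x = 0 \<and> y * y = 1 + b * d \<and> (b = \<beta>1 \<and> d = \<delta>1 \<or> b = \<beta>2 \<and> d = \<delta>2))"
    if Y: "circline Y" "\<forall>X\<in>?G. tangent Y X" for Y
  proof -
    from tangent_vector[OF Y(1) un(1) un(3) un(2) un(4)] Y(2) obtain v where v: "ip v v = 1" "Y = cyc v"
      "ip v ?k1 = 1" "\<bar>ip v ?k3\<bar> = 1" "\<bar>ip v ?k2\<bar> = 1" "\<bar>ip v ?k4\<bar> = 1" by blast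
    obtain b g d where v': "v = (b, g, d)" by (cases v)
    define x y where "x = Re g" and "y = Im g"
    have g: "g = Complex x y" by (simp add: x_def y_def complex_eq_iff)
    have ips: "ip v ?k1 = (x - (b * (c * c) + d) / 2) / s" "ip v ?k3 = (x + (b * (c * c) + d) / 2) / s"
      "ip v ?k2 = - (x - (b * (c * c) * P + d / P) / 2) / s" "ip v ?k4 = - (x + (b * (c * c) * P + d / P) / 2) / s"
      "ip v v = x * x + y * y - b * d"
      using p by (simp_all add: v' g ip_triple inner_complex_def field_simps)
    have "x - (b * (c * c) + d) / 2 = s" using v(3) p(1) unfolding ips by (simp add: field_simps)
    moreover have ab: "\<bar>z\<bar> = s" if "\<bar>z / s\<bar> = 1" for z using that p(1) by (simp add: abs_divide)
    have "\<bar>x + (b * (c * c) + d) / 2\<bar> = s" by (rule ab[OF v(4)[unfolded ips]])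
    moreover have "\<bar>x - (b * (c * c) * P + d / P) / 2\<bar> = s" "\<bar>x + (b * (c * c) * P + d / P) / 2\<bar> = s"
      using ab[OF v(5)[unfolded ips]] ab[OF v(6)[unfolded ips]] by (simp_all only: abs_minus_cancel)
    moreover have "x * x + y * y - b * d = 1" using v(1) unfolding ips .
    ultimately have "b = 0 \<and> d = 0 \<and> x = s \<and> (y = c \<or> y = - c) \<or>
       x = 0 \<and> y * y = 1 + b * d \<and> (b = \<beta>1 \<and> d = \<delta>1 \<or> b = \<beta>2 \<and> d = \<delta>2)"
      unfolding \<beta>1_def \<delta>1_def \<beta>2_def \<delta>2_def by (rule config1_arithmetic[OF p])
    then show ?thesis using v(1,2) unfolding v' g by blast
  qed
  define L where "L = cyc (0, Complex s c, 0)"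
  define M where "M = cyc (0, Complex s (- c), 0)"
  define f where "f b d r = cyc (b, Complex 0 (r * sqrt (1 + b * d)), d)" for b d r
  define T where "T = [f \<beta>1 \<delta>1 1, f \<beta>1 \<delta>1 (-1), f \<beta>2 \<delta>2 1, f \<beta>2 \<delta>2 (-1)]"
  have all: "Y \<in> set (L # M # T)" if Y: "circline Y" "\<forall>X\<in>?G. tangent Y X" for Y
  proof -
    from sol[OF Y] obtain b x y d where v: "Y = cyc (b, Complex x y, d)" and
      "b = 0 \<and> d = 0 \<and> x = s \<and> (y = c \<or> y = - c) \<or>
       x = 0 \<and> y * y = 1 + b * d \<and> (b = \<beta>1 \<and> d = \<delta>1 \<or> b = \<beta>2 \<and> d = \<delta>2)" by blast
    then consider "b = 0" "d = 0" "x = s" "y = c \<or> y = - c"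
      | "x = 0" "y * y = 1 + b * d" "b = \<beta>1 \<and> d = \<delta>1 \<or> b = \<beta>2 \<and> d = \<delta>2" by blast
    then show ?thesis
    proof cases
      case 1
      then show ?thesis unfolding v by (elim disjE) (simp_all add: L_def M_def)
    next
      case 2
      have "\<bar>y\<bar> = sqrt (1 + b * d)" unfolding 2(2)[symmetric] by simp
      then have "y = 1 * sqrt (1 + b * d) \<or> y = (-1) * sqrt (1 + b * d)" by (auto simp: abs_if split: if_splits)
      then have "Y = f b d 1 \<or> Y = f b d (-1)" unfolding v 2(1) f_def by blast
      then show ?thesis using 2(3) unfolding T_def list.set by blast
    qed
  qed
  have cS: "card S = 6" using six unfolding six_tangent_def by blast
  have tS: "circline Y" "\<forall>X\<in>?G. tangent Y X" if "Y \<in> S" for Y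
    using six that unfolding six_tangent_def by blast+
  have sub: "S \<subseteq> set (L # M # T)" using all tS by blast
  have len: "length (L # M # T) = 6" by (simp add: T_def)
  have S: "S = set (L # M # T)" using six_list(1)[OF cS sub len] .
  define u where "u = Complex c (- s)"
  define v where "v = Complex c s"
  note X = crossing_lines[OF p(1,2,4), folded u_def v_def]
  have LM: "line 0 u = L" "line 0 v = M" by (simp_all add: X(4,5) L_def M_def)
  have "L \<in> S" "M \<in> S" using S by simp_all
  have tLM: "tangent Z (line 0 u)" "tangent Z (line 0 v)" if "Z \<in> ?G" for Z
    unfolding LM using six_tangent_in(2)[OF six \<open>L \<in> S\<close> that] six_tangent_in(2)[OF six \<open>M \<in> S\<close> that] by blast+
  have cc: "c * c > 0" and ss: "s * s > 0" using p by simp_all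
  have signs: "\<beta>1 > 0" "\<delta>1 < 0" "\<beta>2 < 0" "\<delta>2 < 0"
    using p cc by (simp_all add: \<beta>1_def \<delta>1_def \<beta>2_def \<delta>2_def)
  have ty: "type_I 0 u v Y \<or> type_II 0 u v Y" if Y: "Y \<in> S" "Y \<noteq> L" "Y \<noteq> M" for Y
  proof -
    from sol[OF tS[OF Y(1)]] obtain b x y d where w: "Y = cyc (b, Complex x y, d)"
      "ip (b, Complex x y, d) (b, Complex x y, d) = 1" and
      "b = 0 \<and> d = 0 \<and> x = s \<and> (y = c \<or> y = - c) \<or>
       x = 0 \<and> y * y = 1 + b * d \<and> (b = \<beta>1 \<and> d = \<delta>1 \<or> b = \<beta>2 \<and> d = \<delta>2)" by blast
    moreover have "\<not> (b = 0 \<and> d = 0 \<and> x = s \<and> (y = c \<or> y = - c))"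
      using Y(2,3) w(1) by (auto simp: L_def M_def)
    ultimately have x: "x = 0" "y * y = 1 + b * d" and bd: "b = \<beta>1 \<and> d = \<delta>1 \<or> b = \<beta>2 \<and> d = \<delta>2" by blast+
    have lt: "c * c * (1 + b * d) < 1"
      using bd
    proof
      assume "b = \<beta>1 \<and> d = \<delta>1"
      then have "b * d < 0" using signs by (simp add: mult_pos_neg)
      then have "c * c * (1 + b * d) < c * c * 1" using cc by (intro mult_strict_left_mono) simp_all
      then show ?thesis using ss p(4) by linarith
    next
      assume bd: "b = \<beta>2 \<and> d = \<delta>2"
      \<comment> \<open>That the circles of type II really cross both lines is the inequality
        between the arithmetic and the geometric mean of \<open>P\<close> and 1, strict because
        \<open>P > 1\<close>.\<close>
      have "(P - 1) * (P - 1) > 0" using p(3) by simp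
      then have "4 * P < (P + 1) * (P + 1)" by (simp add: algebra_simps)
      then have "4 * P / ((P + 1) * (P + 1)) < 1" using p(3) by simp
      then have "s * s * (4 * P / ((P + 1) * (P + 1))) < s * s * 1" using ss by (intro mult_strict_left_mono)
      moreover have "c * c * (b * d) = s * s * (4 * P / ((P + 1) * (P + 1)))"
        using p(2) bd by (simp add: \<beta>2_def \<delta>2_def)
      moreover have "c * c * (1 + b * d) = c * c + c * c * (b * d)" by (simp add: algebra_simps)
      ultimately show ?thesis using p(4) by linarith
    qed
    have "b \<noteq> 0" using bd signs by auto
    have "(y * c)\<^sup>2 < 1" using lt x(2) by (simp add: power2_eq_square mult_ac)
    then have "\<bar>y * c\<bar> < 1" by (simp add: abs_square_less_1)
    then have "\<bar>Complex x y \<bullet> Complex s c\<bar> < 1" "\<bar>Complex x y \<bullet> Complex s (- c)\<bar> < 1"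
      using x(1) by (simp_all add: inner_complex_def)
    then have cards: "card (Y \<inter> line 0 u) = 2" "card (Y \<inter> line 0 v) = 2"
      unfolding X(4,5) w(1) using card_cyc_Int_line[OF w(2) \<open>b \<noteq> 0\<close>] X(8,9) by blast+
    show ?thesis using bd
    proof
      assume "b = \<beta>1 \<and> d = \<delta>1"
      then have "b > 0" "d < 0" using signs by simp_all
      then show ?thesis using type_I_cycI[OF w(2)] cards unfolding w(1) by blast
    next
      assume "b = \<beta>2 \<and> d = \<delta>2"
      then have neg: "- b > 0" "- d > 0" using signs by simp_all
      have eq: "Y = cyc (- b, - Complex x y, - d)" using w(1) cyc_uminus[of "(b, Complex x y, d)"] by simp
      have "ip (- b, - Complex x y, - d) (- b, - Complex x y, - d) = 1" using w(2) by (simp add: ip_triple)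
      from type_II_cycI[OF this neg] show ?thesis using cards unfolding eq by blast
    qed
  qed
  have neg: "- Complex (1 / s) 0 = Complex (- (1 / s)) 0" "- Complex (- (1 / s)) 0 = Complex (1 / s) 0"
    by (simp_all add: complex_eq_iff)
  have nk: "cyc ?k2 = cyc (1 / (s * P), Complex (1 / s) 0, P * (c * c) / s)"
    "cyc ?k3 = cyc (1 / s, Complex (- (1 / s)) 0, c * c / s)"
    using cyc_uminus[of ?k2] cyc_uminus[of ?k3] by (simp_all add: neg)
  have un2: "ip (1 / (s * P), Complex (1 / s) 0, P * (c * c) / s) (1 / (s * P), Complex (1 / s) 0, P * (c * c) / s) = 1"
    using un(2) by (simp add: ip_triple inner_complex_def)
  have ps: "point_symmetry 0 ` cyc ?k1 = cyc ?k3" "point_symmetry 0 ` cyc ?k2 = cyc ?k4"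
    unfolding nk point_symmetry_cyc neg by simp_all
  have pos: "1 / s > 0" "1 / (s * P) > 0" using p by simp_all
  show ?thesis
    unfolding config1_def
  proof (intro exI conjI)
    show "crossing_directions u v" by (rule X(1))
    show "inscribed 0 u v (cyc ?k1)"
      by (rule inscribed_cycI[OF X(1) un(1) pos(1)])
         (use p tLM[of "cyc ?k1"] in \<open>simp_all add: inner_complex_def u_def v_def\<close>)
    show "inscribed 0 u v (cyc ?k2)"
      unfolding nk
      by (rule inscribed_cycI[OF X(1) un2 pos(2)])
         (use p tLM[of "cyc ?k2", unfolded nk] in \<open>simp_all add: inner_complex_def u_def v_def\<close>)
    show "cyc ?k1 \<noteq> cyc ?k2" using six by (simp add: six_tangent_def)
    show "?G = {cyc ?k1, cyc ?k2, point_symmetry 0 ` cyc ?k1, point_symmetry 0 ` cyc ?k2}" unfolding ps ..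
    show "card S = 6" by (rule cS)
    show "S = {line 0 u, line 0 v} \<union> {X. (type_I 0 u v X \<or> type_II 0 u v X) \<and> (\<forall>Y\<in>?G. tangent X Y)}"
      unfolding LM
    proof (intro equalityI subsetI)
      fix Y assume "Y \<in> S"
      then show "Y \<in> {L, M} \<union> {X. (type_I 0 u v X \<or> type_II 0 u v X) \<and> (\<forall>Y\<in>?G. tangent X Y)}"
        using ty tS(2) by blast
    next
      fix Y assume Y: "Y \<in> {L, M} \<union> {X. (type_I 0 u v X \<or> type_II 0 u v X) \<and> (\<forall>Y\<in>?G. tangent X Y)}"
      show "Y \<in> S"
      proof (cases "Y \<in> {L, M}")
        case True
        then show ?thesis using \<open>L \<in> S\<close> \<open>M \<in> S\<close> by blast
      next
        case False
        then have Y': "type_I 0 u v Y \<or> type_II 0 u v Y" "\<forall>Z\<in>?G. tangent Y Z" using Y by blast+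
        have "circline Y"
          using Y'(1) unfolding type_I_def type_II_def circline_def is_circle_def by blast
        then show ?thesis using all Y'(2) unfolding S by blast
      qed
    qed
  qed
qed

section \<open>Normalization\<close>

definition normalizable :: "epoint set set \<Rightarrow> epoint set set \<Rightarrow> bool" where
  "normalizable G S \<longleftrightarrow> (\<exists>f. inv_sim_composition f \<and>
     (config1 (image f ` G) (image f ` S) \<or> config2 (image f ` G) (image f ` S) \<or>
      config3 (image f ` G) (image f ` S) \<or> config4 (image f ` G) (image f ` S)))"

lemma six_tangent_image:
  assumes "induces F T" "six_tangent g1 g2 g3 g4 S"
  shows "six_tangent (T g1) (T g2) (T g3) (T g4) (image F ` S)"
proof -
  have inj: "inj F" using induces_bij[OF assms(1)] bij_is_inj by blast
  have eq: "cyc (T v) = F ` cyc v" for v using induces_cyc[OF assms(1)] by simp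
  have "card (image F ` S) = 6"
    using induces_card_image[OF assms(1)] assms(2) by (simp add: six_tangent_def)
  moreover have "F ` cyc g1 \<inter> F ` cyc g2 \<inter> F ` cyc g3 \<inter> F ` cyc g4 = {}"
    using assms(2) unfolding six_tangent_def image_Int[OF inj, symmetric] by simp
  moreover have "distinct [F ` cyc g1, F ` cyc g2, F ` cyc g3, F ` cyc g4]"
    using assms(2) unfolding six_tangent_def by (simp add: inj_image_eq_iff[OF inj])
  moreover have "\<forall>Y\<in>image F ` S. circline Y \<and> tangent Y (F ` cyc g1) \<and> tangent Y (F ` cyc g2) \<and>
      tangent Y (F ` cyc g3) \<and> tangent Y (F ` cyc g4)"
    using assms(2) unfolding six_tangent_def ball_simps
    by (simp add: induces_tangent_iff[OF assms(1)] induces_circline_iff[OF assms(1)])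
  moreover have "ip (T g1) (T g1) = 1" "ip (T g2) (T g2) = 1" "ip (T g3) (T g3) = 1" "ip (T g4) (T g4) = 1"
    using assms(2) induces_ip[OF assms(1)] by (simp_all add: six_tangent_def)
  ultimately show ?thesis unfolding six_tangent_def eq by blast
qed

lemma normalizableI:
  assumes "induces F T" "six_tangent g1 g2 g3 g4 S"
    and "six_tangent (T g1) (T g2) (T g3) (T g4) (image F ` S) \<Longrightarrow>
      config1 {cyc (T g1), cyc (T g2), cyc (T g3), cyc (T g4)} (image F ` S) \<or>
      config2 {cyc (T g1), cyc (T g2), cyc (T g3), cyc (T g4)} (image F ` S) \<or>
      config3 {cyc (T g1), cyc (T g2), cyc (T g3), cyc (T g4)} (image F ` S) \<or>
      config4 {cyc (T g1), cyc (T g2), cyc (T g3), cyc (T g4)} (image F ` S)"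
  shows "normalizable {cyc g1, cyc g2, cyc g3, cyc g4} S"
proof -
  have "image F ` {cyc g1, cyc g2, cyc g3, cyc g4} = {cyc (T g1), cyc (T g2), cyc (T g3), cyc (T g4)}"
    by (simp add: induces_cyc[OF assms(1)])
  then show ?thesis
    unfolding normalizable_def using assms(3)[OF six_tangent_image[OF assms(1,2)]] induces_inv_sim[OF assms(1)]
    by (intro exI[of _ F]) simp
qed

lemma normalizable_gram3:
  assumes six: "six_tangent g1 g2 g3 g4 S" and sp: "spanning g1 g2 g3 g4" and gram: "gram3 g1 g2 g3 g4"
  shows "normalizable {cyc g1, cyc g2, cyc g3, cyc g4} S"
proof -
  have un: "ip g1 g1 = 1" "ip g2 g2 = 1" "ip g3 g3 = 1" "ip g4 g4 = 1"
    using six unfolding six_tangent_def by blast+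
  note G = gram[unfolded gram3_def]
  define a where "a = 2 / sqrt (5 :: real)"
  have aa: "a * a = 4/5" by (simp add: a_def)
  define k1 k2 k3 k4 :: cvec where "k1 = (1, - of_real a, -1/5)" and "k2 = (-1, 0, 1)"
    and "k3 = (1, of_real a, -1/5)" and "k4 = (0, \<i>, 0)"
  note k = k1_def k2_def k3_def k4_def
  have "ip k1 k1 = 1" "ip k2 k2 = 1" "ip k3 k3 = 1" "ip k4 k4 = 1" "ip k1 k2 = -3/5" "ip k1 k3 = -3/5"
    "ip k2 k3 = -3/5" "ip k1 k4 = 0" "ip k2 k4 = 0" "ip k3 k4 = 0"
    by (simp_all add: k ip_triple inner_complex_def aa)
  then obtain F T where F: "induces F T" "T g1 = k1" "T g2 = k2" "T g3 = k3" "T g4 = k4"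
    using ex_induces_of_gram[OF sp, of k1 k2 k3 k4] un G by (smt (verit))
  show ?thesis
    by (rule normalizableI[OF F(1) six])
       (use config3_model[OF a_def] F(2-5) in \<open>simp add: k\<close>)
qed

lemma normalizable_gram4:
  assumes six: "six_tangent g1 g2 g3 g4 S" and sp: "spanning g1 g2 g3 g4"
    and gram: "gram4 (sqrt 3) g1 g2 g3 g4"
  shows "normalizable {cyc g1, cyc g2, cyc g3, cyc g4} S"
proof -
  have un: "ip g1 g1 = 1" "ip g2 g2 = 1" "ip g3 g3 = 1" "ip g4 g4 = 1"
    using six unfolding six_tangent_def by blast+
  note G = gram[unfolded gram4_def]
  define q r where "q = sqrt (2 :: real)" and "r = sqrt (3 :: real)"
  have qr: "q * q = 2" "r * r = 3" by (simp_all add: q_def r_def)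
  define k1 k2 k3 k4 :: cvec where "k1 = (1, 0, -1)" and "k2 = (2 * q - 3, 0, 3 + 2 * q)"
    and "k3 = (- (r * (q - 1)), 2, - (r * (q + 1)))" and "k4 = (- (r * (q - 1)), 2 * \<i>, - (r * (q + 1)))"
  note k = k1_def k2_def k3_def k4_def
  have mn: "(r * (q - 1)) * (r * (q + 1)) = 3"
  proof -
    have "(r * (q - 1)) * (r * (q + 1)) = (r * r) * (q * q - 1)" by (simp add: algebra_simps)
    then show ?thesis by (simp add: qr)
  qed
  have mq: "(2 * q - 3) * (r * (q + 1)) = - (r * (q - 1))" "(3 + 2 * q) * (r * (q - 1)) = r * (q + 1)"
  proof -
    have "(2 * q - 3) * (r * (q + 1)) = r * (2 * (q * q) - q - 3)" "(3 + 2 * q) * (r * (q - 1)) = r * (2 * (q * q) + q - 3)"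
      by (simp_all add: algebra_simps)
    then show "(2 * q - 3) * (r * (q + 1)) = - (r * (q - 1))" "(3 + 2 * q) * (r * (q - 1)) = r * (q + 1)"
      by (simp_all add: qr algebra_simps)
  qed
  have "ip k1 k1 = 1" "ip k1 k2 = -3" by (simp_all add: k ip_triple field_simps)
  moreover have "ip k2 k2 = 1" using qr(1) by (simp add: k ip_triple field_simps)
  moreover have "ip k3 k3 = 1" "ip k4 k4 = 1" "ip k3 k4 = -3"
    using mn by (simp_all add: k ip_triple inner_complex_def mult.commute)
  moreover have "ip k1 k3 = r" "ip k1 k4 = r" by (simp_all add: k ip_triple algebra_simps)
  moreover have "ip k2 k3 = r" "ip k2 k4 = r"
  proof -
    have "ip k2 k3 = ((2 * q - 3) * (r * (q + 1)) + (3 + 2 * q) * (r * (q - 1))) / 2"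
      "ip k2 k4 = ((2 * q - 3) * (r * (q + 1)) + (3 + 2 * q) * (r * (q - 1))) / 2"
      by (simp_all add: k ip_triple field_simps)
    then show "ip k2 k3 = r" "ip k2 k4 = r" unfolding mq by (simp_all add: algebra_simps)
  qed
  ultimately obtain F T where F: "induces F T" "T g1 = k1" "T g2 = k2" "T g3 = k3" "T g4 = k4"
    using ex_induces_of_gram[OF sp, of k1 k2 k3 k4] un G[folded r_def] by (smt (verit))
  show ?thesis
    by (rule normalizableI[OF F(1) six])
       (use config4_model[OF q_def r_def] F(2-5) in \<open>simp add: k\<close>)
qed

lemma normalizable_spanning:
  assumes "six_tangent g1 g2 g3 g4 S" "spanning g1 g2 g3 g4"
  shows "normalizable {cyc g1, cyc g2, cyc g3, cyc g4} S"
proof -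
  from gram_of_spanning[OF assms] obtain k1 k2 k3 k4 where k: "{cyc k1, cyc k2, cyc k3, cyc k4} = {cyc g1, cyc g2, cyc g3, cyc g4}"
    "six_tangent k1 k2 k3 k4 S" "spanning k1 k2 k3 k4"
    "gram3 k1 k2 k3 k4 \<or> (\<exists>x. x * x = 3 \<and> gram4 x k1 k2 k3 k4)"
    by (elim exE conjE)
  show ?thesis
  proof (cases "gram3 k1 k2 k3 k4")
    case True
    then show ?thesis using normalizable_gram3[OF k(2,3)] k(1) by simp
  next
    case False
    then obtain x where x: "x * x = 3" "gram4 x k1 k2 k3 k4" using k(4) by blast
    have "\<bar>x\<bar> = sqrt 3" unfolding x(1)[symmetric] by simp
    then consider "x = sqrt 3" | "x = - sqrt 3" by (auto simp: abs_if split: if_splits)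
    then show ?thesis
    proof cases
      case 1
      then show ?thesis using normalizable_gram4[OF k(2,3)] k(1) x(2) by simp
    next
      case 2
      \<comment> \<open>Reversing one of the two pairs changes the sign of \<open>x\<close> and
        leaves the products within the pairs unchanged.\<close>
      have "six_tangent (- k1) (- k2) k3 k4 S" using six_tangent_signs[OF k(2), of "-1" "-1" 1 1] by simp
      moreover have "spanning (- k1) (- k2) k3 k4" using k(3) unfolding spanning_def by simp
      moreover have "gram4 (sqrt 3) (- k1) (- k2) k3 k4" using x(2) 2 unfolding gram4_def by simp
      ultimately show ?thesis using normalizable_gram4[of "- k1" "- k2" k3 k4 S] k(1) by simp
    qed
  qed
qed

section \<open>Linearly dependent given circles\<close>

text \<open>A nonzero null vector is a point, and the orthogonality would put this point on all four
  given circles.\<close>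

lemma no_common_null_vector:
  assumes "six_tangent g1 g2 g3 g4 S"
    and "ip n n = 0" "ip n g1 = 0" "ip n g2 = 0" "ip n g3 = 0" "ip n g4 = 0"
  shows "n = 0"
proof (rule ccontr)
  assume "n \<noteq> 0"
  then obtain P l where P: "l \<noteq> 0" "n = l *\<^sub>R lift P" using null_is_lift assms(2) by metis
  then have "ip g1 (lift P) = 0" "ip g2 (lift P) = 0" "ip g3 (lift P) = 0" "ip g4 (lift P) = 0"
    using assms(3-6) by (simp_all add: ip_commute[of "lift P"])
  then have "P \<in> cyc g1 \<inter> cyc g2 \<inter> cyc g3 \<inter> cyc g4" by (simp add: cyc_def)
  then show False using assms(1) unfolding six_tangent_def by blast
qed

text \<open>Two independent vectors orthogonal to all four given ones would, together with a solution, leave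
  room for only one direction, in which the four suitably signed vectors would have to differ; but a
  line meets the quadric \<open>ip x x = 1\<close> in at most two points, unless its direction is null.\<close>

lemma common_orthogonal_unique:
  assumes six: "six_tangent g1 g2 g3 g4 S"
    and n: "ip n n \<noteq> 0" "ip n g1 = 0" "ip n g2 = 0" "ip n g3 = 0" "ip n g4 = 0"
    and w: "ip w g1 = 0" "ip w g2 = 0" "ip w g3 = 0" "ip w g4 = 0"
  shows "\<exists>l. w = l *\<^sub>R n"
proof (rule ccontr)
  assume no: "\<not> ?thesis"
  define u where "u = w - (ip w n / ip n n) *\<^sub>R n"
  have u: "u \<noteq> 0" "ip u n = 0" using no n(1) by (auto simp: u_def)
  have ug: "ip u g1 = 0" "ip u g2 = 0" "ip u g3 = 0" "ip u g4 = 0"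
    using n w by (simp_all add: u_def)
  have "S \<noteq> {}" using six by (auto simp: six_tangent_def)
  then obtain Y where "Y \<in> S" by blast
  from six_tangent_solution[OF six this] obtain v where v: "ip v g1 = 1" "\<bar>ip v g2\<bar> = 1"
    "\<bar>ip v g3\<bar> = 1" "\<bar>ip v g4\<bar> = 1" by blast
  define a2 a3 a4 where "a2 = ip v g2" and "a3 = ip v g3" and "a4 = ip v g4"
  have a: "a2 \<in> {1, -1}" "a3 \<in> {1, -1}" "a4 \<in> {1, -1}"
    using v(2-4) unfolding a2_def a3_def a4_def abs_eq_1_sign .
  define k2 k3 k4 where "k2 = a2 *\<^sub>R g2" and "k3 = a3 *\<^sub>R g3" and "k4 = a4 *\<^sub>R g4"
  have vk: "ip v k2 = 1" "ip v k3 = 1" "ip v k4 = 1"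
    using sign_square(1)[OF a(1)] sign_square(1)[OF a(2)] sign_square(1)[OF a(3)]
    by (simp_all add: k2_def k3_def k4_def a2_def a3_def a4_def)
  have six': "six_tangent g1 k2 k3 k4 S"
    using six_tangent_signs[OF six, of 1 a2 a3 a4] a by (simp add: k2_def k3_def k4_def)
  then have un: "ip g1 g1 = 1" "ip k2 k2 = 1" "ip k3 k3 = 1" and ne: "g1 \<noteq> k2" "g1 \<noteq> k3" "k2 \<noteq> k3"
    unfolding six_tangent_def by auto
  define d where "d = k2 - g1"
  have orth: "ip n (k - g1) = 0" "ip u (k - g1) = 0" "ip v (k - g1) = 0" if "k \<in> {k2, k3, k4}" for k
    using that n ug v(1) vk by (auto simp: k2_def k3_def k4_def)
  have indep: "\<alpha> = 0 \<and> \<beta> = 0 \<and> \<gamma> = 0" if eq: "\<alpha> *\<^sub>R n + \<beta> *\<^sub>R u + \<gamma> *\<^sub>R v = 0" for \<alpha> \<beta> \<gamma>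
  proof -
    have "ip (\<alpha> *\<^sub>R n + \<beta> *\<^sub>R u + \<gamma> *\<^sub>R v) g1 = 0" unfolding eq by simp
    then have c: "\<gamma> = 0" using n(2) ug(1) v(1) by simp
    have "ip (\<alpha> *\<^sub>R n + \<beta> *\<^sub>R u + \<gamma> *\<^sub>R v) n = 0" unfolding eq by simp
    then have a: "\<alpha> = 0" using u(2) n(1) c by simp
    then show ?thesis using eq u(1) c by simp
  qed
  have "d \<noteq> 0" using ne(1) by (simp add: d_def)
  have mult: "\<exists>l. k - g1 = l *\<^sub>R d" if k: "k \<in> {k2, k3, k4}" for k
  proof (rule common_orthogonal_multiple[of n u v d "k - g1"])
    show "\<alpha> = 0 \<and> \<beta> = 0 \<and> \<gamma> = 0" if "\<alpha> *\<^sub>R n + \<beta> *\<^sub>R u + \<gamma> *\<^sub>R v = 0" for \<alpha> \<beta> \<gamma>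
      using indep[OF that] .
    show "d \<noteq> 0" by fact
    show "ip n d = 0" "ip u d = 0" "ip v d = 0" unfolding d_def by (rule orth; simp)+
    show "ip n (k - g1) = 0" "ip u (k - g1) = 0" "ip v (k - g1) = 0" by (rule orth[OF k])+
    show "\<exists>l. k - g1 = l *\<^sub>R d" if "k - g1 = l *\<^sub>R d" for l using that by (rule exI)
  qed
  obtain l where l: "k3 - g1 = l *\<^sub>R d" using mult by blast
  obtain m where m: "k4 - g1 = m *\<^sub>R d" using mult by blast
  have k: "k2 = g1 + d" "k3 = g1 + l *\<^sub>R d" "k4 = g1 + m *\<^sub>R d"
    using l m by (simp_all add: d_def algebra_simps)
  have "l \<noteq> 0" "l \<noteq> 1" using ne k by auto
  have 1: "2 * ip g1 d + ip d d = 0"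
    using un(1,2) unfolding k(1) by (simp add: ip_commute[of d g1])
  have "l * (2 * ip g1 d + l * ip d d) = 0"
    using un(1,3) unfolding k(2) by (simp add: ip_commute[of d g1] algebra_simps)
  then have "2 * ip g1 d + l * ip d d = 0" using \<open>l \<noteq> 0\<close> by simp
  moreover have "(l - 1) * ip d d = (2 * ip g1 d + l * ip d d) - (2 * ip g1 d + ip d d)"
    by (simp add: algebra_simps)
  ultimately have "(l - 1) * ip d d = 0" using 1 by simp
  then have dd: "ip d d = 0" using \<open>l \<noteq> 1\<close> by simp
  then have "ip d g1 = 0" using 1 by (simp add: ip_commute[of d g1])
  then have "ip d k2 = 0" "ip d k3 = 0" "ip d k4 = 0" using dd by (simp_all add: k)
  then show False
    using no_common_null_vector[OF six' dd \<open>ip d g1 = 0\<close>] \<open>d \<noteq> 0\<close> by blast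
qed

text \<open>Subtracting the first relation from another one splits the coefficients into two groups,
  each with sum 0. A split into one and three makes one coefficient vanish; a second, different
  split then makes another one vanish as well, which is excluded. So both splits are into pairs of
  opposite coefficients, and two different pairings force equal absolute values.\<close>

lemma equal_coefficients:
  fixes x1 x2 x3 x4 a b c a' b' c' :: real
  assumes s: "x1 + x2 + x3 + x4 = 0" "x1 + a * x2 + b * x3 + c * x4 = 0" "x1 + a' * x2 + b' * x3 + c' * x4 = 0"
    and e: "a \<in> {1, -1}" "b \<in> {1, -1}" "c \<in> {1, -1}" "a' \<in> {1, -1}" "b' \<in> {1, -1}" "c' \<in> {1, -1}"
    and ne: "(a, b, c) \<noteq> (1, 1, 1)" "(a', b', c') \<noteq> (1, 1, 1)" "(a, b, c) \<noteq> (a', b', c')"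
    and z: "x1 \<noteq> 0 \<or> x2 \<noteq> 0" "x1 \<noteq> 0 \<or> x3 \<noteq> 0" "x1 \<noteq> 0 \<or> x4 \<noteq> 0"
      "x2 \<noteq> 0 \<or> x3 \<noteq> 0" "x2 \<noteq> 0 \<or> x4 \<noteq> 0" "x3 \<noteq> 0 \<or> x4 \<noteq> 0"
  shows "x1 \<noteq> 0 \<and> (x2 = x1 \<or> x2 = - x1) \<and> (x3 = x1 \<or> x3 = - x1) \<and> (x4 = x1 \<or> x4 = - x1)"
proof -
  have 1: "x2 = 0 \<and> (a, b, c) = (-1, 1, 1) \<or> x3 = 0 \<and> (a, b, c) = (1, -1, 1) \<or> x4 = 0 \<and> (a, b, c) = (1, 1, -1) \<or>
      x3 = - x2 \<and> (a, b, c) = (-1, -1, 1) \<or> x4 = - x2 \<and> (a, b, c) = (-1, 1, -1) \<or>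
      x4 = - x3 \<and> (a, b, c) = (1, -1, -1) \<or> x1 = 0 \<and> (a, b, c) = (-1, -1, -1)"
    if h: "x1 + a * x2 + b * x3 + c * x4 = 0" "a \<in> {1, -1}" "b \<in> {1, -1}" "c \<in> {1, -1}" "(a, b, c) \<noteq> (1, 1, 1)"
    for a b c
  proof -
    consider "(a, b, c) = (-1, 1, 1)"
      | "(a, b, c) = (1, -1, 1)"
      | "(a, b, c) = (1, 1, -1)"
      | "(a, b, c) = (-1, -1, 1)"
      | "(a, b, c) = (-1, 1, -1)"
      | "(a, b, c) = (1, -1, -1)"
      | "(a, b, c) = (-1, -1, -1)"
      using h(2-5) by blast
    then show ?thesis
    proof cases
      case 1
      then have "x1 + (-1) * x2 + (1) * x3 + (1) * x4 = 0" using h(1) by simp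
      then have "x2 = 0" using s(1) by argo
      then show ?thesis using 1 by blast
    next
      case 2
      then have "x1 + (1) * x2 + (-1) * x3 + (1) * x4 = 0" using h(1) by simp
      then have "x3 = 0" using s(1) by argo
      then show ?thesis using 2 by blast
    next
      case 3
      then have "x1 + (1) * x2 + (1) * x3 + (-1) * x4 = 0" using h(1) by simp
      then have "x4 = 0" using s(1) by argo
      then show ?thesis using 3 by blast
    next
      case 4
      then have "x1 + (-1) * x2 + (-1) * x3 + (1) * x4 = 0" using h(1) by simp
      then have "x3 = - x2" using s(1) by argo
      then show ?thesis using 4 by blast
    next
      case 5
      then have "x1 + (-1) * x2 + (1) * x3 + (-1) * x4 = 0" using h(1) by simp
      then have "x4 = - x2" using s(1) by argo
      then show ?thesis using 5 by blast
    next
      case 6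
      then have "x1 + (1) * x2 + (-1) * x3 + (-1) * x4 = 0" using h(1) by simp
      then have "x4 = - x3" using s(1) by argo
      then show ?thesis using 6 by blast
    next
      case 7
      then have "x1 + (-1) * x2 + (-1) * x3 + (-1) * x4 = 0" using h(1) by simp
      then have "x1 = 0" using s(1) by argo
      then show ?thesis using 7 by blast
    qed
  qed
  from 1[OF s(2) e(1-3) ne(1)] 1[OF s(3) e(4-6) ne(2)] show ?thesis
    by (elim disjE conjE; use ne(3) z s(1) in argo)
qed

lemma normalized_orthogonal_vector:
  assumes six: "six_tangent g1 g2 g3 g4 S" and nsp: "\<not> spanning g1 g2 g3 g4"
  obtains n where "ip n n = 1 \<or> ip n n = -1" "ip n g1 = 0" "ip n g2 = 0" "ip n g3 = 0" "ip n g4 = 0"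
proof -
  obtain w where w: "w \<noteq> 0" "ip w g1 = 0" "ip w g2 = 0" "ip w g3 = 0" "ip w g4 = 0"
    using nsp unfolding spanning_def by blast
  have ww: "ip w w \<noteq> 0" using no_common_null_vector[OF six _ w(2-5)] w(1) by blast
  define k where "k = sqrt \<bar>ip w w\<bar>"
  have k: "k > 0" "k * k = \<bar>ip w w\<bar>" using ww by (simp_all add: k_def)
  have "ip (w /\<^sub>R k) (w /\<^sub>R k) = ip w w / (k * k)" by (simp add: divide_inverse)
  then have "ip (w /\<^sub>R k) (w /\<^sub>R k) = 1 \<or> ip (w /\<^sub>R k) (w /\<^sub>R k) = -1"
    unfolding k(2) using ww by (auto simp: abs_if)
  then show ?thesis by (rule that) (use w in simp_all)
qed

text \<open>Solutions with the same products differ by a multiple of \<open>n\<close>. The line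
  through \<open>v\<close> in direction \<open>n\<close> meets the unit quadric once more, at the
  image of \<open>v\<close> under the reflection in \<open>n\<close>.\<close>

lemma solution_fibre:
  assumes six: "six_tangent g1 g2 g3 g4 S"
    and n: "ip n n \<noteq> 0" "ip n g1 = 0" "ip n g2 = 0" "ip n g3 = 0" "ip n g4 = 0"
    and v: "ip v v = 1" "ip v' v' = 1" "ip v' g1 = ip v g1" "ip v' g2 = ip v g2" "ip v' g3 = ip v g3" "ip v' g4 = ip v g4"
  shows "v' = v \<or> v' = v - (2 * ip v n / ip n n) *\<^sub>R n"
proof -
  obtain l where "v' - v = l *\<^sub>R n"
    using common_orthogonal_unique[OF six n, of "v' - v"] v(3-6) by auto
  then have l: "v' = v + l *\<^sub>R n" by (simp add: algebra_simps)
  have "l * (2 * ip v n + l * ip n n) = 0"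
    using v(1,2) unfolding l by (simp add: ip_commute[of n v] algebra_simps)
  then have "l = 0 \<or> 2 * ip v n + l * ip n n = 0" by (simp only: mult_eq_0_iff)
  then have "l = 0 \<or> l * ip n n = - (2 * ip v n)" by auto
  then have "l = 0 \<or> l = - (2 * ip v n / ip n n)" using n(1) by (auto simp: field_simps)
  then show ?thesis using l by auto
qed

lemma ex_solution_vectors:
  assumes six: "six_tangent g1 g2 g3 g4 S"
  obtains V where "\<And>Y. Y \<in> S \<Longrightarrow> ip (V Y) (V Y) = 1 \<and> Y = cyc (V Y) \<and> ip (V Y) g1 = 1 \<and>
    ip (V Y) g2 \<in> {1, -1} \<and> ip (V Y) g3 \<in> {1, -1} \<and> ip (V Y) g4 \<in> {1, -1}"
proof -
  have "\<forall>Y\<in>S. \<exists>v. ip v v = 1 \<and> Y = cyc v \<and> ip v g1 = 1 \<and>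
    ip v g2 \<in> {1, -1} \<and> ip v g3 \<in> {1, -1} \<and> ip v g4 \<in> {1, -1}"
  proof
    fix Y assume "Y \<in> S"
    from six_tangent_solution[OF six this] obtain v where "ip v v = 1" "Y = cyc v" "ip v g1 = 1"
      "\<bar>ip v g2\<bar> = 1" "\<bar>ip v g3\<bar> = 1" "\<bar>ip v g4\<bar> = 1" by blast
    then show "\<exists>v. ip v v = 1 \<and> Y = cyc v \<and> ip v g1 = 1 \<and>
        ip v g2 \<in> {1, -1} \<and> ip v g3 \<in> {1, -1} \<and> ip v g4 \<in> {1, -1}"
      unfolding abs_eq_1_sign by blast
  qed
  from bchoice[OF this] show ?thesis using that by blast
qed

text \<open>The two possible solutions of a sign pattern are exchanged by the reflection in
  \<open>n\<close>; they coincide when orthogonal to \<open>n\<close>.\<close>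

lemma solution_fibre_set:
  assumes six: "six_tangent g1 g2 g3 g4 S"
    and n: "ip n n \<noteq> 0" "ip n g1 = 0" "ip n g2 = 0" "ip n g3 = 0" "ip n g4 = 0"
    and V: "\<And>Y. Y \<in> S \<Longrightarrow> ip (V Y) (V Y) = 1 \<and> Y = cyc (V Y) \<and> ip (V Y) g1 = 1 \<and>
      ip (V Y) g2 \<in> {1, -1} \<and> ip (V Y) g3 \<in> {1, -1} \<and> ip (V Y) g4 \<in> {1, -1}"
  defines "f \<equiv> \<lambda>Y. (ip (V Y) g2, ip (V Y) g3, ip (V Y) g4)"
  shows "\<exists>x y. {Y \<in> S. f Y = e} \<subseteq> {x, y}"
    and "(\<And>Y. Y \<in> S \<Longrightarrow> f Y = e \<Longrightarrow> ip (V Y) n = 0) \<Longrightarrow> \<exists>x. {Y \<in> S. f Y = e} \<subseteq> {x}"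
proof -
  have main: "Y' = Y \<or> Y' = cyc (V Y - (2 * ip (V Y) n / ip n n) *\<^sub>R n)"
    if Y: "Y \<in> S" "Y' \<in> S" "f Y = e" "f Y' = e" for Y Y'
  proof -
    have "ip (V Y') g2 = ip (V Y) g2" "ip (V Y') g3 = ip (V Y) g3" "ip (V Y') g4 = ip (V Y) g4"
      using Y(3,4) by (auto simp: f_def)
    then have "V Y' = V Y \<or> V Y' = V Y - (2 * ip (V Y) n / ip n n) *\<^sub>R n"
      using solution_fibre[OF six n, of "V Y" "V Y'"] V[OF Y(1)] V[OF Y(2)] by simp
    then show ?thesis using V[OF Y(1)] V[OF Y(2)] by metis
  qed
  show "\<exists>x y. {Y \<in> S. f Y = e} \<subseteq> {x, y}"
  proof (cases "\<exists>Y\<in>S. f Y = e")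
    case True
    then obtain Y where Y: "Y \<in> S" "f Y = e" by blast
    then have "{Y \<in> S. f Y = e} \<subseteq> {Y, cyc (V Y - (2 * ip (V Y) n / ip n n) *\<^sub>R n)}"
      using main[OF Y(1) _ Y(2)] by blast
    then show ?thesis by (intro exI)
  qed blast
  show "\<exists>x. {Y \<in> S. f Y = e} \<subseteq> {x}" if z: "\<And>Y. Y \<in> S \<Longrightarrow> f Y = e \<Longrightarrow> ip (V Y) n = 0"
  proof (cases "\<exists>Y\<in>S. f Y = e")
    case True
    then obtain Y where Y: "Y \<in> S" "f Y = e" by blast
    have "cyc (V Y - (2 * ip (V Y) n / ip n n) *\<^sub>R n) = Y" using z[OF Y] V[OF Y(1)] by simp
    then have "{Y \<in> S. f Y = e} \<subseteq> {Y}" using main[OF Y(1) _ Y(2)] by auto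
    then show ?thesis by (intro exI)
  qed blast
qed

text \<open>Six solutions with at most two to a sign pattern give at least three patterns. Each
  pattern, by taking the product of such a solution with a linear relation of the given vectors,
  yields an equation for the coefficients; three equations make the coefficients equal up to
  sign.\<close>

lemma balanced_signs:
  assumes six: "six_tangent g1 g2 g3 g4 S"
    and n: "ip n n \<noteq> 0" "ip n g1 = 0" "ip n g2 = 0" "ip n g3 = 0" "ip n g4 = 0"
  shows "\<exists>a2\<in>{1, -1}. \<exists>a3\<in>{1, -1}. \<exists>a4\<in>{1, -1 :: real}.
    g1 + a2 *\<^sub>R g2 + a3 *\<^sub>R g3 + a4 *\<^sub>R g4 = 0"
proof -
  obtain V where V: "\<And>Y. Y \<in> S \<Longrightarrow> ip (V Y) (V Y) = 1 \<and> Y = cyc (V Y) \<and> ip (V Y) g1 = 1 \<and>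
      ip (V Y) g2 \<in> {1, -1} \<and> ip (V Y) g3 \<in> {1, -1} \<and> ip (V Y) g4 \<in> {1, -1}"
    using ex_solution_vectors[OF six] by blast
  define f where "f Y = (ip (V Y) g2, ip (V Y) g3, ip (V Y) g4)" for Y
  obtain x1 x2 x3 x4 where x: "(x1, x2, x3, x4) \<noteq> (0, 0, 0, 0 :: real)"
    "x1 *\<^sub>R g1 + x2 *\<^sub>R g2 + x3 *\<^sub>R g3 + x4 *\<^sub>R g4 = 0"
    using ex_linear_relation[OF n(1) n(2-5)] by blast
  have cS: "card S = 6" using six by (simp add: six_tangent_def)
  then have fin: "finite S" by (metis card.infinite zero_neq_numeral)
  have "card S \<le> 2 * card (f ` S)"
    using card_le_two_fibres[OF fin subset_refl, of f] solution_fibre_set(1)[OF six n V] fin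
    unfolding f_def by blast
  then have "card (f ` S) \<ge> 3" using cS by simp
  moreover have "card (f ` S) \<le> 2" if "f ` S \<subseteq> {p, q}" for p q using card_le_insert_two[OF that] .
  ultimately have three: "\<not> f ` S \<subseteq> {p, q}" for p q by fastforce
  obtain Y1 where Y1: "Y1 \<in> S" using three by fastforce
  obtain Y2 where Y2: "Y2 \<in> S" "f Y2 \<noteq> f Y1" using three[of "f Y1" "f Y1"] by blast
  obtain Y3 where Y3: "Y3 \<in> S" "f Y3 \<noteq> f Y1" "f Y3 \<noteq> f Y2" using three[of "f Y1" "f Y2"] by blast
  define a2 a3 a4 where "a2 = ip (V Y1) g2" and "a3 = ip (V Y1) g3" and "a4 = ip (V Y1) g4"
  have a: "a2 \<in> {1, -1}" "a3 \<in> {1, -1}" "a4 \<in> {1, -1}" using V[OF Y1] by (simp_all add: a2_def a3_def a4_def)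
  have rel: "x1 + ip (V Y) g2 * x2 + ip (V Y) g3 * x3 + ip (V Y) g4 * x4 = 0" if "Y \<in> S" for Y
  proof -
    have "ip (V Y) (x1 *\<^sub>R g1 + x2 *\<^sub>R g2 + x3 *\<^sub>R g3 + x4 *\<^sub>R g4) = 0" unfolding x(2) by simp
    then show ?thesis using V[OF that] by (simp add: algebra_simps)
  qed
  \<comment> \<open>The signs of the first pattern are absorbed into the coefficients, so that the
    first equation becomes a plain sum and the other patterns are read relative to it.\<close>
  define y2 y3 y4 where "y2 = a2 * x2" and "y3 = a3 * x3" and "y4 = a4 * x4"
  have y: "x2 = a2 * y2" "x3 = a3 * y3" "x4 = a4 * y4"
    using a by (simp_all add: y2_def y3_def y4_def sign_square)
  have un: "ip g1 g1 = 1" "ip g2 g2 = 1" "ip g3 g3 = 1" "ip g4 g4 = 1"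
    and dist: "distinct [cyc g1, cyc g2, cyc g3, cyc g4]"
    using six unfolding six_tangent_def by blast+
  have two: False if "p *\<^sub>R g + q *\<^sub>R h = 0" "ip g g = 1" "ip h h = 1" "cyc g \<noteq> cyc h" "p \<noteq> 0 \<or> q \<noteq> 0"
    for p q :: real and g h
  proof -
    have e: "p *\<^sub>R g = (- q) *\<^sub>R h" using that(1) by (simp add: eq_neg_iff_add_eq_0)
    then have "ip (p *\<^sub>R g) (p *\<^sub>R g) = ip ((- q) *\<^sub>R h) ((- q) *\<^sub>R h)" by presburger
    then have "p\<^sup>2 = (- q)\<^sup>2" using that(2,3) by (simp add: power2_eq_square)
    then have pq: "p = - q \<or> p = q" unfolding power2_eq_iff by simp
    then have "p \<noteq> 0" using that(5) by auto
    have "p *\<^sub>R (g - h) = 0 \<or> p *\<^sub>R (g + h) = 0"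
      using e pq by (auto simp: scaleR_right_diff_distrib scaleR_right_distrib)
    then have "g = h \<or> g = - h" using \<open>p \<noteq> 0\<close> by (auto simp: eq_neg_iff_add_eq_0)
    then show False using that(4) by auto
  qed
  have nz: "y2 \<noteq> 0 \<longleftrightarrow> x2 \<noteq> 0" "y3 \<noteq> 0 \<longleftrightarrow> x3 \<noteq> 0" "y4 \<noteq> 0 \<longleftrightarrow> x4 \<noteq> 0"
    using a by (auto simp: y2_def y3_def y4_def)
  have aux: "p \<noteq> 0 \<or> q \<noteq> 0"
    if "(p, q, r, t) \<noteq> (0, 0, 0, 0)" "p *\<^sub>R b + q *\<^sub>R c + r *\<^sub>R g + t *\<^sub>R h = 0"
      "ip g g = 1" "ip h h = 1" "cyc g \<noteq> cyc h" for p q r t :: real and b c g h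
    using two[of r g t h] that by (cases "p = 0 \<and> q = 0") auto
  \<comment> \<open>At most one coefficient vanishes: if two did, the other two vectors would be
    proportional and their circles equal.\<close>
  have z12: "x1 \<noteq> 0 \<or> x2 \<noteq> 0"
    by (rule aux[of _ _ x3 x4 g1 g2 g3 g4]) (use x un dist in \<open>auto simp: add_ac\<close>)
  have z13: "x1 \<noteq> 0 \<or> x3 \<noteq> 0"
    by (rule aux[of _ _ x2 x4 g1 g3 g2 g4]) (use x un dist in \<open>auto simp: add_ac\<close>)
  have z14: "x1 \<noteq> 0 \<or> x4 \<noteq> 0"
    by (rule aux[of _ _ x2 x3 g1 g4 g2 g3]) (use x un dist in \<open>auto simp: add_ac\<close>)
  have z23: "x2 \<noteq> 0 \<or> x3 \<noteq> 0"
    by (rule aux[of _ _ x1 x4 g2 g3 g1 g4]) (use x un dist in \<open>auto simp: add_ac\<close>)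
  have z24: "x2 \<noteq> 0 \<or> x4 \<noteq> 0"
    by (rule aux[of _ _ x1 x3 g2 g4 g1 g3]) (use x un dist in \<open>auto simp: add_ac\<close>)
  have z34: "x3 \<noteq> 0 \<or> x4 \<noteq> 0"
    by (rule aux[of _ _ x1 x2 g3 g4 g1 g2]) (use x un dist in \<open>auto simp: add_ac\<close>)
  note z = z12 z13 z14 z23 z24 z34
  have i: "ip (V Y) g2 \<in> {1, -1}" "ip (V Y) g3 \<in> {1, -1}" "ip (V Y) g4 \<in> {1, -1}" if "Y \<in> S" for Y
    using V[OF that] by blast+
  have prod: "p * r \<in> {1, -1}" if "p \<in> {1, -1}" "r \<in> {1, -1}" for p r :: real using that by auto
  have eqp: "p = r" if "r * p = 1" "r \<in> {1, -1}" for p r :: real using that by auto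
  have eqp2: "p = q" if "r * p = r * q" "r \<in> {1, -1}" for p q r :: real using that by auto
  have fY: "f Y1 = (a2, a3, a4)" by (simp add: f_def a2_def a3_def a4_def)
  have s1: "x1 + y2 + y3 + y4 = 0" using rel[OF Y1] by (simp add: y2_def y3_def y4_def a2_def a3_def a4_def)
  have s: "x1 + (a2 * ip (V Y) g2) * y2 + (a3 * ip (V Y) g3) * y3 + (a4 * ip (V Y) g4) * y4 = 0"
    if "Y \<in> S" for Y
    using rel[OF that] unfolding y by (simp only: mult_ac)
  have ne1: "(a2 * ip (V Y) g2, a3 * ip (V Y) g3, a4 * ip (V Y) g4) \<noteq> (1, 1, 1)" if Y: "f Y \<noteq> f Y1" for Y
  proof
    assume "(a2 * ip (V Y) g2, a3 * ip (V Y) g3, a4 * ip (V Y) g4) = (1, 1, 1)"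
    then have e: "a2 * ip (V Y) g2 = 1" "a3 * ip (V Y) g3 = 1" "a4 * ip (V Y) g4 = 1" by simp_all
    have "f Y = (a2, a3, a4)"
      unfolding f_def eqp[OF e(1) a(1)] eqp[OF e(2) a(2)] eqp[OF e(3) a(3)] ..
    then show False using Y fY by simp
  qed
  have ne2: "(a2 * ip (V Y) g2, a3 * ip (V Y) g3, a4 * ip (V Y) g4) \<noteq>
      (a2 * ip (V Y') g2, a3 * ip (V Y') g3, a4 * ip (V Y') g4)" if Y: "f Y \<noteq> f Y'" for Y Y'
  proof
    assume "(a2 * ip (V Y) g2, a3 * ip (V Y) g3, a4 * ip (V Y) g4) =
      (a2 * ip (V Y') g2, a3 * ip (V Y') g3, a4 * ip (V Y') g4)"
    then have e: "a2 * ip (V Y) g2 = a2 * ip (V Y') g2" "a3 * ip (V Y) g3 = a3 * ip (V Y') g3"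
      "a4 * ip (V Y) g4 = a4 * ip (V Y') g4" by simp_all
    have "f Y = f Y'"
      unfolding f_def eqp2[OF e(1) a(1)] eqp2[OF e(2) a(2)] eqp2[OF e(3) a(3)] ..
    then show False using Y by simp
  qed
  have eq: "x1 \<noteq> 0 \<and> (y2 = x1 \<or> y2 = - x1) \<and> (y3 = x1 \<or> y3 = - x1) \<and> (y4 = x1 \<or> y4 = - x1)"
  proof (rule equal_coefficients[OF s1 s[OF Y2(1)] s[OF Y3(1)]])
    show "a2 * ip (V Y2) g2 \<in> {1, -1}" "a3 * ip (V Y2) g3 \<in> {1, -1}" "a4 * ip (V Y2) g4 \<in> {1, -1}"
      "a2 * ip (V Y3) g2 \<in> {1, -1}" "a3 * ip (V Y3) g3 \<in> {1, -1}" "a4 * ip (V Y3) g4 \<in> {1, -1}"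
      by (intro prod a i Y2(1) Y3(1))+
    show "(a2 * ip (V Y2) g2, a3 * ip (V Y2) g3, a4 * ip (V Y2) g4) \<noteq> (1, 1, 1)"
      "(a2 * ip (V Y3) g2, a3 * ip (V Y3) g3, a4 * ip (V Y3) g4) \<noteq> (1, 1, 1)"
      using ne1 Y2(2) Y3(2) by simp_all
    show "(a2 * ip (V Y2) g2, a3 * ip (V Y2) g3, a4 * ip (V Y2) g4) \<noteq>
        (a2 * ip (V Y3) g2, a3 * ip (V Y3) g3, a4 * ip (V Y3) g4)"
      by (rule ne2) (use Y3(3) in simp)
  qed (use z nz in simp_all)
  have x1: "x1 \<noteq> 0" using eq by blast
  have r: "p * q / x1 \<in> {1, -1}" if "p \<in> {1, -1}" "q = x1 \<or> q = - x1" for p q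
    using that x1 by auto
  have m: "x2 / x1 \<in> {1, -1}" "x3 / x1 \<in> {1, -1}" "x4 / x1 \<in> {1, -1}"
    unfolding y using eq by (intro r a; blast)+
  have "g1 + (x2 / x1) *\<^sub>R g2 + (x3 / x1) *\<^sub>R g3 + (x4 / x1) *\<^sub>R g4 =
      inverse x1 *\<^sub>R (x1 *\<^sub>R g1 + x2 *\<^sub>R g2 + x3 *\<^sub>R g3 + x4 *\<^sub>R g4)"
    using x1 by (simp add: scaleR_right_distrib divide_inverse_commute)
  then have E: "g1 + (x2 / x1) *\<^sub>R g2 + (x3 / x1) *\<^sub>R g3 + (x4 / x1) *\<^sub>R g4 = 0"
    unfolding x(2) by simp
  show ?thesis
  proof (intro bexI)
    show "g1 + (x2 / x1) *\<^sub>R g2 + (x3 / x1) *\<^sub>R g3 + (x4 / x1) *\<^sub>R g4 = 0" by (rule E)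
  qed (rule m)+
qed

lemma card_three_fibres:
  assumes "card S = 6" "S \<subseteq> A \<union> B \<union> C" "A \<subseteq> {a}" "B \<subseteq> {b, b'}" "C \<subseteq> {c, c'}"
  shows False
proof -
  have "S \<subseteq> set [a, b, b', c, c']" using assms(2-5) by auto
  then have "card S \<le> card (set [a, b, b', c, c'])" by (intro card_mono) auto
  also have "\<dots> \<le> length [a, b, b', c, c']" by (rule card_length)
  finally show False using assms(1) by simp
qed

text \<open>Taking the product of the vanishing sum with each of the four vectors gives four linear
  equations for the six products; opposite entries of the Gram matrix agree.\<close>

lemma balanced_gram:
  assumes "k1 + k2 + k3 + k4 = 0" "ip k1 k1 = 1" "ip k2 k2 = 1" "ip k3 k3 = 1" "ip k4 k4 = 1"
  shows "1 + ip k1 k2 + ip k1 k3 + ip k1 k4 = 0"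
    and "ip k2 k3 = ip k1 k4" "ip k2 k4 = ip k1 k3" "ip k3 k4 = ip k1 k2"
proof -
  have "ip (k1 + k2 + k3 + k4) k1 = 0" "ip (k1 + k2 + k3 + k4) k2 = 0"
    "ip (k1 + k2 + k3 + k4) k3 = 0" "ip (k1 + k2 + k3 + k4) k4 = 0"
    unfolding assms(1) by simp_all
  then have "1 + ip k1 k2 + ip k1 k3 + ip k1 k4 = 0" "ip k1 k2 + 1 + ip k2 k3 + ip k2 k4 = 0"
    "ip k1 k3 + ip k2 k3 + 1 + ip k3 k4 = 0" "ip k1 k4 + ip k2 k4 + ip k3 k4 + 1 = 0"
    using assms(2-5) ip_commute[of k2 k1] ip_commute[of k3 k1] ip_commute[of k4 k1]
      ip_commute[of k3 k2] ip_commute[of k4 k2] ip_commute[of k4 k3] by simp_all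
  then show "1 + ip k1 k2 + ip k1 k3 + ip k1 k4 = 0" "ip k2 k3 = ip k1 k4" "ip k2 k4 = ip k1 k3" "ip k3 k4 = ip k1 k2"
    by linarith+
qed

text \<open>The solutions tangent with equal signs to \<open>k1\<close>, \<open>k2\<close> and with the opposite sign to \<open>k3\<close>, \<open>k4\<close>
  are \<open>(k1 + k2) / (1 + ip k1 k2) \<plusminus> t n\<close>; there are two of them, so that \<open>t \<noteq> 0\<close>.\<close>

lemma balanced_discriminant:
  assumes six: "six_tangent k1 k2 k3 k4 S" and sum: "k1 + k2 + k3 + k4 = 0"
    and n: "ip n n = 1 \<or> ip n n = -1" "ip n k1 = 0" "ip n k2 = 0" "ip n k3 = 0" "ip n k4 = 0"
  shows "ip n n * (ip k1 k2 * ip k1 k2 - 1) > 0"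
proof -
  have nn: "ip n n \<noteq> 0" using n(1) by auto
  have un: "ip k1 k1 = 1" "ip k2 k2 = 1" "ip k3 k3 = 1" "ip k4 k4 = 1"
    and dist: "distinct [cyc k1, cyc k2, cyc k3, cyc k4]"
    using six unfolding six_tangent_def by blast+
  obtain V where V: "\<And>Y. Y \<in> S \<Longrightarrow> ip (V Y) (V Y) = 1 \<and> Y = cyc (V Y) \<and> ip (V Y) k1 = 1 \<and>
      ip (V Y) k2 \<in> {1, -1} \<and> ip (V Y) k3 \<in> {1, -1} \<and> ip (V Y) k4 \<in> {1, -1}"
    using ex_solution_vectors[OF six] by blast
  define f where "f Y = (ip (V Y) k2, ip (V Y) k3, ip (V Y) k4)" for Y
  have bal: "f Y \<in> {(1, -1, -1), (-1, 1, -1), (-1, -1, 1)}" if "Y \<in> S" for Y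
  proof -
    have "ip (V Y) (k1 + k2 + k3 + k4) = 0" unfolding sum by simp
    then have "1 + ip (V Y) k2 + ip (V Y) k3 + ip (V Y) k4 = 0" using V[OF that] by simp
    then show ?thesis using V[OF that] by (auto simp: f_def)
  qed
  have cS: "card S = 6" using six by (simp add: six_tangent_def)
  \<comment> \<open>The vanishing sum admits only three patterns. If the solutions of the first were
    all orthogonal to \<open>n\<close>, there would be at most 1 + 2 + 2 solutions.\<close>
  have "\<exists>Y\<in>S. f Y = (1, -1, -1) \<and> ip (V Y) n \<noteq> 0"
  proof (rule ccontr)
    assume no: "\<not> ?thesis"
    obtain p where 1: "{Y \<in> S. f Y = (1, -1, -1)} \<subseteq> {p}"
      using solution_fibre_set(2)[OF six nn n(2-5) V, of "(1, -1, -1)"] no unfolding f_def by blast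
    obtain q q' where 2: "{Y \<in> S. f Y = (-1, 1, -1)} \<subseteq> {q, q'}"
      using solution_fibre_set(1)[OF six nn n(2-5) V, of "(-1, 1, -1)"] unfolding f_def by blast
    obtain r r' where 3: "{Y \<in> S. f Y = (-1, -1, 1)} \<subseteq> {r, r'}"
      using solution_fibre_set(1)[OF six nn n(2-5) V, of "(-1, -1, 1)"] unfolding f_def by blast
    have "S \<subseteq> {Y \<in> S. f Y = (1, -1, -1)} \<union> {Y \<in> S. f Y = (-1, 1, -1)} \<union> {Y \<in> S. f Y = (-1, -1, 1)}"
      using bal by blast
    then show False by (rule card_three_fibres[OF cS _ 1 2 3])
  qed
  then obtain Y where Y: "Y \<in> S" "f Y = (1, -1, -1)" "ip (V Y) n \<noteq> 0" by blast
  define v where "v = V Y"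
  have v: "ip v v = 1" "ip v k1 = 1" "ip v k2 = 1" "ip v k3 = -1" "ip v k4 = -1" "ip v n \<noteq> 0"
    using V[OF Y(1)] Y(2,3) by (simp_all add: v_def f_def)
  define x where "x = ip k1 k2"
  note g = balanced_gram[OF sum un]
  define m where "m = k1 + k2"
  have m: "ip m k1 = 1 + x" "ip m k2 = 1 + x" "ip m k3 = - (1 + x)" "ip m k4 = - (1 + x)" "ip m m = 2 * (1 + x)"
    using un g ip_commute[of k2 k1] by (simp_all add: m_def x_def)
  \<comment> \<open>Otherwise \<open>m\<close> is a null vector orthogonal to all four, hence zero,
    and the first two circles coincide.\<close>
  have "x \<noteq> -1"
  proof
    assume "x = -1"
    then have "m = 0" using m by (intro no_common_null_vector[OF six]) simp_all
    then have "k1 = - k2" by (simp add: m_def eq_neg_iff_add_eq_0)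
    then show False using dist by simp
  qed
  then have x1: "1 + x \<noteq> 0" by simp
  define w where "w = v - (1 / (1 + x)) *\<^sub>R m"
  have "(- 1 - x) / (1 + x) = -1" using x1 by (simp add: field_simps)
  then have "ip w k1 = 0" "ip w k2 = 0" "ip w k3 = 0" "ip w k4 = 0"
    using v m x1 by (simp_all add: w_def)
  from common_orthogonal_unique[OF six nn n(2-5) this] obtain t where t: "w = t *\<^sub>R n" by blast
  have vt: "v = (1 / (1 + x)) *\<^sub>R m + t *\<^sub>R n" using t by (simp add: w_def algebra_simps)
  have "ip n m = 0" using n by (simp add: m_def)
  then have mn: "ip m n = 0" "ip n m = 0" using ip_commute[of m n] by simp_all
  have "t \<noteq> 0" using v(6) mn unfolding vt by auto
  have "ip v v = (1 / (1 + x)) * (1 / (1 + x)) * ip m m + t * t * ip n n"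
    unfolding vt by (simp add: mn algebra_simps)
  also have "(1 / (1 + x)) * (1 / (1 + x)) * ip m m = 2 / (1 + x)"
  proof -
    have "(1 / k) * (1 / k) * (2 * k) = 2 / k" if "k \<noteq> 0" for k :: real using that by simp
    from this[OF x1] show ?thesis unfolding m(5) .
  qed
  finally have "1 = 2 / (1 + x) + t * t * ip n n" using v(1) by simp
  moreover have "q * k = k - 2" if "1 = 2 / k + q" "k \<noteq> 0" for q k :: real
    using that by (simp add: field_simps)
  ultimately have "t * t * ip n n * (1 + x) = (1 + x) - 2" using x1 by blast
  then have "t * t * ip n n * (1 + x) * (1 + x) = ((1 + x) - 2) * (1 + x)" by simp
  then have sq: "t * t * ip n n * ((1 + x) * (1 + x)) = x * x - 1" by (simp add: algebra_simps)
  have "ip n n * (x * x - 1) = (ip n n * ip n n) * ((t * t) * ((1 + x) * (1 + x)))"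
    unfolding sq[symmetric] by (simp only: mult_ac)
  also have "ip n n * ip n n = 1" using n(1) by auto
  finally have eq: "ip n n * (x * x - 1) = (t * t) * ((1 + x) * (1 + x))" by simp
  have pos: "y * y > 0" if "y \<noteq> 0" for y :: real using that by (simp flip: power2_eq_square)
  have "(t * t) * ((1 + x) * (1 + x)) > 0" using mult_pos_pos[OF pos[OF \<open>t \<noteq> 0\<close>] pos[OF x1]] .
  then have "ip n n * (x * x - 1) > 0" unfolding eq .
  then show ?thesis unfolding x_def .
qed

text \<open>The fourth vector is minus the sum of the others, so a vector orthogonal to these three
  is orthogonal to all four and thus a multiple of \<open>n\<close>. Three circles together with
  \<open>n\<close> therefore serve as the basis to be moved.\<close>

lemma spanning_with_orthogonal:
  assumes six: "six_tangent k1 k2 k3 k4 S" and sum: "k1 + k2 + k3 + k4 = 0"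
    and n: "ip n n = 1 \<or> ip n n = -1" "ip n k1 = 0" "ip n k2 = 0" "ip n k3 = 0" "ip n k4 = 0"
  shows "spanning k1 k2 k3 n"
  unfolding spanning_def
proof (intro allI impI)
  fix w assume w: "ip w k1 = 0" "ip w k2 = 0" "ip w k3 = 0" "ip w n = 0"
  have "ip w (k1 + k2 + k3 + k4) = 0" unfolding sum by simp
  then have "ip w k4 = 0" using w by simp
  moreover have nn: "ip n n \<noteq> 0" using n(1) by auto
  ultimately obtain l where l: "w = l *\<^sub>R n"
    using common_orthogonal_unique[OF six nn n(2-5) w(1-3)] by blast
  then have "l * ip n n = 0" using w(4) by simp
  then show "w = 0" using l nn by simp
qed

text \<open>The vector \<open>n\<close> goes to (1, 0, 1), and two given circles become lines.
  Half-angle formulas give \<open>s\<close> and \<open>c\<close>, since the product of the two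
  normals is s^2 - c^2; the product of the first and third vectors gives \<open>e\<close>.\<close>

lemma normalizable_definite:
  assumes six: "six_tangent k1 k2 k3 k4 S" and sum: "k1 + k2 + k3 + k4 = 0"
    and n: "ip n n = -1" "ip n k1 = 0" "ip n k2 = 0" "ip n k3 = 0" "ip n k4 = 0"
    and x: "ip k1 k2 * ip k1 k2 < 1" "ip k1 k3 * ip k1 k3 < 1" "ip k1 k4 * ip k1 k4 < 1"
  shows "normalizable {cyc k1, cyc k2, cyc k3, cyc k4} S"
proof -
  have un: "ip k1 k1 = 1" "ip k2 k2 = 1" "ip k3 k3 = 1" "ip k4 k4 = 1"
    using six unfolding six_tangent_def by blast+
  note g = balanced_gram[OF sum un]
  define x y z where "x = ip k1 k2" and "y = ip k1 k3" and "z = ip k1 k4"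
  have xyz: "1 + x + y + z = 0" using g(1) by (simp add: x_def y_def z_def)
  have bounds: "- 1 < t \<and> t < 1" if "t * t < 1" for t :: real
    using that abs_square_less_1[of t] by (simp add: power2_eq_square abs_less_iff)
  have b: "-1 < x" "x < 1" "-1 < y" "-1 < z"
    using bounds[OF x(1)] bounds[OF x(2)] bounds[OF x(3)] by (simp_all add: x_def y_def z_def)
  define s c where "s = sqrt ((1 + x) / 2)" and "c = sqrt ((1 - x) / 2)"
  have sc: "s > 0" "c > 0" "s * s = (1 + x) / 2" "c * c = (1 - x) / 2"
    using b by (simp_all add: s_def c_def)
  define e where "e = (y + s * s) / c"
  have ce: "c * e = y + s * s" using sc(2) by (simp add: e_def)
  \<comment> \<open>The last entry \<open>r\<close> exists as a real number because this expression
    factors into \<open>(1 + y) * (1 + z)\<close>, and \<open>y\<close>, \<open>z\<close> exceed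
    -1.\<close>
  have "(c * c) * (c * c - e * e) = (c * c) * (c * c) - (c * e) * (c * e)" by (simp add: algebra_simps)
  also have "\<dots> = (1 + y) * (1 + z)"
  proof -
    have z: "z = - 1 - x - y" using xyz by simp
    show ?thesis unfolding ce sc(3,4) z by (simp add: field_simps)
  qed
  also have "\<dots> > 0" using b by simp
  finally have "c * c - e * e > 0" using sc(2) by (simp add: zero_less_mult_iff)
  then obtain r where r: "r > 0" "r * r = c * c - e * e"
    by (intro that[of "sqrt (c * c - e * e)"]) simp_all
  define h1 h2 h3 h4 :: cvec where "h1 = (0, Complex s c, 0)" and "h2 = (0, Complex s (- c), 0)"
    and "h3 = (r, Complex (- s) e, - r)" and "h4 = (- r, Complex (- s) (- e), r)"
  note h = h1_def h2_def h3_def h4_def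
  have ss: "s * s + c * c = 1" "s * s - c * c = x" using sc(3,4) by (simp_all add: field_simps)
  have raw: "ip h1 h1 = s * s + c * c" "ip h2 h2 = s * s + c * c" "ip h3 h3 = s * s + e * e + r * r"
    "ip h1 h2 = s * s - c * c" "ip h1 h3 = - (s * s) + c * e" "ip h2 h3 = - (s * s) - c * e"
    by (simp_all add: h ip_triple inner_complex_def)
  have z: "z = - 1 - x - y" using xyz by simp
  have "- (s * s) - c * e = z" unfolding ce sc(3) z by (simp add: field_simps)
  then have gram: "ip h1 h1 = 1" "ip h2 h2 = 1" "ip h3 h3 = 1" "ip h1 h2 = x" "ip h1 h3 = y" "ip h2 h3 = z"
    unfolding raw using ss ce r(2) by simp_all
  have gram': "ip (1, 0, 1) (1, 0, 1) = -1" "ip h1 (1, 0, 1) = 0" "ip h2 (1, 0, 1) = 0" "ip h3 (1, 0, 1) = 0"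
    by (simp_all add: h ip_triple)
  have "spanning k1 k2 k3 n" using spanning_with_orthogonal[OF six sum _ n(2-5)] n(1) by blast
  from ex_induces_of_gram[OF this, of h1 h2 h3 "(1, 0, 1)"]
  obtain F T where F: "induces F T" "T k1 = h1" "T k2 = h2" "T k3 = h3"
    using un n gram gram' g ip_commute[of k1 n] ip_commute[of k2 n] ip_commute[of k3 n]
    unfolding x_def y_def z_def by metis
  have "k4 = - (k1 + k2 + k3)" using minus_unique[OF sum] by simp
  then have "T k4 = - (h1 + h2 + h3)"
    using induces_linear[OF F(1)] F(2-4) by (simp only: linear_neg linear_add)
  then have F4: "T k4 = h4" by (simp add: h complex_eq_iff)
  show ?thesis
  proof (rule normalizableI[OF F(1) six])
    assume "six_tangent (T k1) (T k2) (T k3) (T k4) (image F ` S)"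
    then have "six_tangent (0, Complex s c, 0) (0, Complex s (- c), 0)
      (r, Complex (- s) e, - r) (- r, Complex (- s) (- e), r) (image F ` S)"
      unfolding F F4 h .
    from config2_model[OF sc(1,2) r(1) ss(1) r(2) this]
    show "config1 {cyc (T k1), cyc (T k2), cyc (T k3), cyc (T k4)} (image F ` S) \<or>
      config2 {cyc (T k1), cyc (T k2), cyc (T k3), cyc (T k4)} (image F ` S) \<or>
      config3 {cyc (T k1), cyc (T k2), cyc (T k3), cyc (T k4)} (image F ` S) \<or>
      config4 {cyc (T k1), cyc (T k2), cyc (T k3), cyc (T k4)} (image F ` S)"
      unfolding F F4 h by blast
  qed
qed

text \<open>The vector \<open>n\<close> goes to the real axis, which becomes the common orthogonal
  line of the four circles. The circles about 1 and -1 with radius s, with opposite signs, have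
  product 2 / s^2 - 1, so \<open>y\<close> determines \<open>s\<close>; then \<open>x\<close>
  determines P + 1 / P = 2 k.\<close>

lemma normalizable_indefinite:
  assumes six: "six_tangent k1 k2 k3 k4 S" and sum: "k1 + k2 + k3 + k4 = 0"
    and n: "ip n n = 1" "ip n k1 = 0" "ip n k2 = 0" "ip n k3 = 0" "ip n k4 = 0"
    and x: "ip k1 k2 > 1" "ip k1 k3 > 1"
  shows "normalizable {cyc k1, cyc k2, cyc k3, cyc k4} S"
proof -
  have un: "ip k1 k1 = 1" "ip k2 k2 = 1" "ip k3 k3 = 1" "ip k4 k4 = 1"
    using six unfolding six_tangent_def by blast+
  note g = balanced_gram[OF sum un]
  define x y z where "x = ip k1 k2" and "y = ip k1 k3" and "z = ip k1 k4"
  have xyz: "1 + x + y + z = 0" using g(1) by (simp add: x_def y_def z_def)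
  have b: "x > 1" "y > 1" using x by (simp_all add: x_def y_def)
  define s c where "s = sqrt (2 / (1 + y))" and "c = sqrt ((y - 1) / (1 + y))"
  have sc: "s > 0" "c > 0" "s * s = 2 / (1 + y)" "c * c = (y - 1) / (1 + y)"
    using b by (simp_all add: s_def c_def)
  have frac: "2 / d + (d - 2) / d = 1" "2 / d * (d - 1) = 1 + (d - 2) / d" if "d > 0" for d :: real
    using that by (simp_all add: field_simps)
  have y1: "1 + y > 0" "(1 + y) - 2 = y - 1" "(1 + y) - 1 = y" using b by simp_all
  have ss: "s * s + c * c = 1" and y: "s * s * y = 1 + c * c"
    unfolding sc(3,4) using frac[OF y1(1)] unfolding y1(2,3) by (simp_all only:)
  define k where "k = (1 + x * (s * s)) / (c * c)"
  have k: "c * c * k = 1 + x * (s * s)" using sc(2) by (simp add: k_def)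
  have "s * s > 0" "c * c > 0" using sc(1,2) by simp_all
  have "x * (s * s) > 1 * (s * s)" using b(1) \<open>s * s > 0\<close> by (intro mult_strict_right_mono)
  then have "c * c * 1 < c * c * k" using k ss \<open>s * s > 0\<close> by linarith
  then have "k > 1" using \<open>c * c > 0\<close> by (simp only: mult_less_cancel_left_pos)
  \<comment> \<open>The larger root of P^2 - 2 k P + 1 = 0; the choice makes the ratio of the two
    radii exceed 1.\<close>
  define P where "P = k + sqrt (k * k - 1)"
  have "k * k > 1" using less_1_mult[OF \<open>k > 1\<close> \<open>k > 1\<close>] .
  then have rt: "sqrt (k * k - 1) > 0" "sqrt (k * k - 1) * sqrt (k * k - 1) = k * k - 1" by simp_all
  have P: "P > 1" unfolding P_def using \<open>k > 1\<close> rt(1) by linarith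
  have "P * P + 1 = 2 * k * P"
    using rt(2) by (simp add: P_def algebra_simps)
  then have Pk: "P + 1 / P = 2 * k" using P by (simp add: field_simps)
  define h1 h2 h3 h4 :: cvec where "h1 = (1 / s, Complex (1 / s) 0, c * c / s)"
    and "h2 = (- (1 / (s * P)), Complex (- (1 / s)) 0, - (P * (c * c) / s))"
    and "h3 = (- (1 / s), Complex (1 / s) 0, - (c * c / s))"
    and "h4 = (1 / (s * P), Complex (- (1 / s)) 0, P * (c * c) / s)"
  note h = h1_def h2_def h3_def h4_def
  define q :: cvec where "q = (0, \<i>, 0)"
  have s0: "s \<noteq> 0" "P \<noteq> 0" and ss': "1 - c * c = s * s" using sc(1) P ss by auto
  have unit: "(1 - c * c) / (s * s) = 1" unfolding ss' using s0 by simp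
  have "ip h1 h1 = (1 - c * c) / (s * s)" "ip h3 h3 = (1 - c * c) / (s * s)" "ip h2 h2 = (1 - c * c) / (s * s)"
    using s0 by (simp_all add: h ip_triple inner_complex_def field_simps)
  moreover have "ip h1 h3 = (1 + c * c) / (s * s)"
    using s0 by (simp add: h ip_triple inner_complex_def field_simps)
  moreover have "ip h1 h2 = (c * c * ((P + 1 / P) / 2) - 1) / (s * s)" "ip h2 h3 = - (1 + c * c * ((P + 1 / P) / 2)) / (s * s)"
    using s0 by (simp_all add: h ip_triple inner_complex_def field_simps)
  moreover have "(1 + c * c) / (s * s) = y" unfolding y[symmetric] using s0 by simp
  moreover have "(P + 1 / P) / 2 = k" using Pk by simp
  moreover have "(c * c * k - 1) / (s * s) = x" unfolding k using s0 by simp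
  moreover have "- (1 + c * c * k) / (s * s) = z"
  proof -
    have "s * s * (1 + y) = 2" unfolding distrib_left y using ss by simp
    moreover have z: "z = - 1 - x - y" using xyz by simp
    have "z * (s * s) = - (s * s * (1 + y)) - x * (s * s)" unfolding z by (simp add: algebra_simps)
    ultimately have "- (1 + c * c * k) = z * (s * s)" unfolding k by simp
    then show ?thesis using s0 by simp
  qed
  ultimately have gram: "ip h1 h1 = 1" "ip h2 h2 = 1" "ip h3 h3 = 1" "ip h1 h2 = x" "ip h1 h3 = y" "ip h2 h3 = z"
    using unit by simp_all
  have gram': "ip q q = 1" "ip h1 q = 0" "ip h2 q = 0" "ip h3 q = 0"
    by (simp_all add: h q_def ip_triple inner_complex_def)
  have "spanning k1 k2 k3 n" using spanning_with_orthogonal[OF six sum _ n(2-5)] n(1) by blast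
  from ex_induces_of_gram[OF this, of h1 h2 h3 q]
  obtain F T where F: "induces F T" "T k1 = h1" "T k2 = h2" "T k3 = h3"
    using un n gram gram' g ip_commute[of k1 n] ip_commute[of k2 n] ip_commute[of k3 n]
    unfolding x_def y_def z_def by metis
  have "k4 = - (k1 + k2 + k3)" using minus_unique[OF sum] by simp
  then have "T k4 = - (h1 + h2 + h3)"
    using induces_linear[OF F(1)] F(2-4) by (simp only: linear_neg linear_add)
  then have F4: "T k4 = h4" by (simp add: h complex_eq_iff)
  show ?thesis
  proof (rule normalizableI[OF F(1) six])
    assume "six_tangent (T k1) (T k2) (T k3) (T k4) (image F ` S)"
    from config1_model[OF sc(1,2) P ss this[unfolded F F4 h]]
    show "config1 {cyc (T k1), cyc (T k2), cyc (T k3), cyc (T k4)} (image F ` S) \<or>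
      config2 {cyc (T k1), cyc (T k2), cyc (T k3), cyc (T k4)} (image F ` S) \<or>
      config3 {cyc (T k1), cyc (T k2), cyc (T k3), cyc (T k4)} (image F ` S) \<or>
      config4 {cyc (T k1), cyc (T k2), cyc (T k3), cyc (T k4)} (image F ` S)"
      unfolding F F4 h by blast
  qed
qed

text \<open>The form is nonnegative on the hyperplane where the outer entries sum to 0. Some
  nontrivial combination of \<open>v\<close> and \<open>w\<close> lies in it, although two
  orthogonal timelike vectors would make that combination timelike.\<close>

lemma no_orthogonal_timelike:
  assumes "ip v v < 0" "ip w w < 0"
  shows "ip v w \<noteq> 0"
proof
  assume o: "ip v w = 0"
  define t :: "cvec \<Rightarrow> real" where "t u = fst u + snd (snd u)" for u
  have lin: "t (a *\<^sub>R u - b *\<^sub>R u') = a * t u - b * t u'" for a b u u'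
    by (simp add: t_def algebra_simps)
  have pos: "ip u u \<ge> 0" if "t u = 0" for u
  proof -
    have "snd (snd u) = - fst u" using that by (simp add: t_def)
    then show ?thesis by (simp add: ip_def)
  qed
  have "t v \<noteq> 0" using pos[of v] assms(1) by linarith
  define u where "u = t w *\<^sub>R v - t v *\<^sub>R w"
  have "ip u u = (t w * t w) * ip v v + (t v * t v) * ip w w"
    using o ip_commute[of w v] by (simp add: u_def algebra_simps)
  moreover have "(t w * t w) * ip v v \<le> 0" using assms(1) by (intro mult_nonneg_nonpos) simp_all
  moreover have "t v * t v > 0" using \<open>t v \<noteq> 0\<close> by (simp flip: power2_eq_square)
  then have "(t v * t v) * ip w w < 0" using assms(2) by (rule mult_pos_neg)
  ultimately have "ip u u < 0" by linarith
  then show False using pos[of u] lin by (simp add: u_def)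
qed

lemma normalizable_not_spanning:
  assumes six: "six_tangent g1 g2 g3 g4 S" and nsp: "\<not> spanning g1 g2 g3 g4"
  shows "normalizable {cyc g1, cyc g2, cyc g3, cyc g4} S"
proof -
  obtain n where n: "ip n n = 1 \<or> ip n n = -1" "ip n g1 = 0" "ip n g2 = 0" "ip n g3 = 0" "ip n g4 = 0"
    using normalized_orthogonal_vector[OF six nsp] by blast
  have nn: "ip n n \<noteq> 0" using n(1) by auto
  obtain a2 a3 a4 where a: "a2 \<in> {1, -1}" "a3 \<in> {1, -1}" "a4 \<in> {1, -1 :: real}"
    "g1 + a2 *\<^sub>R g2 + a3 *\<^sub>R g3 + a4 *\<^sub>R g4 = 0"
    using balanced_signs[OF six nn n(2-5)] by blast
  define k1 k2 k3 k4 where "k1 = g1" and "k2 = a2 *\<^sub>R g2" and "k3 = a3 *\<^sub>R g3" and "k4 = a4 *\<^sub>R g4"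
  note k = k1_def k2_def k3_def k4_def
  have K: "six_tangent k1 k2 k3 k4 S"
    using six_tangent_signs[OF six, of 1 a2 a3 a4] a(1-3) by (simp add: k)
  have sum: "k1 + k2 + k3 + k4 = 0" using a(4) by (simp only: k)
  have nk: "ip n k1 = 0" "ip n k2 = 0" "ip n k3 = 0" "ip n k4 = 0" using n by (simp_all add: k)
  have sets: "{cyc k1, cyc k2, cyc k3, cyc k4} = {cyc g1, cyc g2, cyc g3, cyc g4}"
    unfolding k using cyc_sign[OF a(1)] cyc_sign[OF a(2)] cyc_sign[OF a(3)] by simp
  have K3: "six_tangent k1 k3 k2 k4 S" by (rule six_tangent_permute(2)[OF K])
  have K4: "six_tangent k1 k4 k2 k3 S"
    by (rule six_tangent_permute(2)[OF six_tangent_permute(3)[OF K]])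
  have sum3: "k1 + k3 + k2 + k4 = 0" and sum4: "k1 + k4 + k2 + k3 = 0"
    using sum by (simp_all add: add_ac)
  have d: "ip n n * (ip k1 k2 * ip k1 k2 - 1) > 0" "ip n n * (ip k1 k3 * ip k1 k3 - 1) > 0"
    "ip n n * (ip k1 k4 * ip k1 k4 - 1) > 0"
    using balanced_discriminant[OF K sum n(1) nk]
      balanced_discriminant[OF K3 sum3 n(1) nk(1,3,2,4)]
      balanced_discriminant[OF K4 sum4 n(1) nk(1,4,2,3)] by blast+
  show ?thesis
  proof (cases "ip n n = 1")
    case False
    then have m: "ip n n = -1" using n(1) by blast
    then have "ip k1 k2 * ip k1 k2 < 1" "ip k1 k3 * ip k1 k3 < 1" "ip k1 k4 * ip k1 k4 < 1"
      using d by simp_all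
    from normalizable_definite[OF K sum m nk this] show ?thesis unfolding sets .
  next
    case True
    have un: "ip k1 k1 = 1" "ip k2 k2 = 1" "ip k3 k3 = 1" "ip k4 k4 = 1"
      using K unfolding six_tangent_def by blast+
    have s: "1 + ip k1 k2 + ip k1 k3 + ip k1 k4 = 0" by (rule balanced_gram(1)[OF sum un])
    note g = balanced_gram[OF sum un]
    have c: "ip k2 k1 = ip k1 k2" "ip k3 k1 = ip k1 k3" "ip k4 k1 = ip k1 k4"
      "ip k3 k2 = ip k1 k4" "ip k4 k2 = ip k1 k3" "ip k4 k3 = ip k1 k2"
      using g ip_commute by metis+
    \<comment> \<open>The sums \<open>k1 + k2\<close>, \<open>k1 + k3\<close>,
      \<open>k1 + k4\<close> are pairwise orthogonal, so at most one of them is timelike. Hence at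
      most one of the three products is below -1 and two of them exceed 1.\<close>
    have m: "ip (k1 + k2) (k1 + k2) = 2 * (1 + ip k1 k2)" "ip (k1 + k3) (k1 + k3) = 2 * (1 + ip k1 k3)"
      "ip (k1 + k4) (k1 + k4) = 2 * (1 + ip k1 k4)"
      "ip (k1 + k2) (k1 + k3) = 0" "ip (k1 + k2) (k1 + k4) = 0" "ip (k1 + k3) (k1 + k4) = 0"
      using un s g(2-4) c by simp_all
    have "t > 1 \<or> t < -1" if "1 * (t * t - 1) > 0" for t :: real
      using that abs_square_le_1[of t] by (simp add: power2_eq_square abs_le_iff) linarith
    from this[OF d(1)[unfolded True]] this[OF d(2)[unfolded True]] this[OF d(3)[unfolded True]]
    consider "ip k1 k2 > 1" "ip k1 k3 > 1" | "ip k1 k2 > 1" "ip k1 k4 > 1" | "ip k1 k3 > 1" "ip k1 k4 > 1"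
      | "ip k1 k2 < -1" "ip k1 k3 < -1" | "ip k1 k2 < -1" "ip k1 k4 < -1" | "ip k1 k3 < -1" "ip k1 k4 < -1"
      by blast
    then show ?thesis
    proof cases
      case 1
      from normalizable_indefinite[OF K sum True nk 1] show ?thesis unfolding sets .
    next
      case 2
      have "k1 + k2 + k4 + k3 = 0" using sum by (simp add: add_ac)
      from normalizable_indefinite[OF six_tangent_permute(3)[OF K] this True nk(1,2,4,3) 2]
      show ?thesis using sets by (simp add: insert_commute)
    next
      case 3
      have "k1 + k3 + k4 + k2 = 0" using sum by (simp add: add_ac)
      from normalizable_indefinite[OF six_tangent_permute(3)[OF K3] this True nk(1,3,4,2) 3]
      show ?thesis using sets by (simp add: insert_commute)
    next
      case 4
      then show ?thesis using no_orthogonal_timelike[of "k1 + k2" "k1 + k3"] m by simp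
    next
      case 5
      then show ?thesis using no_orthogonal_timelike[of "k1 + k2" "k1 + k4"] m by simp
    next
      case 6
      then show ?thesis using no_orthogonal_timelike[of "k1 + k3" "k1 + k4"] m by simp
    qed
  qed
qed

lemma normalizable_six_tangent:
  assumes "six_tangent g1 g2 g3 g4 S"
  shows "normalizable {cyc g1, cyc g2, cyc g3, cyc g4} S"
  using normalizable_spanning[OF assms] normalizable_not_spanning[OF assms] by blast

section \<open>Reduction to circles and lines without a common point\<close>

lemma induces_configuration:
  assumes "induces F T" "card G = 4" "\<forall>X\<in>G. gen_circle X" "\<not> all_tangent_at_one_point G"
    and "\<forall>Y\<in>S. gen_circle Y \<and> (\<forall>X\<in>G. tangent Y X)"
  shows "card (image F ` G) = 4" "\<forall>X\<in>image F ` G. gen_circle X" "\<not> all_tangent_at_one_point (image F ` G)"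
    and "\<forall>Y\<in>image F ` S. gen_circle Y \<and> (\<forall>X\<in>image F ` G. tangent Y X)"
  using assms(2-) induces_card_image[OF assms(1)] induces_gen_circle[OF assms(1)]
    induces_all_tangent_iff[OF assms(1)] induces_tangent_iff[OF assms(1)] by auto

lemma given_not_point:
  assumes G: "card G = 4" "\<forall>X\<in>G. gen_circle X" "\<not> all_tangent_at_one_point G"
    and S: "card S = 6" "\<forall>Y\<in>S. gen_circle Y \<and> (\<forall>X\<in>G. tangent Y X)"
  shows "{P} \<notin> G"
proof
  assume "{P} \<in> G"
  obtain F T where F: "induces F T" "F P = None" using ex_induces_to_infinity by blast
  have "F ` {P} \<in> image F ` G" using \<open>{P} \<in> G\<close> by (rule imageI)
  then have inf: "{None} \<in> image F ` G" using F(2) by simp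
  note c = induces_configuration[OF F(1) G S(2)]
  have "card (image F ` S) \<le> 5" by (rule given_infinity_few_solutions[OF inf c(2,1,3,4)])
  then show False using induces_card_image[OF F(1), of S] S(1) by simp
qed

lemma no_common_point:
  assumes G: "card G = 4" "\<forall>X\<in>G. circline X" "\<not> all_tangent_at_one_point G"
    and S: "card S = 6" "\<forall>Y\<in>S. gen_circle Y \<and> (\<forall>X\<in>G. tangent Y X)"
  shows "\<exists>X\<in>G. P \<notin> X"
proof (rule ccontr)
  assume no: "\<not> ?thesis"
  obtain F T where F: "induces F T" "F P = None" using ex_induces_to_infinity by blast
  have gen: "\<forall>X\<in>G. gen_circle X" using G(2) by (simp add: gen_circle_iff)
  note c = induces_configuration[OF F(1) G(1) gen G(3) S(2)]
  have "\<forall>X\<in>image F ` G. circline X \<and> None \<in> X"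
  proof
    fix Z assume "Z \<in> image F ` G"
    then obtain X where X: "X \<in> G" "Z = F ` X" by blast
    then have "F P \<in> Z" using no by blast
    then show "circline Z \<and> None \<in> Z" using F G(2) X induces_circline_iff[OF F(1)] by simp
  qed
  then have "card (image F ` S) \<le> 5" by (rule given_lines_few_solutions[OF _ c(1,3,4)])
  then show False using induces_card_image[OF F(1), of S] S(1) by simp
qed

theorem mainTheorem3:
  fixes G S :: "epoint set set"
  assumes "card G = 4"
    and "\<forall>X\<in>G. gen_circle X"
    and "\<not> all_tangent_at_one_point G"
    and "card S = 6"
    and "\<forall>Y\<in>S. gen_circle Y \<and> (\<forall>X\<in>G. tangent Y X)"
  shows "\<exists>f. inv_sim_composition f \<and>
           (config1 (image f ` G) (image f ` S) \<or> config2 (image f ` G) (image f ` S) \<or>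
            config3 (image f ` G) (image f ` S) \<or> config4 (image f ` G) (image f ` S))"
proof -
  have circ: "circline X" if "X \<in> G" for X
    using given_not_point[OF assms(1-5)] assms(2) that by (auto simp: gen_circle_iff)
  then have "\<forall>X\<in>G. circline X" by blast
  note ncp = no_common_point[OF assms(1) this assms(3-5)]
  \<comment> \<open>A solution that is a point would lie on all four given circles.\<close>
  have solc: "circline Y" if Y: "Y \<in> S" for Y
  proof (rule ccontr)
    assume "\<not> circline Y"
    then obtain P where P: "Y = {P}" using assms(5) Y by (auto simp: gen_circle_iff)
    obtain X where X: "X \<in> G" "P \<notin> X" using ncp by blast
    obtain v where v: "ip v v = 1" "X = cyc v" using circ[OF X(1)] circline_iff by blast
    have "tangent {P} (cyc v)" using assms(5) Y X(1) P v(2) by blast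
    then show False using tangent_point_cyc_iff(1)[OF v(1)] X(2) v(2) by blast
  qed
  from card_4_obtain[OF assms(1)] obtain X1 X2 X3 X4 where
    X: "G = {X1, X2, X3, X4}" "distinct [X1, X2, X3, X4]" by blast
  have "\<exists>v. ip v v = 1 \<and> X = cyc v" if "X \<in> G" for X using circ[OF that] circline_iff by blast
  then obtain g1 g2 g3 g4 where g: "ip g1 g1 = 1" "X1 = cyc g1" "ip g2 g2 = 1" "X2 = cyc g2"
    "ip g3 g3 = 1" "X3 = cyc g3" "ip g4 g4 = 1" "X4 = cyc g4"
    using X(1) by (metis insertCI)
  have "X1 \<inter> X2 \<inter> X3 \<inter> X4 = {}" using ncp X(1) by blast
  moreover have "\<forall>Y\<in>S. circline Y \<and> tangent Y X1 \<and> tangent Y X2 \<and> tangent Y X3 \<and> tangent Y X4"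
    using solc assms(5) X(1) by blast
  ultimately have "six_tangent g1 g2 g3 g4 S"
    using X(2) assms(4) g unfolding six_tangent_def by blast
  from normalizable_six_tangent[OF this] have "normalizable G S" using X(1) g by simp
  then show ?thesis unfolding normalizable_def .
qed

end
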